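(* Let $N\ge3$, $2<q<2\cdot2^*$, $\tau\le0$ and $c>0$. Then problem (P) has no solution pair $(u,\lambda)\in\widetilde S(c)\times(0,\infty)$.
   Context: Let $N\ge3$, $2^*=\frac{2N}{N-2}$, $\tau\in\mathbb R$. Let $\widetilde X=\{u\in H^1(\mathbb R^N):\int_{\mathbb R^N}|u|^2|\nabla u|^2dx<\infty\}$ and, for $c>0$, $\widetilde S(c)=\{u\in\widetilde X:\int_{\mathbb R^N}|u|^2dx=c\}$. Problem (P) is $-\Delta u-u\Delta(u^2)+\lambda u=\tau|u|^{q-2}u+|u|^{2\cdot2^*-2}u$ in $\mathbb R^N$, $\int|u|^2=c$; a solution pair is $(u,\lambda)\in\widetilde S(c)\times\mathbb R$ with, for all $\varphi\in C_0^\infty(\mathbb R^N)$, $\int\nabla u\cdot\nabla\varphi+2\int\big(|u|^2\nabla u\cdot\nabla\varphi+u|\nabla u|^2\varphi\big)+\lambda\int u\varphi=\tau\int|u|^{q-2}u\varphi+\int|u|^{2\cdot2^*-2}u\varphi$ (solutions being regular enough that the associated Pohozaev identity holds). *)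

theory Defs
  imports "HOL-Analysis.Analysis"
begin

coinductive smooth_fun :: "('a::euclidean_space \<Rightarrow> real) \<Rightarrow> bool" where
  "(\<forall>x. f differentiable (at x)) \<Longrightarrow>
   (\<forall>i\<in>Basis. smooth_fun (\<lambda>x. frechet_derivative f (at x) i)) \<Longrightarrow> smooth_fun f"

definition test_fun :: "('a::euclidean_space \<Rightarrow> real) \<Rightarrow> bool" where
  "test_fun \<phi> \<longleftrightarrow> smooth_fun \<phi> \<and> compact (closure {x. \<phi> x \<noteq> 0})"

definition cgrad :: "('a::euclidean_space \<Rightarrow> real) \<Rightarrow> 'a \<Rightarrow> 'a" where
  "cgrad \<phi> x = (\<Sum>i\<in>Basis. frechet_derivative \<phi> (at x) i *\<^sub>R i)"

definition weak_grad :: "('a::euclidean_space \<Rightarrow> real) \<Rightarrow> ('a \<Rightarrow> 'a) \<Rightarrow> bool" where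
  "weak_grad u g \<longleftrightarrow> (\<forall>\<phi>. test_fun \<phi> \<longrightarrow> (\<forall>i\<in>Basis.
      (\<integral>x. u x * frechet_derivative \<phi> (at x) i \<partial>lborel) = - (\<integral>x. (g x \<bullet> i) * \<phi> x \<partial>lborel)))"

definition H1_with_grad :: "('a::euclidean_space \<Rightarrow> real) \<Rightarrow> ('a \<Rightarrow> 'a) \<Rightarrow> bool" where
  "H1_with_grad u g \<longleftrightarrow> u \<in> borel_measurable lborel \<and> g \<in> borel_measurable lborel \<and>
     integrable lborel (\<lambda>x. (u x)\<^sup>2) \<and> integrable lborel (\<lambda>x. (norm (g x))\<^sup>2) \<and> weak_grad u g"

definition Xt_with_grad :: "('a::euclidean_space \<Rightarrow> real) \<Rightarrow> ('a \<Rightarrow> 'a) \<Rightarrow> bool" where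
  "Xt_with_grad u g \<longleftrightarrow> H1_with_grad u g \<and> integrable lborel (\<lambda>x. (u x)\<^sup>2 * (norm (g x))\<^sup>2)"

definition crit_exp :: "'a::euclidean_space itself \<Rightarrow> real" where
  "crit_exp _ = 2 * real DIM('a) / (real DIM('a) - 2)"

text \<open>Weak formulation of
  -Delta u - u Delta(u^2) + lambda u = tau |u|^(q-2) u + |u|^(2 2^* - 2) u.\<close>
definition weak_eq :: "real \<Rightarrow> real \<Rightarrow> ('a::euclidean_space \<Rightarrow> real) \<Rightarrow> ('a \<Rightarrow> 'a) \<Rightarrow> real \<Rightarrow> bool" where
  "weak_eq \<tau> q u g lam \<longleftrightarrow> (\<forall>\<phi>. test_fun \<phi> \<longrightarrow>
     (\<integral>x. g x \<bullet> cgrad \<phi> x \<partial>lborel)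
     + 2 * (\<integral>x. (u x)\<^sup>2 * (g x \<bullet> cgrad \<phi> x) + u x * (norm (g x))\<^sup>2 * \<phi> x \<partial>lborel)
     + lam * (\<integral>x. u x * \<phi> x \<partial>lborel)
     = \<tau> * (\<integral>x. \<bar>u x\<bar> powr (q - 2) * u x * \<phi> x \<partial>lborel)
       + (\<integral>x. \<bar>u x\<bar> powr (2 * crit_exp TYPE('a) - 2) * u x * \<phi> x \<partial>lborel))"

definition pohozaev :: "real \<Rightarrow> real \<Rightarrow> ('a::euclidean_space \<Rightarrow> real) \<Rightarrow> ('a \<Rightarrow> 'a) \<Rightarrow> real \<Rightarrow> bool" where
  "pohozaev \<tau> q u g lam \<longleftrightarrow>
     (real DIM('a) - 2) / 2 * (\<integral>x. (1 + 2 * (u x)\<^sup>2) * (norm (g x))\<^sup>2 \<partial>lborel)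
     + real DIM('a) * lam / 2 * (\<integral>x. (u x)\<^sup>2 \<partial>lborel)
     = real DIM('a) * \<tau> / q * (\<integral>x. \<bar>u x\<bar> powr q \<partial>lborel)
       + real DIM('a) / (2 * crit_exp TYPE('a)) * (\<integral>x. \<bar>u x\<bar> powr (2 * crit_exp TYPE('a)) \<partial>lborel)"

text \<open>(u, lambda) is a solution pair of problem (P) with mass c: u in S-tilde(c), the weak
  equation holds, and (standing regularity assumption) the Pohozaev identity holds.\<close>
definition solution_pair :: "real \<Rightarrow> real \<Rightarrow> real \<Rightarrow> ('a::euclidean_space \<Rightarrow> real) \<Rightarrow> real \<Rightarrow> bool" where
  "solution_pair \<tau> q c u lam \<longleftrightarrow> (\<exists>g. Xt_with_grad u g \<and> (\<integral>x. (u x)\<^sup>2 \<partial>lborel) = c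
      \<and> weak_eq \<tau> q u g lam \<and> pohozaev \<tau> q u g lam)"

end

theory Submission
  imports Defs
begin

text \<open>
  If \<open>|u|\<close> to the power \<open>2 \<cdot> 2\<^sup>*\<close> is not integrable, its Bochner integral is \<open>0\<close> and the Pohozaev identity
  equates a positive and a nonpositive number. Otherwise \<open>u\<close> may be used as a test function, and
  subtracting the result from the Pohozaev identity gives
  \<open>(N-2)/4 \<integral>|\<nabla>u|\<^sup>2 + (N+2)/4 \<lambda> c = (N/q - (N-2)/4) \<tau> \<integral>|u|\<^sup>q\<close>, where the left side is positive and the
  right side is not.

  The difficulty is the testing with \<open>u\<close>, since smooth functions need not be dense for the weight
  \<open>1 + 2u\<^sup>2\<close>. Write the equation as \<open>-\<Delta>w = F\<close> with \<open>w = u + 2u\<^sup>3/3\<close>, test it only with the rescaled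
  translates \<open>k((\<cdot> - y)/\<epsilon>)\<close> of an even bump \<open>k\<close>, multiply by \<open>\<theta>(u(y))\<close> with \<open>\<theta>\<close> bounded, and integrate
  over \<open>y\<close>. As \<open>\<Delta>k\<close> is even and has integral \<open>0\<close>, the left side becomes the integral over \<open>y\<close> and \<open>z\<close> of
  \<open>\<Delta>k(z)/2\<close> times the product of the increments of \<open>w\<close> and \<open>\<theta>(u)\<close> from \<open>y\<close> to \<open>y + \<epsilon>z\<close>, divided by \<open>\<epsilon>\<^sup>2\<close>.
  This product is dominated by the squared increments of \<open>u\<close> and \<open>u|u|\<close>, both of which have a square
  integrable weak gradient, so one can let \<open>\<epsilon> \<longrightarrow> 0\<close>.
\<close>

subsection \<open>Translations in mean\<close>

text \<open>The auxiliary function \<open>u |u|\<close> is chosen because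
  \<open>|\<nabla>(u |u|)|^2 = 4 u^2 |\<nabla>u|^2\<close>: the weighted energy is a combination of
  two unweighted ones, and difference quotients of functions with finite unweighted energy converge
  in mean square by continuity of translations. Boundedness of \<open>\<theta>\<close> is dictated
  by the right side \<open>F\<close>. The term \<open>u |\<nabla>u|^2\<close> and the power
  nonlinearities at large \<open>|u|\<close> are only known to be integrable, while the terms at
  small \<open>|u|\<close>, such as a multiple of \<open>u\<close>, are only known to be square
  integrable. Hence \<open>F\<close> is carried along as an integrable plus a square integrable
  function, and \<open>\<theta>(u)\<close> has to be both bounded and square integrable. The passage
  from squared directional derivatives \<open>(\<nabla>u \<bullet> z)^2\<close> to
  \<open>|\<nabla>u|^2\<close> rests on the second moments of the Laplacian of the bump: its
  integral against \<open>(a \<bullet> z)^2\<close> is \<open>2 |a|^2\<close> times the integral of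
  \<open>k\<close>, since \<open>(a \<bullet> z)^2\<close> itself has Laplacian
  \<open>2 |a|^2\<close>.\<close>

lemma lborel_integrable_translate:
  fixes f :: "'a::euclidean_space \<Rightarrow> real"
  assumes "integrable lborel f"
  shows "integrable lborel (\<lambda>x. f (x + h))"
proof -
  have f: "f \<in> borel_measurable borel" using assms by auto
  have "integrable (distr lborel borel ((+) h)) f"
    using assms by (simp add: lborel_distr_plus)
  then have "integrable lborel (\<lambda>x. f (h + x))"
    by (subst (asm) integrable_distr_eq) (use f in auto)
  then show ?thesis by (simp add: add.commute)
qed

lemma lborel_integral_translate:
  fixes f :: "'a::euclidean_space \<Rightarrow> real"
  assumes [measurable]: "f \<in> borel_measurable borel"
  shows "(LBINT x. f (x + h)) = (LBINT x. f x)"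
proof -
  have "(LBINT x. f x) = (\<integral>x. f x \<partial>distr lborel borel ((+) h))"
    by (simp add: lborel_distr_plus)
  also have "\<dots> = (LBINT x. f (h + x))"
    by (subst integral_distr) auto
  finally show ?thesis by (simp add: add.commute)
qed

lemma lborel_integral_affine:
  fixes f :: "'a::euclidean_space \<Rightarrow> real"
  assumes [measurable]: "f \<in> borel_measurable borel" and "c \<noteq> 0"
  shows "(LBINT x. f x) = \<bar>c\<bar> ^ DIM('a) * (LBINT x. f (t + c *\<^sub>R x))"
proof -
  have "(LBINT x. f x)
      = (\<integral>x. f x \<partial>density (distr lborel borel (\<lambda>x. t + c *\<^sub>R x)) (\<lambda>_. ennreal (\<bar>c\<bar> ^ DIM('a))))"
    by (subst lborel_affine[OF assms(2), of t]) (simp add: ennreal_power)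
  also have "\<dots> = (LBINT x. \<bar>c\<bar> ^ DIM('a) * f (t + c *\<^sub>R x))"
    by (subst integral_density) (auto simp: integral_distr)
  finally show ?thesis by simp
qed

lemma lborel_integral_reflect:
  fixes f :: "'a::euclidean_space \<Rightarrow> real"
  assumes "f \<in> borel_measurable borel"
  shows "(LBINT x. f (- x)) = (LBINT x. f x)"
  using lborel_integral_affine[OF assms, of "-1" 0] by simp

lemma integral_abs_add_le:
  fixes f g :: "'a \<Rightarrow> real"
  assumes "integrable M f" "integrable M g"
  shows "(\<integral>x. \<bar>f x + g x\<bar> \<partial>M) \<le> (\<integral>x. \<bar>f x\<bar> \<partial>M) + (\<integral>x. \<bar>g x\<bar> \<partial>M)"
proof -
  have "(\<integral>x. \<bar>f x + g x\<bar> \<partial>M) \<le> (\<integral>x. \<bar>f x\<bar> + \<bar>g x\<bar> \<partial>M)"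
    using assms by (intro integral_mono) auto
  then show ?thesis using assms by simp
qed

section \<open>Continuity of translations in \<open>L^1\<close> and in \<open>L^2\<close>\<close>

text \<open>Openness puts \<open>x + h n\<close> into \<open>U\<close> eventually for every
  \<open>x \<in> U\<close>, so the part of \<open>U\<close> that is lost by translation shrinks to
  nothing pointwise and is dominated by the indicator of \<open>U\<close>. The translated sets
  themselves have no such fixed dominating function.\<close>

lemma tendsto_translate_L1_open:
  fixes U :: "'a::euclidean_space set" and h :: "nat \<Rightarrow> 'a"
  assumes U: "open U" "emeasure lborel U < \<infinity>" and h: "h \<longlonglongrightarrow> 0"
  shows "(\<lambda>n. \<integral>x. \<bar>indicat_real U (x + h n) - indicat_real U x\<bar> \<partial>lborel) \<longlonglongrightarrow> 0"
proof -
  have i: "integrable lborel (indicator U :: 'a \<Rightarrow> real)"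
    using U by (auto simp: integrable_indicator_iff)
  have [measurable]: "U \<in> sets borel" using U by auto
  \<comment> \<open>Both integrals agree, so the positive part of the difference controls its absolute value.\<close>
  have eq: "(LBINT x. \<bar>indicat_real U (x + h n) - indicat_real U x\<bar>)
      = 2 * (LBINT x. max 0 (indicat_real U x - indicat_real U (x + h n)))" for n
  proof -
    have it: "integrable lborel (\<lambda>x. indicator U (x + h n) :: real)"
      by (rule lborel_integrable_translate[OF i])
    have "(LBINT x. \<bar>indicat_real U (x + h n) - indicat_real U x\<bar>)
      = (LBINT x. 2 * max 0 (indicat_real U x - indicat_real U (x + h n))
              + (indicat_real U (x + h n) - indicat_real U x))"
      by (intro Bochner_Integration.integral_cong) (auto simp: indicator_def max_def)
    also have "\<dots> = 2 * (LBINT x. max 0 (indicat_real U x - indicat_real U (x + h n)))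
              + ((LBINT x. indicator U (x + h n)) - (LBINT x. indicator U x))"
      using i it by (subst Bochner_Integration.integral_add) auto
    also have "(LBINT x. indicat_real U (x + h n)) = (LBINT x. indicator U x)"
      by (rule lborel_integral_translate) auto
    finally show ?thesis by simp
  qed
  have "(\<lambda>n. \<integral>x. max 0 (indicat_real U x - indicat_real U (x + h n)) \<partial>lborel)
      \<longlonglongrightarrow> (\<integral>x. 0 \<partial>(lborel :: 'a measure))"
  proof (rule integral_dominated_convergence[OF _ _ i])
    show "AE x in lborel. (\<lambda>n. max 0 (indicat_real U x - indicat_real U (x + h n))) \<longlonglongrightarrow> 0"
    proof (intro AE_I2)
      fix x :: 'a
      show "(\<lambda>n. max 0 (indicat_real U x - indicat_real U (x + h n))) \<longlonglongrightarrow> 0"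
      proof (cases "x \<in> U")
        case True
        have "(\<lambda>n. x + h n) \<longlonglongrightarrow> x" using tendsto_add[OF tendsto_const h, of x] by simp
        then have "\<forall>\<^sub>F n in sequentially. x + h n \<in> U"
          using U True by (simp add: topological_tendstoD)
        then have "\<forall>\<^sub>F n in sequentially. max 0 (indicat_real U x - indicat_real U (x + h n)) = 0"
          by eventually_elim (use True in auto)
        then show ?thesis by (simp add: tendsto_eventually)
      qed simp
    qed
  qed (auto simp: indicator_def)
  then show ?thesis unfolding eq by (auto intro: tendsto_mult_right_zero)
qed

lemma tendsto_translate_L1:
  fixes f :: "'a::euclidean_space \<Rightarrow> real" and h :: "nat \<Rightarrow> 'a"
  assumes f: "integrable lborel f" and h: "h \<longlonglongrightarrow> 0"
  shows "(\<lambda>n. \<integral>x. \<bar>f (x + h n) - f x\<bar> \<partial>lborel) \<longlonglongrightarrow> 0"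
proof -
  \<comment> \<open>Translation is an isometry of \<open>L^1\<close>, so the functions with the
    property form a closed set. This is applied twice: to reach a Borel set from open sets
    containing it, and to reach a general function from simple ones.\<close>
  have approx: "(\<lambda>n. \<integral>x. \<bar>f (x + h n) - f x\<bar> \<partial>lborel) \<longlonglongrightarrow> 0"
    if f: "integrable lborel f"
      and ap: "\<And>e. e > 0 \<Longrightarrow> \<exists>s. integrable lborel s \<and> (LBINT x. \<bar>f x - s x\<bar>) < e
        \<and> (\<lambda>n. \<integral>x. \<bar>s (x + h n) - s x\<bar> \<partial>lborel) \<longlonglongrightarrow> 0" for f :: "'a \<Rightarrow> real"
  proof (rule LIMSEQ_I)
    fix r :: real assume "r > 0"
    then obtain s where s: "integrable lborel s" and d: "(LBINT x. \<bar>f x - s x\<bar>) < r / 4"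
        and c: "(\<lambda>n. \<integral>x. \<bar>s (x + h n) - s x\<bar> \<partial>lborel) \<longlonglongrightarrow> 0"
      using ap[of "r/4"] by auto
    obtain N where N: "\<And>n. n \<ge> N \<Longrightarrow> \<bar>\<integral>x. \<bar>s (x + h n) - s x\<bar> \<partial>lborel\<bar> < r / 4"
      using LIMSEQ_D[OF c, of "r/4"] \<open>r > 0\<close> by auto
    show "\<exists>N. \<forall>n\<ge>N. norm ((LBINT x. \<bar>f (x + h n) - f x\<bar>) - 0) < r"
    proof (intro exI allI impI)
      fix n assume "n \<ge> N"
      have [measurable]: "f \<in> borel_measurable borel" "s \<in> borel_measurable borel" using f s by auto
      note fi = lborel_integrable_translate[OF f, of "h n"]
      note si = lborel_integrable_translate[OF s, of "h n"]
      have "(LBINT x. \<bar>f (x + h n) - f x\<bar>)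
          \<le> (LBINT x. \<bar>f (x + h n) - s (x + h n)\<bar> + \<bar>s (x + h n) - s x\<bar> + \<bar>f x - s x\<bar>)"
        using fi si f s by (intro integral_mono) auto
      also have "\<dots> = (LBINT x. \<bar>f (x + h n) - s (x + h n)\<bar>)
          + (LBINT x. \<bar>s (x + h n) - s x\<bar>) + (LBINT x. \<bar>f x - s x\<bar>)"
        using fi si f s by simp
      also have "(LBINT x. \<bar>f (x + h n) - s (x + h n)\<bar>) = (LBINT x. \<bar>f x - s x\<bar>)"
        by (rule lborel_integral_translate[of "\<lambda>x. \<bar>f x - s x\<bar>"]) auto
      finally have "(LBINT x. \<bar>f (x + h n) - f x\<bar>) < r"
        using N[OF \<open>n \<ge> N\<close>] d \<open>r > 0\<close> by linarith
      moreover have "(LBINT x. \<bar>f (x + h n) - f x\<bar>) \<ge> 0" by simp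
      ultimately show "norm ((LBINT x. \<bar>f (x + h n) - f x\<bar>) - 0) < r" by simp
    qed
  qed
  show ?thesis using f
  proof induct
    case (base A c)
    have Ab[measurable]: "A \<in> sets borel" using base by simp
    have Ai: "integrable lborel (indicator A :: 'a \<Rightarrow> real)"
      using base by (auto simp: integrable_indicator_iff)
    have "(\<lambda>n. \<integral>x. \<bar>indicator A (x + h n) - indicator A x :: real\<bar> \<partial>lborel) \<longlonglongrightarrow> 0"
    proof (rule approx[OF Ai])
      fix e :: real assume "e > 0"
      then obtain U where U: "open U" "A \<subseteq> U" "emeasure lborel (U - A) < ennreal e"
        using outer_regular_lborel[OF Ab] by blast
      have [measurable]: "U \<in> sets borel" using U by auto
      have "emeasure lborel U = emeasure lborel A + emeasure lborel (U - A)"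
        using U by (subst plus_emeasure) (auto intro!: arg_cong[where f="emeasure lborel"])
      also have "\<dots> < \<infinity>" using U base by (auto simp: less_top[symmetric] top_unique)
      finally have fin: "emeasure lborel U < \<infinity>" .
      have "(LBINT x. \<bar>indicator A x - indicator U x :: real\<bar>) = (LBINT x. indicator (U - A) x)"
        using U(2) by (intro Bochner_Integration.integral_cong) (auto simp: indicator_def)
      also have "\<dots> = measure lborel (U - A)" by simp
      also have "\<dots> < e" using U(3) \<open>e > 0\<close>
        by (cases "emeasure lborel (U - A) = \<infinity>")
          (auto simp: emeasure_eq_ennreal_measure ennreal_less_iff)
      finally show "\<exists>s. integrable lborel s \<and> (LBINT x. \<bar>indicator A x - s x\<bar>) < e
        \<and> (\<lambda>n. \<integral>x. \<bar>s (x + h n) - s x\<bar> \<partial>lborel) \<longlonglongrightarrow> 0"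
        using fin tendsto_translate_L1_open[OF U(1) fin h]
        by (intro exI[of _ "indicator U"]) (auto simp: integrable_indicator_iff)
    qed
    then have "(\<lambda>n. \<bar>c\<bar> * (LBINT x. \<bar>indicator A (x + h n) - indicator A x :: real\<bar>)) \<longlonglongrightarrow> 0"
      by (rule tendsto_mult_right_zero)
    moreover have "(LBINT x. \<bar>indicator A (x + h n) *\<^sub>R c - indicator A x *\<^sub>R c\<bar>)
       = \<bar>c\<bar> * (LBINT x. \<bar>indicator A (x + h n) - indicator A x :: real\<bar>)" for n
      unfolding integral_mult_right_zero[symmetric]
      by (intro Bochner_Integration.integral_cong) (auto simp: indicator_def)
    ultimately show ?case by simp
  next
    case (add f g)
    show ?case
    proof (rule tendsto_sandwich[OF _ _ tendsto_const])
      show "(\<lambda>n. (LBINT x. \<bar>f (x + h n) - f x\<bar>) + (LBINT x. \<bar>g (x + h n) - g x\<bar>)) \<longlonglongrightarrow> 0"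
        using tendsto_add[OF add(2) add(4)] by simp
      have "(LBINT x. \<bar>(f (x + h n) + g (x + h n)) - (f x + g x)\<bar>)
        \<le> (LBINT x. \<bar>f (x + h n) - f x\<bar>) + (LBINT x. \<bar>g (x + h n) - g x\<bar>)" for n
        using integral_abs_add_le[of lborel "\<lambda>x. f (x + h n) - f x" "\<lambda>x. g (x + h n) - g x"]
          add(1,3)[THEN lborel_integrable_translate] add(1,3) by (simp add: algebra_simps)
      then show "\<forall>\<^sub>F n in sequentially. (LBINT x. \<bar>(f (x + h n) + g (x + h n)) - (f x + g x)\<bar>)
        \<le> (LBINT x. \<bar>f (x + h n) - f x\<bar>) + (LBINT x. \<bar>g (x + h n) - g x\<bar>)"
        by simp
    qed simp
  next
    case (lim f s)
    show ?case
    proof (rule approx[OF lim(5)])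
      fix e :: real assume "e > 0"
      have [measurable]: "f \<in> borel_measurable borel" "\<And>i. s i \<in> borel_measurable borel"
        using lim(5) lim(1)[THEN borel_measurable_integrable] by auto
      \<comment> \<open>The induction rule bounds \<open>\<bar>s i x\<bar>\<close> by
        \<open>2 * \<bar>f x\<bar>\<close>, hence the factor 3 in the dominating function.\<close>
      have "(\<lambda>i. \<integral>x. \<bar>f x - s i x\<bar> \<partial>lborel) \<longlonglongrightarrow> (\<integral>x. 0 \<partial>(lborel :: 'a measure))"
      proof (rule integral_dominated_convergence[where w = "\<lambda>x. 3 * \<bar>f x\<bar>"])
        show "AE x in lborel. (\<lambda>i. \<bar>f x - s i x\<bar>) \<longlonglongrightarrow> 0"
        proof (intro AE_I2)
          fix x :: 'a
          have "(\<lambda>i. s i x) \<longlonglongrightarrow> f x" using lim(3)[of x] by simp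
          then have "(\<lambda>i. f x - s i x) \<longlonglongrightarrow> 0" using tendsto_diff[OF tendsto_const, of "\<lambda>i. s i x" "f x" sequentially "f x"] by simp
          then show "(\<lambda>i. \<bar>f x - s i x\<bar>) \<longlonglongrightarrow> 0" by (rule tendsto_rabs_zero)
        qed
        show "AE x in lborel. norm \<bar>f x - s i x\<bar> \<le> 3 * \<bar>f x\<bar>" for i
        proof (intro AE_I2)
          fix x :: 'a
          show "norm \<bar>f x - s i x\<bar> \<le> 3 * \<bar>f x\<bar>" using lim(4)[of x i] by simp
        qed
      qed (use lim(5) in auto)
      then have "(\<lambda>i. \<integral>x. \<bar>f x - s i x\<bar> \<partial>lborel) \<longlonglongrightarrow> 0" by simp
      then have "\<forall>\<^sub>F i in sequentially. (LBINT x. \<bar>f x - s i x\<bar>) < e"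
        using \<open>e > 0\<close> by (rule order_tendstoD)
      then obtain i where "(LBINT x. \<bar>f x - s i x\<bar>) < e"
        by (meson eventually_sequentially order_refl)
      then show "\<exists>s. integrable lborel s \<and> (LBINT x. \<bar>f x - s x\<bar>) < e
        \<and> (\<lambda>n. \<integral>x. \<bar>s (x + h n) - s x\<bar> \<partial>lborel) \<longlonglongrightarrow> 0"
        using lim(1,2) by blast
    qed
  qed
qed

text \<open>The map \<open>s |s|\<close> sends square integrable functions to integrable ones, and
  this bound controls its inverse, so continuity of translations in \<open>L^2\<close> can be read
  off from \<open>L^1\<close>. For equal signs the factor 1 would do; for opposite signs the
  estimate is \<open>(a - b)^2 \<le> 2 (a^2 + b^2)\<close>, with equality at
  \<open>a = - b\<close>.\<close>

lemma abs_mult_self_diff_bound: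
  fixes a b :: real
  shows "(a - b)\<^sup>2 \<le> 2 * \<bar>a * \<bar>a\<bar> - b * \<bar>b\<bar>\<bar>"
proof -
  have same: "(a - b)\<^sup>2 \<le> 2 * \<bar>a * a - b * b\<bar>" if "a \<ge> 0" "b \<ge> 0" for a b :: real
  proof -
    have "\<bar>a - b\<bar> * \<bar>a - b\<bar> \<le> \<bar>a - b\<bar> * (a + b)"
      using that by (intro mult_left_mono) auto
    also have "\<dots> = \<bar>(a - b) * (a + b)\<bar>" using that by (simp add: abs_mult)
    also have "\<dots> = \<bar>a * a - b * b\<bar>" by (simp add: algebra_simps)
    finally have "(a - b)\<^sup>2 \<le> \<bar>a * a - b * b\<bar>" by (simp add: power2_eq_square)
    then show ?thesis by (rule order_trans) simp
  qed
  have opp: "(a - b)\<^sup>2 \<le> 2 * (a * a + b * b)" for a b :: real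
    using sum_squares_ge_zero[of "a + b" 0] by (simp add: power2_eq_square algebra_simps)
  consider "a \<ge> 0" "b \<ge> 0" | "a < 0" "b < 0" | "a \<ge> 0" "b < 0" | "a < 0" "b \<ge> 0" by linarith
  then show ?thesis
  proof cases
    case 1 then show ?thesis using same[of a b] by simp
  next
    case 2
    have "\<bar>a * \<bar>a\<bar> - b * \<bar>b\<bar>\<bar> = \<bar>(- a) * (- a) - (- b) * (- b)\<bar>" using 2 by (simp add: abs_minus_commute)
    moreover have "(a - b)\<^sup>2 = (- a - - b)\<^sup>2" by (simp add: power2_commute)
    ultimately show ?thesis using same[of "-a" "-b"] 2 by simp
  next
    case 3 then show ?thesis using opp[of a b] by simp
  next
    case 4 then show ?thesis using opp[of a b] by (simp add: abs_if)
  qed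
qed

lemma tendsto_translate_L2:
  fixes f :: "'a::euclidean_space \<Rightarrow> real" and h :: "nat \<Rightarrow> 'a"
  assumes [measurable]: "f \<in> borel_measurable borel"
    and f: "integrable lborel (\<lambda>x. (f x)\<^sup>2)" and h: "h \<longlonglongrightarrow> 0"
  shows "(\<lambda>n. \<integral>x. (f (x + h n) - f x)\<^sup>2 \<partial>lborel) \<longlonglongrightarrow> 0"
proof -
  let ?F = "\<lambda>x. f x * \<bar>f x\<bar>"
  have F: "integrable lborel ?F"
    by (rule Bochner_Integration.integrable_bound[OF f]) (auto simp: power2_eq_square abs_mult)
  note Ft = lborel_integrable_translate[OF F]
  have "(\<lambda>n. 2 * (LBINT x. \<bar>?F (x + h n) - ?F x\<bar>)) \<longlonglongrightarrow> 0"
    by (intro tendsto_mult_right_zero tendsto_translate_L1 F h)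
  moreover have "(LBINT x. (f (x + h n) - f x)\<^sup>2) \<le> 2 * (LBINT x. \<bar>?F (x + h n) - ?F x\<bar>)" for n
    unfolding integral_mult_right_zero[symmetric]
    using F Ft[of "h n"] abs_mult_self_diff_bound
    by (intro integral_mono')  auto
  ultimately show ?thesis
    by - (rule Lim_null_comparison[rotated], assumption, rule always_eventually, simp)
qed

subsection \<open>Square integrable functions\<close>

definition square_integrable :: "'a measure \<Rightarrow> ('a \<Rightarrow> real) \<Rightarrow> bool" where
  "square_integrable M f \<longleftrightarrow> f \<in> borel_measurable M \<and> integrable M (\<lambda>x. (f x)\<^sup>2)"

lemma square_integrable_measurable[measurable_dest]:
  "square_integrable M f \<Longrightarrow> f \<in> borel_measurable M"
  by (simp add: square_integrable_def)

lemma square_integrableD: "square_integrable M f \<Longrightarrow> integrable M (\<lambda>x. (f x)\<^sup>2)"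
  by (simp add: square_integrable_def)

lemma integrable_real_bound:
  fixes f g :: "'a \<Rightarrow> real"
  assumes "integrable M g" "f \<in> borel_measurable M" "\<And>x. \<bar>f x\<bar> \<le> g x"
  shows "integrable M f"
proof (rule Bochner_Integration.integrable_bound[OF assms(1,2)], rule AE_I2)
  show "norm (f x) \<le> norm (g x)" for x
    using assms(3)[of x] by simp
qed

lemma square_integrable_bound:
  assumes f: "square_integrable M f" and [measurable]: "g \<in> borel_measurable M"
    and b: "\<And>x. \<bar>g x\<bar> \<le> C * \<bar>f x\<bar>"
  shows "square_integrable M g"
  unfolding square_integrable_def
proof
  show "g \<in> borel_measurable M" by fact
  have "(g x)\<^sup>2 \<le> C\<^sup>2 * (f x)\<^sup>2" for x
    using power_mono[OF b[of x] abs_ge_zero, of 2] by (simp add: power_mult_distrib)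
  then show "integrable M (\<lambda>x. (g x)\<^sup>2)"
    using integrable_mult_right[OF square_integrableD[OF f], of "C\<^sup>2"]
    by (intro Bochner_Integration.integrable_bound[of M "\<lambda>x. C\<^sup>2 * (f x)\<^sup>2" "\<lambda>x. (g x)\<^sup>2"] AE_I2) simp_all
qed

lemma square_integrable_add:
  assumes f: "square_integrable M f" and g: "square_integrable M g"
  shows "square_integrable M (\<lambda>x. f x + g x)"
  unfolding square_integrable_def
proof
  note [measurable] = f[THEN square_integrable_measurable] g[THEN square_integrable_measurable]
  show "(\<lambda>x. f x + g x) \<in> borel_measurable M" by simp
  have "(a + b)\<^sup>2 \<le> 2 * (a\<^sup>2 + b\<^sup>2)" for a b :: real
    using zero_le_power2[of "a - b"] by (simp add: power2_eq_square algebra_simps)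
  then show "integrable M (\<lambda>x. (f x + g x)\<^sup>2)"
    using f[THEN square_integrableD] g[THEN square_integrableD]
    by (intro Bochner_Integration.integrable_bound[of M "\<lambda>x. 2 * ((f x)\<^sup>2 + (g x)\<^sup>2)" "\<lambda>x. (f x + g x)\<^sup>2"] AE_I2)
      simp_all
qed

lemma square_integrable_cmult:
  assumes f: "square_integrable M f"
  shows "square_integrable M (\<lambda>x. c * f x)"
proof (rule square_integrable_bound[OF f])
  show "(\<lambda>x. c * f x) \<in> borel_measurable M" using square_integrable_measurable[OF f] by simp
  show "\<bar>c * f x\<bar> \<le> \<bar>c\<bar> * \<bar>f x\<bar>" for x by (simp add: abs_mult)
qed

lemma square_integrable_abs:
  "square_integrable M f \<Longrightarrow> square_integrable M (\<lambda>x. \<bar>f x\<bar>)"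
  by (simp add: square_integrable_def borel_measurable_abs)

lemma square_integrable_diff:
  assumes f: "square_integrable M f" and g: "square_integrable M g"
  shows "square_integrable M (\<lambda>x. f x - g x)"
  using square_integrable_add[OF f square_integrable_cmult[OF g, of "-1"]] by (simp only: mult_minus1 diff_conv_add_uminus)

lemma square_integrable_translate:
  fixes f :: "'a::euclidean_space \<Rightarrow> real"
  assumes f: "square_integrable lborel f"
  shows "square_integrable lborel (\<lambda>x. f (x + h))"
  unfolding square_integrable_def
proof
  have [measurable]: "f \<in> borel_measurable borel" using square_integrable_measurable[OF f] by simp
  show "(\<lambda>x. f (x + h)) \<in> borel_measurable lborel" by measurable
qed (rule lborel_integrable_translate[OF square_integrableD[OF f]])

lemma square_integrable_difference_quotient:
  fixes f :: "'a::euclidean_space \<Rightarrow> real"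
  assumes f: "square_integrable lborel f"
  shows "square_integrable lborel (\<lambda>x. (f (x + h) - f x) / c)"
  using square_integrable_cmult[OF square_integrable_diff[OF square_integrable_translate[OF f, of h] f], of "1 / c"]
  by simp

lemma square_integrable_inner:
  assumes g[measurable]: "g \<in> borel_measurable M" and "integrable M (\<lambda>x. (norm (g x :: 'b::euclidean_space))\<^sup>2)"
  shows "square_integrable M (\<lambda>x. g x \<bullet> z)"
proof (rule square_integrable_bound)
  show "square_integrable M (\<lambda>x. norm (g x))" using assms by (simp add: square_integrable_def)
  show "\<bar>g x \<bullet> z\<bar> \<le> norm z * \<bar>norm (g x)\<bar>" for x
    using Cauchy_Schwarz_ineq2[of "g x" z] by (simp add: mult.commute)
qed measurable

lemma integrable_square_integrable_mult:
  assumes f: "square_integrable M f" and g: "square_integrable M g"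
  shows "integrable M (\<lambda>x. f x * g x)"
proof -
  note [measurable] = f[THEN square_integrable_measurable] g[THEN square_integrable_measurable]
  have bound: "\<bar>f x * g x\<bar> \<le> (f x)\<^sup>2 + (g x)\<^sup>2" for x
  proof -
    have "0 \<le> (\<bar>f x\<bar> - \<bar>g x\<bar>)\<^sup>2" by simp
    also have "\<dots> = (f x)\<^sup>2 + (g x)\<^sup>2 - 2 * \<bar>f x * g x\<bar>"
      by (simp add: power2_diff abs_mult)
    finally show ?thesis using abs_ge_zero[of "f x * g x"] by linarith
  qed
  have "integrable M (\<lambda>x. (f x)\<^sup>2 + (g x)\<^sup>2)"
    using f[THEN square_integrableD] g[THEN square_integrableD] by (rule Bochner_Integration.integrable_add)
  then show ?thesis by (rule integrable_real_bound[OF _ _ bound]) measurable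
qed

lemma integral_Cauchy_Schwarz:
  assumes f: "square_integrable M f" and g: "square_integrable M g"
  shows "(\<integral>x. \<bar>f x * g x\<bar> \<partial>M) \<le> sqrt (\<integral>x. (f x)\<^sup>2 \<partial>M) * sqrt (\<integral>x. (g x)\<^sup>2 \<partial>M)"
proof -
  note [measurable] = f[THEN square_integrable_measurable] g[THEN square_integrable_measurable]
  have i: "integrable M (\<lambda>x. \<bar>f x * g x\<bar>)"
    using integrable_square_integrable_mult[OF f g] by simp
  have nn: "0 \<le> (\<integral>x. (f x)\<^sup>2 \<partial>M)" "0 \<le> (\<integral>x. (g x)\<^sup>2 \<partial>M)" by auto
  have "(ennreal (\<integral>x. \<bar>f x * g x\<bar> \<partial>M))\<^sup>2 = (\<integral>\<^sup>+x. ennreal \<bar>f x\<bar> * ennreal \<bar>g x\<bar> \<partial>M)\<^sup>2"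
    using nn_integral_eq_integral[OF i] by (simp add: abs_mult ennreal_mult)
  also have "\<dots> \<le> (\<integral>\<^sup>+x. (ennreal \<bar>f x\<bar>)\<^sup>2 \<partial>M) * (\<integral>\<^sup>+x. (ennreal \<bar>g x\<bar>)\<^sup>2 \<partial>M)"
    by (rule Cauchy_Schwarz_nn_integral) auto
  also have "\<dots> = ennreal (\<integral>x. (f x)\<^sup>2 \<partial>M) * ennreal (\<integral>x. (g x)\<^sup>2 \<partial>M)"
    using nn_integral_eq_integral[OF square_integrableD[OF f]]
      nn_integral_eq_integral[OF square_integrableD[OF g]]
    by (simp add: ennreal_power)
  finally have "ennreal ((\<integral>x. \<bar>f x * g x\<bar> \<partial>M)\<^sup>2) \<le> ennreal ((\<integral>x. (f x)\<^sup>2 \<partial>M) * (\<integral>x. (g x)\<^sup>2 \<partial>M))"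
    using nn by (simp add: ennreal_power ennreal_mult)
  then have "(\<integral>x. \<bar>f x * g x\<bar> \<partial>M)\<^sup>2 \<le> (\<integral>x. (f x)\<^sup>2 \<partial>M) * (\<integral>x. (g x)\<^sup>2 \<partial>M)"
    using nn by (subst (asm) ennreal_le_iff) auto
  then show ?thesis
    unfolding real_sqrt_mult[symmetric] by (rule real_le_rsqrt)
qed

section \<open>Convergence of integrals with varying dominating functions\<close>

lemma tendsto_L1_mult:
  fixes f g :: "nat \<Rightarrow> 'a \<Rightarrow> real"
  assumes f: "\<And>n. square_integrable M (f n)" "square_integrable M f'"
      "(\<lambda>n. \<integral>x. (f n x - f' x)\<^sup>2 \<partial>M) \<longlonglongrightarrow> 0"
    and g: "\<And>n. square_integrable M (g n)" "square_integrable M g'"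
      "(\<lambda>n. \<integral>x. (g n x - g' x)\<^sup>2 \<partial>M) \<longlonglongrightarrow> 0"
  shows "(\<lambda>n. \<integral>x. \<bar>f n x * g n x - f' x * g' x\<bar> \<partial>M) \<longlonglongrightarrow> 0"
proof -
  define F G where "F n = sqrt (\<integral>x. (f n x - f' x)\<^sup>2 \<partial>M)" and "G n = sqrt (\<integral>x. (g n x - g' x)\<^sup>2 \<partial>M)" for n
  have F: "F \<longlonglongrightarrow> 0" and G: "G \<longlonglongrightarrow> 0"
    unfolding F_def G_def using tendsto_real_sqrt[OF f(3)] tendsto_real_sqrt[OF g(3)] by simp_all
  define a b where "a = sqrt (\<integral>x. (f' x)\<^sup>2 \<partial>M)" and "b = sqrt (\<integral>x. (g' x)\<^sup>2 \<partial>M)"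
  have bound: "(\<integral>x. \<bar>f n x * g n x - f' x * g' x\<bar> \<partial>M) \<le> F n * G n + F n * b + a * G n" for n
  proof -
    note df = square_integrable_diff[OF f(1)[of n] f(2)]
    note dg = square_integrable_diff[OF g(1)[of n] g(2)]
    have i1: "integrable M (\<lambda>x. \<bar>(f n x - f' x) * (g n x - g' x)\<bar>)"
      and i2: "integrable M (\<lambda>x. \<bar>(f n x - f' x) * g' x\<bar>)"
      and i3: "integrable M (\<lambda>x. \<bar>f' x * (g n x - g' x)\<bar>)"
      by (intro integrable_abs integrable_square_integrable_mult df dg f(2) g(2))+
    have "(\<integral>x. \<bar>f n x * g n x - f' x * g' x\<bar> \<partial>M)
      \<le> (\<integral>x. \<bar>(f n x - f' x) * (g n x - g' x)\<bar> + \<bar>(f n x - f' x) * g' x\<bar> + \<bar>f' x * (g n x - g' x)\<bar> \<partial>M)"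
    proof (rule integral_mono')
      fix x
      have "f n x * g n x - f' x * g' x
          = (f n x - f' x) * (g n x - g' x) + (f n x - f' x) * g' x + f' x * (g n x - g' x)"
        by (simp add: algebra_simps)
      then show "\<bar>f n x * g n x - f' x * g' x\<bar>
          \<le> \<bar>(f n x - f' x) * (g n x - g' x)\<bar> + \<bar>(f n x - f' x) * g' x\<bar> + \<bar>f' x * (g n x - g' x)\<bar>"
        by linarith
    qed (use i1 i2 i3 in auto)
    also have "\<dots> = (\<integral>x. \<bar>(f n x - f' x) * (g n x - g' x)\<bar> \<partial>M) + (\<integral>x. \<bar>(f n x - f' x) * g' x\<bar> \<partial>M)
        + (\<integral>x. \<bar>f' x * (g n x - g' x)\<bar> \<partial>M)"
      using i1 i2 i3 by simp
    also have "\<dots> \<le> F n * G n + F n * b + a * G n"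
      unfolding F_def G_def a_def b_def
      by (intro add_mono integral_Cauchy_Schwarz df dg f(2) g(2))
    finally show ?thesis .
  qed
  have "(\<lambda>n. F n * G n + F n * b + a * G n) \<longlonglongrightarrow> 0 * 0 + 0 * b + a * 0"
    by (intro tendsto_intros F G)
  then have lim: "(\<lambda>n. F n * G n + F n * b + a * G n) \<longlonglongrightarrow> 0" by simp
  show ?thesis
  proof (rule Lim_null_comparison[OF always_eventually lim], rule allI)
    show "norm (\<integral>x. \<bar>f n x * g n x - f' x * g' x\<bar> \<partial>M) \<le> F n * G n + F n * b + a * G n" for n
    proof -
      have "0 \<le> (\<integral>x. \<bar>f n x * g n x - f' x * g' x\<bar> \<partial>M)" by (rule integral_nonneg_AE) simp
      then show ?thesis using bound[of n] unfolding real_norm_def by (subst abs_of_nonneg)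
    qed
  qed
qed

text \<open>Pointwise convergence of \<open>f n\<close> is only required along the subsequences on which \<open>A n\<close>
  converges pointwise; convergence in mean square of \<open>A n\<close> provides enough of them.\<close>

lemma integral_tendsto_dominated_L1:
  fixes f G A :: "nat \<Rightarrow> 'a \<Rightarrow> real"
  assumes fm[measurable]: "\<And>n. f n \<in> borel_measurable M" "f' \<in> borel_measurable M"
    and G: "\<And>n. integrable M (G n)" "integrable M G'"
      "(\<lambda>n. \<integral>x. \<bar>G n x - G' x\<bar> \<partial>M) \<longlonglongrightarrow> 0"
    and A: "\<And>n. square_integrable M (A n)" "square_integrable M A'"
      "(\<lambda>n. \<integral>x. (A n x - A' x)\<^sup>2 \<partial>M) \<longlonglongrightarrow> 0"
    and bound: "\<And>n x. \<bar>f n x\<bar> \<le> G n x" "\<And>x. \<bar>f' x\<bar> \<le> G' x"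
    and lim: "\<And>r x. strict_mono r \<Longrightarrow> (\<lambda>n. A (r n) x) \<longlonglongrightarrow> A' x \<Longrightarrow> (\<lambda>n. f (r n) x) \<longlonglongrightarrow> f' x"
  shows "(\<lambda>n. \<integral>x. f n x \<partial>M) \<longlonglongrightarrow> (\<integral>x. f' x \<partial>M)"
proof (rule ccontr)
  assume "\<not> ?thesis"
  \<comment> \<open>If the limit fails, a subsequence \<open>r\<close> keeps its distance
    \<open>e\<close>. Mean square convergence of \<open>A\<close> yields a further subsequence
    \<open>s\<close> with almost everywhere convergence, and the integrals converge along it, which
    is the contradiction.\<close>
  then obtain e where e: "e > 0" and "\<And>N. \<exists>n\<ge>N. e \<le> dist (\<integral>x. f n x \<partial>M) (\<integral>x. f' x \<partial>M)"
    unfolding lim_sequentially by (meson linorder_not_less)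
  then have "\<exists>\<^sub>F n in sequentially. e \<le> dist (\<integral>x. f n x \<partial>M) (\<integral>x. f' x \<partial>M)"
    by (simp add: frequently_sequentially)
  then obtain r :: "nat \<Rightarrow> nat" where r: "strict_mono r"
    and far: "\<And>n. e \<le> dist (\<integral>x. f (r n) x \<partial>M) (\<integral>x. f' x \<partial>M)"
    using infinite_enumerate[of "{n. e \<le> dist (\<integral>x. f n x \<partial>M) (\<integral>x. f' x \<partial>M)}"]
    by (auto simp: frequently_cofinite cofinite_eq_sequentially[symmetric])
  have "(\<lambda>n. \<integral>x. norm ((A (r n) x - A' x)\<^sup>2) \<partial>M) \<longlonglongrightarrow> 0"
    using LIMSEQ_subseq_LIMSEQ[OF A(3) r] by (simp add: o_def)
  then obtain s :: "nat \<Rightarrow> nat" where s: "strict_mono s"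
    and ae: "AE x in M. (\<lambda>n. (A (r (s n)) x - A' x)\<^sup>2) \<longlonglongrightarrow> 0"
    using tendsto_L1_AE_subseq[of M "\<lambda>n x. (A (r n) x - A' x)\<^sup>2"]
      square_integrableD[OF square_integrable_diff[OF A(1) A(2)]] by blast
  let ?k = "\<lambda>n. r (s n)"
  have k: "strict_mono ?k" using r s by (auto simp: strict_mono_def)
  \<comment> \<open>Truncating \<open>f n\<close> at the limit of the dominating functions costs at most their distance in mean.\<close>
  define H where "H n x = max (- G' x) (min (G' x) (f (?k n) x))" for n x
  have Hm[measurable]: "H n \<in> borel_measurable M" for n
    unfolding H_def using G(2) by measurable
  have G0: "0 \<le> G' x" for x using bound(2)[of x] by linarith
  have Hb: "\<bar>H n x\<bar> \<le> G' x" for n x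
    using G0[of x] unfolding H_def by (auto simp: max_def min_def abs_if)
  have Hi: "integrable M (H n)" for n
    by (rule integrable_real_bound[OF G(2) Hm Hb])
  have fi: "integrable M (f n)" for n
    by (rule integrable_real_bound[OF G(1) fm(1) bound(1)])
  have H: "(\<lambda>n. \<integral>x. H n x \<partial>M) \<longlonglongrightarrow> (\<integral>x. f' x \<partial>M)"
  proof (rule integral_dominated_convergence[OF _ _ G(2)])
    show "AE x in M. (\<lambda>n. H n x) \<longlonglongrightarrow> f' x"
      using ae
    proof eventually_elim
      case (elim x)
      then have "(\<lambda>n. sqrt ((A (?k n) x - A' x)\<^sup>2)) \<longlonglongrightarrow> 0"
        using tendsto_real_sqrt[OF elim] by simp
      then have "(\<lambda>n. A (?k n) x - A' x) \<longlonglongrightarrow> 0"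
        by (simp add: tendsto_rabs_zero_iff)
      then have "(\<lambda>n. A (?k n) x) \<longlonglongrightarrow> A' x" by (rule LIM_zero_cancel)
      then have "(\<lambda>n. f (?k n) x) \<longlonglongrightarrow> f' x" by (rule lim[OF k])
      then have "(\<lambda>n. H n x) \<longlonglongrightarrow> max (- G' x) (min (G' x) (f' x))"
        unfolding H_def by (intro tendsto_intros)
      also have "max (- G' x) (min (G' x) (f' x)) = f' x" using bound(2)[of x] by auto
      finally show ?case .
    qed
  qed (use Hb in simp_all)
  have "(\<lambda>n. (\<integral>x. f (?k n) x \<partial>M) - (\<integral>x. H n x \<partial>M)) \<longlonglongrightarrow> 0"
  proof (rule Lim_null_comparison[OF always_eventually])
    show "(\<lambda>n. \<integral>x. \<bar>G (?k n) x - G' x\<bar> \<partial>M) \<longlonglongrightarrow> 0"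
      using LIMSEQ_subseq_LIMSEQ[OF G(3) k] by (simp add: o_def)
    show "\<forall>n. norm ((\<integral>x. f (?k n) x \<partial>M) - (\<integral>x. H n x \<partial>M)) \<le> (\<integral>x. \<bar>G (?k n) x - G' x\<bar> \<partial>M)"
    proof
      fix n
      have "norm ((\<integral>x. f (?k n) x \<partial>M) - (\<integral>x. H n x \<partial>M)) = norm (\<integral>x. f (?k n) x - H n x \<partial>M)"
        using fi Hi by simp
      also have "\<dots> \<le> (\<integral>x. norm (f (?k n) x - H n x) \<partial>M)" by (rule integral_norm_bound)
      also have "\<dots> \<le> (\<integral>x. \<bar>G (?k n) x - G' x\<bar> \<partial>M)"
      proof (rule integral_mono)
        fix x
        show "norm (f (?k n) x - H n x) \<le> \<bar>G (?k n) x - G' x\<bar>"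
          using bound(1)[of "?k n" x] G0[of x] unfolding H_def
          by (auto simp: max_def min_def abs_if split: if_splits)
      qed (use fi Hi G in simp_all)
      finally show "norm ((\<integral>x. f (?k n) x \<partial>M) - (\<integral>x. H n x \<partial>M)) \<le> (\<integral>x. \<bar>G (?k n) x - G' x\<bar> \<partial>M)" .
    qed
  qed
  from tendsto_add[OF this H] have "(\<lambda>n. \<integral>x. f (?k n) x \<partial>M) \<longlonglongrightarrow> (\<integral>x. f' x \<partial>M)" by simp
  then obtain n where "dist (\<integral>x. f (?k n) x \<partial>M) (\<integral>x. f' x \<partial>M) < e"
    using e by (meson lim_sequentially order_refl)
  with far[of "s n"] show False by simp
qed

text \<open>The Caratheodory form of the derivative avoids a division by \<open>a n - b\<close>,
  which may vanish for some \<open>n\<close>.\<close>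

lemma has_real_derivative_difference_quotient_tendsto:
  fixes \<Phi> :: "real \<Rightarrow> real" and e a :: "nat \<Rightarrow> real"
  assumes d: "(\<Phi> has_real_derivative d) (at b)"
    and e: "e \<longlonglongrightarrow> 0" "\<And>n. e n \<noteq> 0" and a: "(\<lambda>n. (a n - b) / e n) \<longlonglongrightarrow> A"
  shows "(\<lambda>n. (\<Phi> (a n) - \<Phi> b) / e n) \<longlonglongrightarrow> d * A"
proof -
  obtain g where g: "\<And>z. \<Phi> z - \<Phi> b = g z * (z - b)" "isCont g b" "g b = d"
    using d unfolding CARAT_DERIV by blast
  have "(\<lambda>n. b + e n * ((a n - b) / e n)) \<longlonglongrightarrow> b + 0 * A"
    by (intro tendsto_intros e a)
  then have "a \<longlonglongrightarrow> b" using e(2) by simp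
  then have "(\<lambda>n. g (a n)) \<longlonglongrightarrow> d" using g(2,3) isCont_tendsto_compose by blast
  from tendsto_mult[OF this a] show ?thesis unfolding g(1) by simp
qed

subsection \<open>Bump functions\<close>

text \<open>With \<open>p = 1\<close> this is the classical \<open>exp (- 1 / t)\<close>, continued
  by zero. The polynomial in \<open>1 / t\<close> makes the family closed under
  differentiation.\<close>

definition flat_fun :: "real poly \<Rightarrow> real \<Rightarrow> real" where
  "flat_fun p t = (if t > 0 then poly p (1 / t) * exp (- (1 / t)) else 0)"

text \<open>The extra power \<open>s ^ k\<close> serves the induction: in the step for
  \<open>pCons a p\<close> it absorbs the factor \<open>s\<close> in front of
  \<open>poly p s\<close>.\<close>

lemma poly_exp_minus_tendsto_0:
  fixes p :: "real poly"
  shows "((\<lambda>s. s ^ k * poly p s * exp (- s)) \<longlongrightarrow> 0) at_top"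
proof (induction p arbitrary: k)
  case (pCons a p)
  have "((\<lambda>s. a * (s ^ k / exp s) + s ^ Suc k * poly p s * exp (- s)) \<longlongrightarrow> a * 0 + 0) at_top"
    by (intro tendsto_intros tendsto_power_div_exp_0 pCons.IH)
  also have "(\<lambda>s. a * (s ^ k / exp s) + s ^ Suc k * poly p s * exp (- s))
      = (\<lambda>s. s ^ k * poly (pCons a p) s * exp (- s))"
    by (auto simp: fun_eq_iff exp_minus field_simps)
  finally show ?case by simp
qed simp

lemma flat_fun_tendsto_0: "(flat_fun p \<longlongrightarrow> 0) (at_right 0)"
proof -
  have "((\<lambda>t. poly p (inverse t) * exp (- inverse t)) \<longlongrightarrow> 0) (at_right (0::real))"
    using filterlim_compose[OF poly_exp_minus_tendsto_0[of 0 p] filterlim_inverse_at_top_right] by simp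
  moreover have "\<forall>\<^sub>F t in at_right (0::real). poly p (inverse t) * exp (- inverse t) = flat_fun p t"
    by (auto simp: eventually_at_right_field flat_fun_def divide_inverse intro!: exI[of _ 1])
  ultimately show ?thesis by (rule Lim_transform_eventually)
qed

text \<open>Differentiating \<open>p (1 / t) exp (- 1 / t)\<close> produces
  \<open>(p - p') (1 / t) / t^2\<close> times the exponential, and \<open>[:0, 0, 1:]\<close> stands
  for the factor \<open>1 / t^2\<close>.\<close>

lemma flat_fun_has_derivative:
  "(flat_fun p has_real_derivative flat_fun ([:0, 0, 1:] * (p - pderiv p)) t) (at t)"
proof -
  let ?q = "[:0, 0, 1:] * (p - pderiv p)"
  consider "t > 0" | "t < 0" | "t = 0" by linarith
  then show ?thesis
  proof cases
    case 1
    have "((\<lambda>t. poly p (1 / t) * exp (- (1 / t))) has_real_derivative flat_fun ?q t) (at t)"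
      using 1 by (auto intro!: derivative_eq_intros simp: flat_fun_def field_simps power2_eq_square)
    moreover have "\<forall>\<^sub>F s in nhds t. poly p (1 / s) * exp (- (1 / s)) = flat_fun p s"
      using eventually_nhds_in_open[of "{0<..}" t] 1 by (auto simp: flat_fun_def elim!: eventually_mono)
    ultimately show ?thesis by (subst (asm) DERIV_cong_ev[OF refl _ refl]) auto
  next
    case 2
    have "((\<lambda>t. 0) has_real_derivative flat_fun ?q t) (at t)" using 2 by (simp add: flat_fun_def)
    moreover have "\<forall>\<^sub>F s in nhds t. 0 = flat_fun p s"
      using eventually_nhds_in_open[of "{..<0}" t] 2 by (auto simp: flat_fun_def elim!: eventually_mono)
    ultimately show ?thesis by (subst (asm) DERIV_cong_ev[OF refl _ refl]) auto
  next
    case 3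
    \<comment> \<open>Dividing by \<open>h\<close> multiplies the polynomial by its variable, so the
      difference quotient at 0 is again a flat function, that of \<open>pCons 0 p\<close>.\<close>
    have "((\<lambda>h. flat_fun p h / h) \<longlongrightarrow> 0) (at_right 0)"
      by (rule Lim_transform_eventually[OF flat_fun_tendsto_0[of "pCons 0 p"]])
        (auto simp: eventually_at_right_field flat_fun_def intro!: exI[of _ 1])
    moreover have "((\<lambda>h. flat_fun p h / h) \<longlongrightarrow> 0) (at_left 0)"
      by (rule Lim_transform_eventually[OF tendsto_const])
        (auto simp: eventually_at_left_field flat_fun_def intro!: exI[of _ "-1"])
    ultimately have "((\<lambda>h. flat_fun p h / h) \<longlongrightarrow> 0) (at 0)" by (simp add: filterlim_split_at)
    then show ?thesis using 3 by (simp add: DERIV_def flat_fun_def)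
  qed
qed

text \<open>Closed under directional derivatives, hence made of smooth functions by coinduction.\<close>

inductive bump_algebra :: "('a::euclidean_space \<Rightarrow> real) \<Rightarrow> bool" where
  const: "bump_algebra (\<lambda>_. c)"
| inner: "bump_algebra (\<lambda>x. x \<bullet> a)"
| square: "bump_algebra (\<lambda>x. x \<bullet> x)"
| add: "bump_algebra f \<Longrightarrow> bump_algebra g \<Longrightarrow> bump_algebra (\<lambda>x. f x + g x)"
| mult: "bump_algebra f \<Longrightarrow> bump_algebra g \<Longrightarrow> bump_algebra (\<lambda>x. f x * g x)"
| flat: "bump_algebra f \<Longrightarrow> bump_algebra (\<lambda>x. flat_fun p (f x))"

lemma bump_algebra_cmult: "bump_algebra f \<Longrightarrow> bump_algebra (\<lambda>x. c * f x)"
  using bump_algebra.mult[OF bump_algebra.const] .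

lemma bump_algebra_affine:
  assumes "bump_algebra f"
  shows "bump_algebra (\<lambda>x. f (c *\<^sub>R x + b))"
  using assms
proof induction
  case (inner a)
  have "bump_algebra (\<lambda>x. c * (x \<bullet> a) + b \<bullet> a)"
    by (intro bump_algebra.add bump_algebra_cmult bump_algebra.inner bump_algebra.const)
  then show ?case by (simp add: inner_add_left)
next
  case square
  have "bump_algebra (\<lambda>x. c\<^sup>2 * (x \<bullet> x) + (2 * c * (x \<bullet> b) + b \<bullet> b))"
    by (intro bump_algebra.add bump_algebra_cmult bump_algebra.inner bump_algebra.const bump_algebra.square)
  moreover have "c\<^sup>2 * (x \<bullet> x) + (2 * c * (x \<bullet> b) + b \<bullet> b) = (c *\<^sub>R x + b) \<bullet> (c *\<^sub>R x + b)" for x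
    by (simp add: inner_add_left inner_add_right inner_commute power2_eq_square algebra_simps)
  ultimately show ?case by simp
qed (auto intro: bump_algebra.intros)

lemma bump_algebra_has_derivative:
  assumes "bump_algebra f"
  shows "\<exists>D. (\<forall>x. (f has_derivative D x) (at x)) \<and> (\<forall>h. bump_algebra (\<lambda>x. D x h))"
  using assms
proof induction
  case (const c)
  show ?case by (intro exI[of _ "\<lambda>x h. 0"]) (auto intro: bump_algebra.const)
next
  case (inner a)
  show ?case by (intro exI[of _ "\<lambda>x h. h \<bullet> a"]) (auto intro!: bump_algebra.const derivative_eq_intros)
next
  case square
  have "((\<lambda>x. x \<bullet> x) has_derivative (\<lambda>h. 2 * (x \<bullet> h))) (at x)" for x :: 'a
    by (auto intro!: derivative_eq_intros simp: inner_commute)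
  then show ?case
    by (intro exI[of _ "\<lambda>x h. 2 * (x \<bullet> h)"]) (auto intro: bump_algebra_cmult bump_algebra.inner)
next
  case (add f g)
  then obtain D E where
    "\<And>x. (f has_derivative D x) (at x)" "\<And>h. bump_algebra (\<lambda>x. D x h)"
    "\<And>x. (g has_derivative E x) (at x)" "\<And>h. bump_algebra (\<lambda>x. E x h)" by blast
  then show ?case
    by (intro exI[of _ "\<lambda>x h. D x h + E x h"]) (auto intro: bump_algebra.add has_derivative_add)
next
  case (mult f g)
  then obtain D E where
    "\<And>x. (f has_derivative D x) (at x)" "\<And>h. bump_algebra (\<lambda>x. D x h)"
    "\<And>x. (g has_derivative E x) (at x)" "\<And>h. bump_algebra (\<lambda>x. E x h)" by blast
  then show ?case using mult.hyps
    by (intro exI[of _ "\<lambda>x h. f x * E x h + D x h * g x"])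
      (auto intro!: bump_algebra.add bump_algebra.mult has_derivative_mult)
next
  case (flat f p)
  then obtain D where D: "\<And>x. (f has_derivative D x) (at x)" "\<And>h. bump_algebra (\<lambda>x. D x h)" by blast
  let ?q = "[:0, 0, 1:] * (p - pderiv p)"
  have "((\<lambda>x. flat_fun p (f x)) has_derivative (\<lambda>h. flat_fun ?q (f x) * D x h)) (at x)" for x
    using has_derivative_compose[OF D(1) flat_fun_has_derivative[THEN has_field_derivative_imp_has_derivative]]
    by simp
  then show ?case using D(2) flat.hyps
    by (intro exI[of _ "\<lambda>x h. flat_fun ?q (f x) * D x h"])
      (auto intro!: bump_algebra.mult bump_algebra.flat)
qed

lemma bump_algebra_frechet:
  assumes "bump_algebra f"
  shows "(f has_derivative frechet_derivative f (at x)) (at x)"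
    and "bump_algebra (\<lambda>x. frechet_derivative f (at x) h)"
proof -
  obtain D where D: "\<And>x. (f has_derivative D x) (at x)" "\<And>h. bump_algebra (\<lambda>x. D x h)"
    using bump_algebra_has_derivative[OF assms] by blast
  then have eq: "frechet_derivative f (at x) = D x" for x using frechet_derivative_at by metis
  show "(f has_derivative frechet_derivative f (at x)) (at x)"
    and "bump_algebra (\<lambda>x. frechet_derivative f (at x) h)"
    using D by (simp_all add: eq)
qed

lemma bump_algebra_continuous: "bump_algebra f \<Longrightarrow> continuous_on A f"
  by (meson bump_algebra_frechet(1) continuous_at_imp_continuous_on has_derivative_continuous)

lemma bump_algebra_smooth: "bump_algebra f \<Longrightarrow> smooth_fun f"
proof (coinduction arbitrary: f rule: smooth_fun.coinduct)
  case smooth_fun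
  then show ?case using bump_algebra_frechet[OF smooth_fun] by (auto simp: differentiable_def)
qed

section \<open>Test functions drawn from the bump algebra\<close>

text \<open>A subclass of \<open>test_fun\<close> for which closure under products, rescaling,
  translation and directional derivatives comes directly from the generating rules. It is still rich
  enough to determine a square integrable function almost everywhere.\<close>

definition bump_test :: "('a::euclidean_space \<Rightarrow> real) \<Rightarrow> bool" where
  "bump_test f \<longleftrightarrow> bump_algebra f \<and> (\<exists>R. \<forall>x. norm x > R \<longrightarrow> f x = 0)"

lemma bump_test_test_fun: 
  assumes "bump_test f"
  shows "test_fun f"
proof -
  obtain R where R: "\<And>x. norm x > R \<Longrightarrow> f x = 0" using assms by (auto simp: bump_test_def)
  have "{x. f x \<noteq> 0} \<subseteq> cball 0 R" using R by (auto simp: not_less[symmetric])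
  then have "bounded {x. f x \<noteq> 0}" using bounded_cball bounded_subset by blast
  then show ?thesis
    using assms bump_algebra_smooth by (auto simp: test_fun_def bump_test_def compact_closure)
qed

lemma bump_test_add: "bump_test f \<Longrightarrow> bump_test g \<Longrightarrow> bump_test (\<lambda>x. f x + g x)"
  unfolding bump_test_def
  by (auto intro!: bump_algebra.add) (metis add_0 nle_le order_le_less_trans)

lemma bump_test_mult: "bump_algebra f \<Longrightarrow> bump_test g \<Longrightarrow> bump_test (\<lambda>x. f x * g x)"
  unfolding bump_test_def by (auto intro!: bump_algebra.mult)

lemma bump_test_affine:
  assumes f: "bump_test f" and c: "c \<noteq> 0"
  shows "bump_test (\<lambda>x. f (c *\<^sub>R x + b))"
proof -
  obtain R where R: "\<And>x. norm x > R \<Longrightarrow> f x = 0" using f by (auto simp: bump_test_def)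
  have "f (c *\<^sub>R x + b) = 0" if "norm x > (R + norm b) / \<bar>c\<bar>" for x
  proof (rule R)
    have "R + norm b < \<bar>c\<bar> * norm x" using that c by (simp add: field_simps)
    also have "\<bar>c\<bar> * norm x = norm ((c *\<^sub>R x + b) - b)" by simp
    also have "\<dots> \<le> norm (c *\<^sub>R x + b) + norm b" by (rule norm_triangle_ineq4)
    finally show "R < norm (c *\<^sub>R x + b)" by simp
  qed
  then show ?thesis using f bump_algebra_affine unfolding bump_test_def by blast
qed

lemma bump_test_translate: "bump_test f \<Longrightarrow> bump_test (\<lambda>x. f (x + b))"
  using bump_test_affine[of f 1 b] by simp

lemma bump_test_derivative: "bump_test f \<Longrightarrow> (f has_derivative frechet_derivative f (at x)) (at x)"
  by (simp add: bump_test_def bump_algebra_frechet)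

lemma bump_test_frechet:
  assumes "bump_test f"
  shows "bump_test (\<lambda>x. frechet_derivative f (at x) h)"
proof -
  obtain R where R: "\<And>x. norm x > R \<Longrightarrow> f x = 0" using assms by (auto simp: bump_test_def)
  have "frechet_derivative f (at x) h = 0" if x: "norm x > R" for x
  proof -
    have "open {x::'a. norm x > R}" by (intro open_Collect_less continuous_intros)
    then have "((\<lambda>_. 0) has_derivative frechet_derivative f (at x)) (at x)"
      using x R
      by (intro has_derivative_transform_within_open[OF bump_test_derivative[OF assms], of "{x. norm x > R}"]) auto
    then have "frechet_derivative f (at x) = (\<lambda>_. 0)"
      using has_derivative_unique[OF _ has_derivative_const] by blast
    then show ?thesis by simp
  qed
  then show ?thesis using assms bump_algebra_frechet(2) unfolding bump_test_def by blast
qed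

lemma bump_test_measurable: "bump_test f \<Longrightarrow> f \<in> borel_measurable borel"
  using bump_algebra_continuous borel_measurable_continuous_onI by (auto simp: bump_test_def)

lemma bump_test_bounded:
  assumes "bump_test f"
  shows "\<exists>B\<ge>0. \<forall>x. \<bar>f x\<bar> \<le> B"
proof -
  obtain R where R: "\<And>x. norm x > R \<Longrightarrow> f x = 0" using assms by (auto simp: bump_test_def)
  have "compact (f ` cball 0 R)"
    using assms by (intro compact_continuous_image bump_algebra_continuous) (auto simp: bump_test_def)
  then obtain B where B: "\<And>x. norm x \<le> R \<Longrightarrow> \<bar>f x\<bar> \<le> B"
    using compact_imp_bounded[THEN bounded_iff[THEN iffD1]] by fastforce
  have "\<bar>f x\<bar> \<le> max B 0" for x
    using B[of x] R[of x] by (cases "norm x \<le> R") auto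
  then show ?thesis by (intro exI[of _ "max B 0"]) auto
qed

lemma bump_test_integrable:
  assumes f: "bump_test f"
  shows "integrable lborel f"
proof -
  obtain R where R: "\<And>x. norm x > R \<Longrightarrow> f x = 0" using f by (auto simp: bump_test_def)
  obtain B where B: "\<And>x. \<bar>f x\<bar> \<le> B" "B \<ge> 0" using bump_test_bounded[OF f] by blast
  have "integrable lborel (\<lambda>x::'a. B * indicator (cball 0 R) x)"
    using emeasure_lborel_cball_finite[of "0::'a" R]
    by (intro integrable_mult_right) (simp add: integrable_indicator_iff)
  then show ?thesis
  proof (rule integrable_real_bound)
    show "f \<in> borel_measurable lborel" using bump_test_measurable[OF f] by simp
    show "\<bar>f x\<bar> \<le> B * indicator (cball 0 R) x" for x
      using B R[of x] by (cases "norm x \<le> R") (auto simp: indicator_def)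
  qed
qed

lemma bump_test_square_integrable:
  assumes f: "bump_test f"
  shows "square_integrable lborel f"
  unfolding square_integrable_def
proof
  show "f \<in> borel_measurable lborel" using bump_test_measurable[OF f] by simp
  have "bump_test (\<lambda>x. f x * f x)" using f by (intro bump_test_mult) (auto simp: bump_test_def)
  then show "integrable lborel (\<lambda>x. (f x)\<^sup>2)"
    using bump_test_integrable by (simp add: power2_eq_square)
qed

lemma bump_test_line_derivative:
  assumes "bump_test f"
  shows "((\<lambda>s. f (x + s *\<^sub>R h)) has_real_derivative frechet_derivative f (at (x + s *\<^sub>R h)) h) (at s)"
proof -
  have "((\<lambda>s. f (x + s *\<^sub>R h)) has_derivative
      (\<lambda>t. frechet_derivative f (at (x + s *\<^sub>R h)) (t *\<^sub>R h))) (at s)"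
    by (rule has_derivative_compose[OF _ bump_test_derivative[OF assms]])
      (auto intro!: derivative_eq_intros)
  moreover have "frechet_derivative f (at (x + s *\<^sub>R h)) (t *\<^sub>R h)
      = frechet_derivative f (at (x + s *\<^sub>R h)) h * t" for t
    using linear_cmul[OF has_derivative_linear[OF bump_test_derivative[OF assms]]] by simp
  ultimately show ?thesis by (simp add: has_field_derivative_def)
qed

lemma bump_test_difference_quotient_bound:
  assumes f: "bump_test f"
  obtains B where "\<And>x s. \<bar>f (x + s *\<^sub>R h) - f x\<bar> \<le> B * \<bar>s\<bar>"
proof -
  obtain B where B: "\<And>x. \<bar>frechet_derivative f (at x) h\<bar> \<le> B" "B \<ge> 0"
    using bump_test_bounded[OF bump_test_frechet[OF f], of h] by blast
  have "\<bar>f (x + s *\<^sub>R h) - f x\<bar> \<le> B * \<bar>s\<bar>" for x s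
    using field_differentiable_bound[OF convex_UNIV, of "\<lambda>s. f (x + s *\<^sub>R h)"
        "\<lambda>s. frechet_derivative f (at (x + s *\<^sub>R h)) h" B s 0]
      bump_test_line_derivative[OF f] B by simp
  then show ?thesis by (rule that)
qed

text \<open>The steps \<open>e n\<close> may have either sign: a discrete integration by parts turns
  forward quotients of one factor into backward quotients of the other. The mean value theorem gives
  the uniform bound on the quotients.\<close>

lemma bump_test_weighted_difference_quotient_tendsto:
  fixes W :: "'a::euclidean_space \<Rightarrow> real"
  assumes f: "bump_test f" and W: "integrable lborel W"
    and e: "e \<longlonglongrightarrow> 0" "\<And>n. e n \<noteq> 0"
  shows "(\<lambda>n. \<integral>x. W x * ((f (x + e n *\<^sub>R h) - f x) / e n) \<partial>lborel)
    \<longlonglongrightarrow> (LBINT x. W x * frechet_derivative f (at x) h)"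
proof -
  obtain B where B: "\<And>x s. \<bar>f (x + s *\<^sub>R h) - f x\<bar> \<le> B * \<bar>s\<bar>"
    using bump_test_difference_quotient_bound[OF f] by blast
  have [measurable]: "f \<in> borel_measurable borel" "W \<in> borel_measurable borel"
    "(\<lambda>x. frechet_derivative f (at x) h) \<in> borel_measurable borel"
    using bump_test_measurable f bump_test_frechet W by auto
  show ?thesis
  proof (rule integral_dominated_convergence[where w = "\<lambda>x. B * \<bar>W x\<bar>"])
    show "AE x in lborel. (\<lambda>n. W x * ((f (x + e n *\<^sub>R h) - f x) / e n))
        \<longlonglongrightarrow> W x * frechet_derivative f (at x) h"
    proof (intro AE_I2 tendsto_mult tendsto_const)
      fix x
      have "((\<lambda>s. f (x + s *\<^sub>R h)) has_real_derivative frechet_derivative f (at x) h) (at 0)"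
        using bump_test_line_derivative[OF f, of x h 0] by simp
      from has_real_derivative_difference_quotient_tendsto[OF this e, of e 1]
      show "(\<lambda>n. (f (x + e n *\<^sub>R h) - f x) / e n) \<longlonglongrightarrow> frechet_derivative f (at x) h"
        using e(2) by simp
    qed
    show "AE x in lborel. norm (W x * ((f (x + e n *\<^sub>R h) - f x) / e n)) \<le> B * \<bar>W x\<bar>" for n
    proof (intro AE_I2)
      fix x
      have "\<bar>(f (x + e n *\<^sub>R h) - f x) / e n\<bar> \<le> B"
        using B[of x "e n"] e(2)[of n] by (simp add: field_simps)
      from mult_left_mono[OF this, of "\<bar>W x\<bar>"]
      show "norm (W x * ((f (x + e n *\<^sub>R h) - f x) / e n)) \<le> B * \<bar>W x\<bar>"
        by (simp add: abs_mult mult.commute)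
    qed
  qed (use W in auto)
qed

text \<open>Every difference quotient has integral zero by translation invariance, and the
  derivative is their limit.\<close>

lemma integral_frechet_derivative_bump_test:
  assumes f: "bump_test f"
  shows "(LBINT x. frechet_derivative f (at x) h) = 0"
proof -
  obtain R where R: "\<And>x. norm x > R \<Longrightarrow> f x = 0" using f by (auto simp: bump_test_def)
  obtain R' where R': "\<And>x. norm x > R' \<Longrightarrow> frechet_derivative f (at x) h = 0"
    using bump_test_frechet[OF f, of h] by (auto simp: bump_test_def)
  define e where "e n = inverse (real (Suc n))" for n
  have e: "e \<longlonglongrightarrow> 0" "\<And>n. e n \<noteq> 0" "\<And>n. \<bar>e n\<bar> \<le> 1"
    unfolding e_def using LIMSEQ_inverse_real_of_nat by (auto simp: field_simps)
  \<comment> \<open>A constant weight would not be integrable, so it is cut off. As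
    \<open>\<bar>e n\<bar> \<le> 1\<close>, this ball contains all points where the derivative or
    any of the difference quotients is nonzero.\<close>
  define W :: "'a \<Rightarrow> real" where "W = indicator (cball 0 (max R' (R + norm h)))"
  have W: "integrable lborel W"
    unfolding W_def using emeasure_lborel_cball_finite[of "0::'a"] by (simp add: integrable_indicator_iff)
  have [measurable]: "f \<in> borel_measurable borel" using f by (rule bump_test_measurable)
  have "(LBINT x. W x * ((f (x + e n *\<^sub>R h) - f x) / e n)) = 0" for n
  proof -
    have "W x * ((f (x + e n *\<^sub>R h) - f x) / e n) = (f (x + e n *\<^sub>R h) - f x) / e n" for x
    proof (cases "norm x \<le> max R' (R + norm h)")
      case False
      have "norm (e n *\<^sub>R h) \<le> norm h" using e(3)[of n] by (simp add: mult_left_le_one_le)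
      then have "norm (x + e n *\<^sub>R h) > R"
        using False norm_triangle_ineq4[of "x + e n *\<^sub>R h" "e n *\<^sub>R h"] by auto
      moreover have "norm x > R" using False norm_ge_zero[of h] by (auto simp del: norm_ge_zero)
      ultimately show ?thesis using R by simp
    qed (simp add: W_def)
    then have "(LBINT x. W x * ((f (x + e n *\<^sub>R h) - f x) / e n))
        = (LBINT x. (f (x + e n *\<^sub>R h) - f x) / e n)" by (simp only:)
    also have "\<dots> = ((LBINT x. f (x + e n *\<^sub>R h)) - (LBINT x. f x)) / e n"
      using bump_test_integrable[OF f] lborel_integrable_translate[OF bump_test_integrable[OF f]] by simp
    also have "\<dots> = 0" by (simp add: lborel_integral_translate)
    finally show ?thesis .
  qed
  then have "(\<lambda>n::nat. 0) \<longlonglongrightarrow> (LBINT x. W x * frechet_derivative f (at x) h)"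
    using bump_test_weighted_difference_quotient_tendsto[OF f W e(1,2), of h] by (simp only:)
  then have "(LBINT x. W x * frechet_derivative f (at x) h) = 0"
    by (rule LIMSEQ_unique) simp
  moreover have "W x * frechet_derivative f (at x) h = frechet_derivative f (at x) h" for x
    using R'[of x] by (auto simp: W_def indicator_def)
  ultimately show ?thesis by simp
qed

lemma exists_even_bump_test:
  obtains k :: "'a::euclidean_space \<Rightarrow> real"
  where "bump_test k" "\<And>x. k (- x) = k x" "(LBINT x. k x) > 0"
proof
  \<comment> \<open>This is \<open>exp (- 1 / (1 - |x|^2))\<close> on the unit ball and zero
    elsewhere; it is even because it depends on \<open>x \<bullet> x\<close> only.\<close>
  let ?k = "\<lambda>x::'a. flat_fun 1 (1 + (-1) * (x \<bullet> x))"
  have "?k x = 0" if "norm x > 1" for x :: 'a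
    using that by (simp add: flat_fun_def dot_square_norm abs_square_less_1)
  moreover have "bump_algebra ?k"
    by (intro bump_algebra.flat bump_algebra.add bump_algebra.const bump_algebra_cmult bump_algebra.square)
  ultimately show k: "bump_test ?k"
    unfolding bump_test_def by blast
  show "?k (- x) = ?k x" for x by simp
  have nn: "?k x \<ge> 0" for x by (simp add: flat_fun_def)
  have "(LBINT x. ?k x) \<noteq> 0"
  proof
    assume "(LBINT x. ?k x) = 0"
    then have "AE x in lborel. ?k x = 0"
      using integral_nonneg_eq_0_iff_AE[OF bump_test_integrable[OF k]] nn by simp
    then have "AE x in lborel. x \<notin> ball (0::'a) 1"
    proof eventually_elim
      case (elim x)
      have "x \<bullet> x < 1" if "norm x < 1"
        using that by (simp add: dot_square_norm abs_square_less_1)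
      then show ?case using elim by (auto simp: flat_fun_def split: if_splits)
    qed
    then have "emeasure lborel (ball (0::'a) 1) = 0"
      by (subst (asm) AE_iff_measurable[of "ball 0 1"]) auto
    then show False using content_ball_pos[of 1 "0::'a"] by (simp add: measure_def)
  qed
  then show "(LBINT x. ?k x) > 0"
    using nn by (simp add: order.strict_iff_order integral_nonneg)
qed

subsection \<open>Mollified pairings\<close>

text \<open>The general shift \<open>a s\<close> covers rescaled kernels
  (\<open>a z = e *\<^sub>R z\<close>), segments (\<open>a s = s *\<^sub>R h\<close>) and plain
  products of functions in separate variables (\<open>a = (\<lambda>_. 0)\<close>).\<close>

lemma integrable_pair_translate:
  fixes K :: "'b::euclidean_space \<Rightarrow> real" and f :: "'a::euclidean_space \<Rightarrow> real"
  assumes K: "integrable lborel K" and f: "integrable lborel f"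
    and [measurable]: "a \<in> borel_measurable borel"
  shows "integrable (lborel \<Otimes>\<^sub>M lborel) (\<lambda>(s, x). K s * f (x + a s))"
proof (rule lborel_pair.Fubini_integrable)
  have [measurable]: "K \<in> borel_measurable borel" "f \<in> borel_measurable borel" using K f by auto
  show "(\<lambda>(s, x). K s * f (x + a s)) \<in> borel_measurable (lborel \<Otimes>\<^sub>M lborel)" by measurable
  have "(LBINT x. \<bar>f (x + a s)\<bar>) = (LBINT x. \<bar>f x\<bar>)" for s
    by (rule lborel_integral_translate[of "\<lambda>x. \<bar>f x\<bar>"]) simp
  then show "integrable lborel (\<lambda>s. \<integral>x. norm (case (s, x) of (s, x) \<Rightarrow> K s * f (x + a s)) \<partial>lborel)"
    using K by (simp add: abs_mult)
  show "AE s in lborel. integrable lborel (\<lambda>x. case (s, x) of (s, x) \<Rightarrow> K s * f (x + a s))"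
    using lborel_integrable_translate[OF f] by simp
qed

lemma integrable_pair_translate_mult:
  fixes K :: "'b::euclidean_space \<Rightarrow> real" and f t :: "'a::euclidean_space \<Rightarrow> real"
  assumes K: "integrable lborel K" and f: "square_integrable lborel f" and t: "square_integrable lborel t"
    and a[measurable]: "a \<in> borel_measurable borel"
  shows "integrable (lborel \<Otimes>\<^sub>M lborel) (\<lambda>(s, x). K s * (f (x + a s) * t x))"
proof -
  have [measurable]: "K \<in> borel_measurable borel" "f \<in> borel_measurable borel" "t \<in> borel_measurable borel"
    using K square_integrable_measurable[OF f] square_integrable_measurable[OF t] by auto
  have "integrable (lborel \<Otimes>\<^sub>M lborel)
      (\<lambda>p. (\<lambda>(s, x). \<bar>K s\<bar> * (f (x + a s))\<^sup>2) p + (\<lambda>(s, x). \<bar>K s\<bar> * (t (x + 0))\<^sup>2) p)"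
    by (intro Bochner_Integration.integrable_add integrable_pair_translate[where a = a]
        integrable_pair_translate[where a = "\<lambda>_. 0"] integrable_abs K square_integrableD f t) simp_all
  then show ?thesis
  proof (rule integrable_real_bound)
    show "(\<lambda>(s, x). K s * (f (x + a s) * t x)) \<in> borel_measurable (lborel \<Otimes>\<^sub>M lborel)" by measurable
    have le: "\<bar>k * (b * c)\<bar> \<le> \<bar>k\<bar> * b\<^sup>2 + \<bar>k\<bar> * c\<^sup>2" for k b c :: real
    proof -
      have "0 \<le> (\<bar>b\<bar> - \<bar>c\<bar>)\<^sup>2" by simp
      also have "\<dots> = b\<^sup>2 + c\<^sup>2 - 2 * \<bar>b * c\<bar>" by (simp add: power2_diff abs_mult)
      finally have "\<bar>b * c\<bar> \<le> b\<^sup>2 + c\<^sup>2" using abs_ge_zero[of "b * c"] by linarith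
      from mult_left_mono[OF this, of "\<bar>k\<bar>"] show ?thesis by (simp add: abs_mult distrib_left)
    qed
    show "\<bar>(\<lambda>(s, x). K s * (f (x + a s) * t x)) p\<bar>
      \<le> (\<lambda>(s, x). \<bar>K s\<bar> * (f (x + a s))\<^sup>2) p + (\<lambda>(s, x). \<bar>K s\<bar> * (t (x + 0))\<^sup>2) p" for p
      using le by (cases p) simp
  qed
qed

lemma integrable_pair_translate_bounded:
  fixes K :: "'b::euclidean_space \<Rightarrow> real" and f t :: "'a::euclidean_space \<Rightarrow> real"
  assumes K: "integrable lborel K" and f: "integrable lborel f"
    and t[measurable]: "t \<in> borel_measurable borel" and C: "\<And>x. \<bar>t x\<bar> \<le> C"
    and a[measurable]: "a \<in> borel_measurable borel"
  shows "integrable (lborel \<Otimes>\<^sub>M lborel) (\<lambda>(s, x). K s * (f (x + a s) * t x))"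
proof -
  have [measurable]: "K \<in> borel_measurable borel" "f \<in> borel_measurable borel" using K f by auto
  have "integrable (lborel \<Otimes>\<^sub>M lborel) (\<lambda>p. C * (\<lambda>(s, x). \<bar>K s\<bar> * \<bar>f (x + a s)\<bar>) p)"
    by (intro integrable_mult_right integrable_pair_translate[where f = "\<lambda>x. \<bar>f x\<bar>"] integrable_abs K f a)
  then show ?thesis
  proof (rule integrable_real_bound)
    show "(\<lambda>(s, x). K s * (f (x + a s) * t x)) \<in> borel_measurable (lborel \<Otimes>\<^sub>M lborel)" by measurable
    have "\<bar>K s * (f (x + a s) * t x)\<bar> \<le> C * (\<bar>K s\<bar> * \<bar>f (x + a s)\<bar>)" for s x
      using mult_right_mono[OF C[of x], of "\<bar>K s\<bar> * \<bar>f (x + a s)\<bar>"] by (simp add: abs_mult mult_ac)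
    then show "\<bar>(\<lambda>(s, x). K s * (f (x + a s) * t x)) p\<bar>
      \<le> C * (\<lambda>(s, x). \<bar>K s\<bar> * \<bar>f (x + a s)\<bar>) p" for p
      by (cases p) simp
  qed
qed

lemma integrable_bounded_mult:
  fixes f t :: "'a \<Rightarrow> real"
  assumes f: "integrable M f" and t[measurable]: "t \<in> borel_measurable M" and C: "\<And>x. \<bar>t x\<bar> \<le> C"
  shows "integrable M (\<lambda>x. f x * t x)"
proof (rule integrable_real_bound[OF integrable_mult_right[OF integrable_abs[OF f], of C]])
  show "(\<lambda>x. f x * t x) \<in> borel_measurable M" using f by measurable
  show "\<bar>f x * t x\<bar> \<le> C * \<bar>f x\<bar>" for x
    using mult_right_mono[OF C[of x], of "\<bar>f x\<bar>"] by (simp add: abs_mult mult_ac)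
qed

section \<open>Pairings with translates and their averages over a kernel\<close>

text \<open>The integrable \<open>f\<close> is estimated with the supremum bound of
  \<open>t\<close>, the square integrable \<open>g\<close> with Cauchy-Schwarz. Such sums occur both
  for the right side of the equation and for \<open>w\<close>, where \<open>2 / 3 * u ^ 3\<close> is
  integrable and \<open>u\<close> square integrable.\<close>

lemma translate_pairing_tendsto:
  fixes f g t :: "'a::euclidean_space \<Rightarrow> real"
  assumes f: "integrable lborel f" and g: "square_integrable lborel g"
    and t: "square_integrable lborel t" and C: "\<And>x. \<bar>t x\<bar> \<le> C" and h: "h \<longlonglongrightarrow> 0"
  shows "(\<lambda>n. \<integral>y. (f (y + h n) + g (y + h n)) * t y \<partial>lborel) \<longlonglongrightarrow> (LBINT y. (f y + g y) * t y)"
    and "\<bar>\<integral>y. (f (y + b) + g (y + b)) * t y \<partial>lborel\<bar>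
      \<le> C * (LBINT y. \<bar>f y\<bar>) + sqrt (LBINT y. (g y)\<^sup>2) * sqrt (LBINT y. (t y)\<^sup>2)"
proof -
  have [measurable]: "f \<in> borel_measurable borel" "g \<in> borel_measurable borel" "t \<in> borel_measurable borel"
    using f square_integrable_measurable[OF g] square_integrable_measurable[OF t] by auto
  have bound: "\<bar>\<integral>y. (p y + q y) * t y \<partial>lborel\<bar>
      \<le> C * (LBINT y. \<bar>p y\<bar>) + sqrt (LBINT y. (q y)\<^sup>2) * sqrt (LBINT y. (t y)\<^sup>2)"
    and int: "integrable lborel (\<lambda>y. (p y + q y) * t y)"
    if p: "integrable lborel p" and q: "square_integrable lborel q" for p q :: "'a \<Rightarrow> real"
  proof -
    have [measurable]: "p \<in> borel_measurable borel" using p by auto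
    have i1: "integrable lborel (\<lambda>y. p y * t y)"
      by (rule integrable_bounded_mult[OF p _ C]) simp
    have i2: "integrable lborel (\<lambda>y. q y * t y)"
      by (rule integrable_square_integrable_mult[OF q t])
    show "integrable lborel (\<lambda>y. (p y + q y) * t y)"
      using Bochner_Integration.integrable_add[OF i1 i2] by (simp only: distrib_right)
    have "\<bar>\<integral>y. (p y + q y) * t y \<partial>lborel\<bar> = \<bar>(LBINT y. p y * t y) + (LBINT y. q y * t y)\<bar>"
      using i1 i2 by (simp add: distrib_right)
    also have "\<dots> \<le> (LBINT y. \<bar>p y * t y\<bar>) + (LBINT y. \<bar>q y * t y\<bar>)"
      by (intro order_trans[OF abs_triangle_ineq] add_mono integral_abs_bound)
    also have "(LBINT y. \<bar>p y * t y\<bar>) \<le> (LBINT y. C * \<bar>p y\<bar>)"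
    proof (rule integral_mono)
      show "\<bar>p y * t y\<bar> \<le> C * \<bar>p y\<bar>" for y
        using mult_right_mono[OF C[of y], of "\<bar>p y\<bar>"] by (simp add: abs_mult mult_ac)
    qed (use i1 p in auto)
    also have "(LBINT y. \<bar>q y * t y\<bar>) \<le> sqrt (LBINT y. (q y)\<^sup>2) * sqrt (LBINT y. (t y)\<^sup>2)"
      by (rule integral_Cauchy_Schwarz[OF q t])
    finally show "\<bar>\<integral>y. (p y + q y) * t y \<partial>lborel\<bar>
      \<le> C * (LBINT y. \<bar>p y\<bar>) + sqrt (LBINT y. (q y)\<^sup>2) * sqrt (LBINT y. (t y)\<^sup>2)"
      by simp
  qed
  have "(LBINT y. \<bar>f (y + b)\<bar>) = (LBINT y. \<bar>f y\<bar>)"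
    by (rule lborel_integral_translate[of "\<lambda>x. \<bar>f x\<bar>"]) simp
  moreover have "(LBINT y. (g (y + b))\<^sup>2) = (LBINT y. (g y)\<^sup>2)"
    by (rule lborel_integral_translate[of "\<lambda>x. (g x)\<^sup>2"]) simp
  ultimately show "\<bar>\<integral>y. (f (y + b) + g (y + b)) * t y \<partial>lborel\<bar>
      \<le> C * (LBINT y. \<bar>f y\<bar>) + sqrt (LBINT y. (g y)\<^sup>2) * sqrt (LBINT y. (t y)\<^sup>2)"
    using bound[OF lborel_integrable_translate[OF f] square_integrable_translate[OF g], of b b] by simp
  show "(\<lambda>n. \<integral>y. (f (y + h n) + g (y + h n)) * t y \<partial>lborel) \<longlonglongrightarrow> (LBINT y. (f y + g y) * t y)"
  proof (rule LIM_zero_cancel, rule Lim_null_comparison[OF always_eventually], rule allI)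
    fix n
    note fn = lborel_integrable_translate[OF f, of "h n"] and gn = square_integrable_translate[OF g, of "h n"]
    have "(LBINT y. (f (y + h n) + g (y + h n)) * t y) - (LBINT y. (f y + g y) * t y)
      = (LBINT y. (f (y + h n) + g (y + h n)) * t y - (f y + g y) * t y)"
      by (rule Bochner_Integration.integral_diff[symmetric]) (intro int fn gn f g)+
    also have "\<dots> = (LBINT y. ((f (y + h n) - f y) + (g (y + h n) - g y)) * t y)"
      by (simp add: algebra_simps)
    finally show "norm ((LBINT y. (f (y + h n) + g (y + h n)) * t y) - (LBINT y. (f y + g y) * t y))
      \<le> C * (LBINT y. \<bar>f (y + h n) - f y\<bar>)
        + sqrt (LBINT y. (g (y + h n) - g y)\<^sup>2) * sqrt (LBINT y. (t y)\<^sup>2)"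
      using bound[OF Bochner_Integration.integrable_diff[OF fn f] square_integrable_diff[OF gn g]]
      by (simp only: real_norm_def)
  next
    have "(\<lambda>n. C * (LBINT y. \<bar>f (y + h n) - f y\<bar>)
        + sqrt (LBINT y. (g (y + h n) - g y)\<^sup>2) * sqrt (LBINT y. (t y)\<^sup>2))
      \<longlonglongrightarrow> C * 0 + sqrt 0 * sqrt (LBINT y. (t y)\<^sup>2)"
      by (intro tendsto_intros tendsto_translate_L1 tendsto_translate_L2 f h square_integrableD g) simp
    then show "(\<lambda>n. C * (LBINT y. \<bar>f (y + h n) - f y\<bar>)
        + sqrt (LBINT y. (g (y + h n) - g y)\<^sup>2) * sqrt (LBINT y. (t y)\<^sup>2)) \<longlonglongrightarrow> 0"
      by simp
  qed
qed

text \<open>The left form appears when the equation is tested with a rescaled bump centred at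
  \<open>y\<close>; the right form is the one suited to limits, as its inner integral converges for
  each fixed \<open>z\<close>.\<close>

lemma mollified_pairing_swap:
  fixes K f g t :: "'a::euclidean_space \<Rightarrow> real"
  assumes K: "integrable lborel K" and f: "integrable lborel f" and g: "square_integrable lborel g"
    and t: "square_integrable lborel t" and C: "\<And>x. \<bar>t x\<bar> \<le> C"
  shows "(LBINT y. (LBINT z. (f (y + e *\<^sub>R z) + g (y + e *\<^sub>R z)) * K z) * t y)
    = (LBINT z. K z * (LBINT y. (f (y + e *\<^sub>R z) + g (y + e *\<^sub>R z)) * t y))"
proof -
  have [measurable]: "t \<in> borel_measurable borel" using square_integrable_measurable[OF t] by simp
  let ?F = "\<lambda>z y. K z * ((f (y + e *\<^sub>R z) + g (y + e *\<^sub>R z)) * t y)"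
  have "integrable (lborel \<Otimes>\<^sub>M lborel)
      (\<lambda>p. (\<lambda>(z, y). K z * (f (y + e *\<^sub>R z) * t y)) p + (\<lambda>(z, y). K z * (g (y + e *\<^sub>R z) * t y)) p)"
    by (intro Bochner_Integration.integrable_add integrable_pair_translate_bounded[OF K f _ C, where a = "\<lambda>z. e *\<^sub>R z"]
        integrable_pair_translate_mult[OF K g t, where a = "\<lambda>z. e *\<^sub>R z"]) simp_all
  also have "(\<lambda>p. (\<lambda>(z, y). K z * (f (y + e *\<^sub>R z) * t y)) p + (\<lambda>(z, y). K z * (g (y + e *\<^sub>R z) * t y)) p)
      = (\<lambda>(z, y). ?F z y)"
    by (auto simp: fun_eq_iff algebra_simps)
  finally have "(LBINT y. (LBINT z. ?F z y)) = (LBINT z. (LBINT y. ?F z y))"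
    by (rule lborel_pair.Fubini_integral)
  moreover have "(LBINT z. ?F z y) = (LBINT z. (f (y + e *\<^sub>R z) + g (y + e *\<^sub>R z)) * K z) * t y" for y
    unfolding integral_mult_left_zero[symmetric] by (simp only: mult_ac)
  ultimately show ?thesis by simp
qed

lemma mollified_pairing_tendsto:
  fixes K f g t :: "'a::euclidean_space \<Rightarrow> real"
  assumes K: "integrable lborel K" and f: "integrable lborel f" and g: "square_integrable lborel g"
    and t: "square_integrable lborel t" and C: "\<And>x. \<bar>t x\<bar> \<le> C" and e: "e \<longlonglongrightarrow> 0"
  shows "(\<lambda>n. \<integral>z. K z * (LBINT y. (f (y + e n *\<^sub>R z) + g (y + e n *\<^sub>R z)) * t y) \<partial>lborel)
    \<longlonglongrightarrow> (LBINT z. K z) * (LBINT y. (f y + g y) * t y)"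
proof -
  have [measurable]: "f \<in> borel_measurable borel" "g \<in> borel_measurable borel" "t \<in> borel_measurable borel"
    "K \<in> borel_measurable borel"
    using f K square_integrable_measurable[OF g] square_integrable_measurable[OF t] by auto
  define B where "B = C * (LBINT y. \<bar>f y\<bar>) + sqrt (LBINT y. (g y)\<^sup>2) * sqrt (LBINT y. (t y)\<^sup>2)"
  have "(\<lambda>n. \<integral>z. K z * (LBINT y. (f (y + e n *\<^sub>R z) + g (y + e n *\<^sub>R z)) * t y) \<partial>lborel)
    \<longlonglongrightarrow> (LBINT z. K z * (LBINT y. (f y + g y) * t y))"
  proof (rule integral_dominated_convergence[where w = "\<lambda>z. \<bar>K z\<bar> * B"])
    show "AE z in lborel. (\<lambda>n. K z * (LBINT y. (f (y + e n *\<^sub>R z) + g (y + e n *\<^sub>R z)) * t y))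
        \<longlonglongrightarrow> K z * (LBINT y. (f y + g y) * t y)"
    proof (intro AE_I2 tendsto_mult tendsto_const translate_pairing_tendsto(1)[OF f g t C])
      fix z :: 'a
      have "(\<lambda>n. e n *\<^sub>R z) \<longlonglongrightarrow> 0 *\<^sub>R z" by (intro tendsto_intros e)
      then show "(\<lambda>n. e n *\<^sub>R z) \<longlonglongrightarrow> 0" by simp
    qed
    show "AE z in lborel. norm (K z * (LBINT y. (f (y + e n *\<^sub>R z) + g (y + e n *\<^sub>R z)) * t y)) \<le> \<bar>K z\<bar> * B" for n
    proof (rule AE_I2)
      fix z
      show "norm (K z * (LBINT y. (f (y + e n *\<^sub>R z) + g (y + e n *\<^sub>R z)) * t y)) \<le> \<bar>K z\<bar> * B"
        unfolding B_def real_norm_def abs_mult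
        by (intro mult_left_mono translate_pairing_tendsto(2)[OF f g t C tendsto_const]) simp
    qed
    show "integrable lborel (\<lambda>z. \<bar>K z\<bar> * B)" using K by simp
  qed simp_all
  then show ?thesis by simp
qed

text \<open>Substitution \<open>x = y + e *\<^sub>R z\<close>. The argument of \<open>k\<close> is
  written as a multiple of \<open>x\<close> plus a constant, in the shape expected by
  \<open>bump_test_affine\<close>.\<close>

lemma integral_rescaled_kernel:
  fixes f k :: "'a::euclidean_space \<Rightarrow> real"
  assumes [measurable]: "f \<in> borel_measurable borel" "k \<in> borel_measurable borel" and e: "e > 0"
  shows "(LBINT x. f x * k ((1 / e) *\<^sub>R x + (- (1 / e)) *\<^sub>R y))
    = e ^ DIM('a) * (LBINT z. f (y + e *\<^sub>R z) * k z)"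
proof -
  have "(1 / e) *\<^sub>R (y + e *\<^sub>R z) + (- (1 / e)) *\<^sub>R y = z" for z
    using e by (simp add: algebra_simps)
  then show ?thesis
    using lborel_integral_affine[of "\<lambda>x. f x * k ((1 / e) *\<^sub>R x + (- (1 / e)) *\<^sub>R y)" e y] e by simp
qed

text \<open>All mollifications of \<open>f\<close> vanish, hence so do their pairings with
  \<open>f / (1 + |f|)\<close>, a bounded square integrable function with the sign of
  \<open>f\<close>. Letting the scale tend to 0 gives that the nonnegative function
  \<open>f^2 / (1 + |f|)\<close> has integral 0.\<close>

lemma AE_zero_if_orthogonal_to_bump_tests:
  fixes f :: "'a::euclidean_space \<Rightarrow> real"
  assumes f: "square_integrable lborel f"
    and orth: "\<And>\<phi>. bump_test \<phi> \<Longrightarrow> (LBINT x. f x * \<phi> x) = 0"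
  shows "AE x in lborel. f x = 0"
proof -
  obtain k :: "'a \<Rightarrow> real" where k: "bump_test k" "(LBINT x. k x) > 0"
    using exists_even_bump_test by metis
  have [measurable]: "f \<in> borel_measurable borel" "k \<in> borel_measurable borel"
    using square_integrable_measurable[OF f] bump_test_measurable[OF k(1)] by auto
  define t where "t x = f x / (1 + \<bar>f x\<bar>)" for x
  have tC: "\<bar>t x\<bar> \<le> 1" for x by (simp add: t_def)
  have tf: "\<bar>t x\<bar> \<le> 1 * \<bar>f x\<bar>" for x
    using mult_left_mono[of 1 "1 + \<bar>f x\<bar>" "\<bar>f x\<bar>"] by (simp add: t_def field_simps)
  have tm[measurable]: "t \<in> borel_measurable borel" unfolding t_def by measurable
  have t: "square_integrable lborel t"
    by (rule square_integrable_bound[OF f _ tf]) simp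
  define e where "e n = inverse (real (Suc n))" for n
  have e: "e \<longlonglongrightarrow> 0" "\<And>n. e n > 0" unfolding e_def using LIMSEQ_inverse_real_of_nat by auto
  have z: "integrable lborel (\<lambda>_::'a. 0::real)" by simp
  have "(LBINT z. k z * (LBINT y. (0 + f (y + e n *\<^sub>R z)) * t y)) = 0" for n
  proof -
    have "(LBINT z. (0 + f (y + e n *\<^sub>R z)) * k z) = 0" for y
    proof -
      have "bump_test (\<lambda>x. k ((1 / e n) *\<^sub>R x + (- (1 / e n)) *\<^sub>R y))"
        using e(2)[of n] by (intro bump_test_affine k) simp
      from orth[OF this] integral_rescaled_kernel[of f k "e n" y] e(2)[of n] show ?thesis by simp
    qed
    then show ?thesis
      using mollified_pairing_swap[OF bump_test_integrable[OF k(1)] z f t tC, of "e n"] by simp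
  qed
  then have "(\<lambda>n::nat. 0) \<longlonglongrightarrow> (LBINT z. k z) * (LBINT y. (0 + f y) * t y)"
    using mollified_pairing_tendsto[OF bump_test_integrable[OF k(1)] z f t tC e(1)] by (simp only:)
  then have "(LBINT z. k z) * (LBINT y. (0 + f y) * t y) = 0"
    by (rule LIMSEQ_unique) simp
  then have "(LBINT y. f y * t y) = 0" using k(2) by simp
  moreover have "f y * t y \<ge> 0" for y by (simp add: t_def)
  ultimately have "AE y in lborel. f y * t y = 0"
    using integral_nonneg_eq_0_iff_AE[OF integrable_square_integrable_mult[OF f t]] by simp
  then show ?thesis by eventually_elim (auto simp: t_def split: if_splits)
qed

text \<open>Cauchy-Schwarz in \<open>s\<close> against the indicator of \<open>{0..1}\<close>, which
  has norm 1, followed by Fubini. The inner square is integrable for almost every \<open>x\<close>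
  only, so the pointwise inequality holds almost everywhere.\<close>

lemma unit_interval_Jensen:
  fixes w :: "real \<Rightarrow> 'a::euclidean_space \<Rightarrow> real"
  assumes [measurable]: "(\<lambda>(s, x). w s x) \<in> borel_measurable (lborel \<Otimes>\<^sub>M lborel)"
    and int: "integrable (lborel \<Otimes>\<^sub>M lborel) (\<lambda>(s, x). indicator {0..1} s * (w s x)\<^sup>2)"
  shows "square_integrable lborel (\<lambda>x. \<integral>s. indicator {0..1} s * w s x \<partial>lborel)"
    and "(LBINT x. (LBINT s. indicator {0..1} s * w s x)\<^sup>2)
      \<le> (LBINT s. indicator {0..1} s * (LBINT x. (w s x)\<^sup>2))"
proof -
  let ?I = "indicator {0..1} :: real \<Rightarrow> real"
  have I: "square_integrable lborel ?I" "(LBINT s. (?I s)\<^sup>2) = 1"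
  proof -
    have [simp]: "(\<lambda>s. (?I s)\<^sup>2) = ?I" by (auto simp: indicator_def)
    show "square_integrable lborel ?I" "(LBINT s. (?I s)\<^sup>2) = 1"
      by (simp_all add: square_integrable_def integrable_indicator_iff)
  qed
  have m[measurable]: "(\<lambda>x. \<integral>s. ?I s * w s x \<partial>lborel) \<in> borel_measurable lborel"
    by measurable
  have ae: "AE x in lborel. (LBINT s. ?I s * w s x)\<^sup>2 \<le> (LBINT s. ?I s * (w s x)\<^sup>2)"
    using lborel_pair.AE_integrable_snd[OF int]
  proof eventually_elim
    case (elim x)
    have sq: "(?I s * w s x)\<^sup>2 = ?I s * (w s x)\<^sup>2" for s by (auto simp: indicator_def)
    have wm[measurable]: "(\<lambda>s. w s x) \<in> borel_measurable lborel" by measurable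
    have W: "square_integrable lborel (\<lambda>s. ?I s * w s x)"
      using elim by (simp add: square_integrable_def sq)
    have II: "?I s * (?I s * w s x) = ?I s * w s x" for s by (auto simp: indicator_def)
    have "\<bar>\<integral>s. ?I s * w s x \<partial>lborel\<bar> \<le> (LBINT s. \<bar>?I s * (?I s * w s x)\<bar>)"
      unfolding II by (rule integral_abs_bound)
    also have "\<dots> \<le> sqrt (LBINT s. ?I s * (w s x)\<^sup>2)"
      using integral_Cauchy_Schwarz[OF I(1) W] unfolding I(2) sq by simp
    finally have "\<bar>\<integral>s. ?I s * w s x \<partial>lborel\<bar> \<le> sqrt (LBINT s. ?I s * (w s x)\<^sup>2)" .
    from power_mono[OF this abs_ge_zero, of 2]
    show ?case by (simp add: integral_nonneg)
  qed
  have i: "integrable lborel (\<lambda>x. \<integral>s. ?I s * (w s x)\<^sup>2 \<partial>lborel)"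
    by (rule lborel_pair.integrable_snd[OF int])
  have i2: "integrable lborel (\<lambda>x. (LBINT s. ?I s * w s x)\<^sup>2)"
  proof (rule Bochner_Integration.integrable_bound[OF i])
    show "AE x in lborel. norm ((LBINT s. ?I s * w s x)\<^sup>2) \<le> norm (LBINT s. ?I s * (w s x)\<^sup>2)"
      using ae by eventually_elim simp
  qed measurable
  then show "square_integrable lborel (\<lambda>x. \<integral>s. ?I s * w s x \<partial>lborel)"
    using m by (simp add: square_integrable_def)
  have "(LBINT x. (LBINT s. ?I s * w s x)\<^sup>2) \<le> (LBINT x. (LBINT s. ?I s * (w s x)\<^sup>2))"
    by (rule integral_mono_AE[OF i2 i ae])
  also have "\<dots> = (LBINT s. (LBINT x. ?I s * (w s x)\<^sup>2))"
    by (rule lborel_pair.Fubini_integral[OF int])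
  finally show "(LBINT x. (LBINT s. ?I s * w s x)\<^sup>2)
      \<le> (LBINT s. ?I s * (LBINT x. (w s x)\<^sup>2))" by simp
qed

subsection \<open>Weak directional derivatives\<close>

text \<open>The direction \<open>h\<close> is arbitrary rather than a basis vector, since increments
  are taken along all \<open>z\<close> in the support of the kernel. Step lengths are absorbed into
  \<open>h\<close>.\<close>

definition weak_deriv :: "'a::euclidean_space \<Rightarrow> ('a \<Rightarrow> real) \<Rightarrow> ('a \<Rightarrow> real) \<Rightarrow> bool" where
  "weak_deriv h u v \<longleftrightarrow> (\<forall>\<phi>. bump_test \<phi> \<longrightarrow>
     (LBINT x. u x * frechet_derivative \<phi> (at x) h) = - (LBINT x. v x * \<phi> x))"

lemma weak_deriv_scale:
  assumes "weak_deriv h u v"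
  shows "weak_deriv (c *\<^sub>R h) u (\<lambda>x. c * v x)"
  unfolding weak_deriv_def
proof (intro allI impI)
  fix \<phi> :: "'a \<Rightarrow> real" assume \<phi>: "bump_test \<phi>"
  have "frechet_derivative \<phi> (at x) (c *\<^sub>R h) = c * frechet_derivative \<phi> (at x) h" for x
    using linear_cmul[OF has_derivative_linear[OF bump_test_derivative[OF \<phi>]]] by simp
  then have "(LBINT x. u x * frechet_derivative \<phi> (at x) (c *\<^sub>R h))
      = c * (LBINT x. u x * frechet_derivative \<phi> (at x) h)"
    by (simp add: mult.left_commute)
  then show "(LBINT x. u x * frechet_derivative \<phi> (at x) (c *\<^sub>R h)) = - (LBINT x. c * v x * \<phi> x)"
    using assms \<phi> by (simp add: weak_deriv_def mult.assoc)
qed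

lemma weak_grad_imp_weak_deriv:
  fixes u :: "'a::euclidean_space \<Rightarrow> real"
  assumes wg: "weak_grad u g" and u: "square_integrable lborel u"
    and g: "\<And>i. square_integrable lborel (\<lambda>x. g x \<bullet> i)"
  shows "weak_deriv h u (\<lambda>x. g x \<bullet> h)"
  unfolding weak_deriv_def
proof (intro allI impI)
  fix \<phi> :: "'a \<Rightarrow> real" assume \<phi>: "bump_test \<phi>"
  let ?D = "\<lambda>x. frechet_derivative \<phi> (at x)"
  have D: "?D x h = (\<Sum>i\<in>Basis. (h \<bullet> i) * ?D x i)" for x
  proof -
    have lin: "linear (?D x)" by (rule has_derivative_linear[OF bump_test_derivative[OF \<phi>]])
    have "?D x h = ?D x (\<Sum>i\<in>Basis. (h \<bullet> i) *\<^sub>R i)" by (simp add: euclidean_representation)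
    also have "\<dots> = (\<Sum>i\<in>Basis. (h \<bullet> i) * ?D x i)"
      by (simp add: linear_sum[OF lin] linear_cmul[OF lin])
    finally show ?thesis .
  qed
  have i1: "integrable lborel (\<lambda>x. (h \<bullet> i) * (u x * ?D x i))" for i
    by (intro integrable_mult_right integrable_square_integrable_mult u
        bump_test_square_integrable bump_test_frechet \<phi>)
  have i2: "integrable lborel (\<lambda>x. (h \<bullet> i) * ((g x \<bullet> i) * \<phi> x))" for i
    by (intro integrable_mult_right integrable_square_integrable_mult g bump_test_square_integrable \<phi>)
  have "(LBINT x. u x * ?D x h) = (LBINT x. (\<Sum>i\<in>Basis. (h \<bullet> i) * (u x * ?D x i)))"
    unfolding D by (simp add: sum_distrib_left mult.left_commute)
  also have "\<dots> = (\<Sum>i\<in>Basis. (h \<bullet> i) * (LBINT x. u x * ?D x i))"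
    using i1 by (simp add: Bochner_Integration.integral_sum)
  also have "\<dots> = (\<Sum>i\<in>Basis. (h \<bullet> i) * - (LBINT x. (g x \<bullet> i) * \<phi> x))"
    using wg bump_test_test_fun[OF \<phi>] unfolding weak_grad_def by (intro sum.cong) auto
  also have "\<dots> = - (LBINT x. (\<Sum>i\<in>Basis. (h \<bullet> i) * ((g x \<bullet> i) * \<phi> x)))"
    using i2 by (simp add: Bochner_Integration.integral_sum sum_negf)
  also have "(\<lambda>x. \<Sum>i\<in>Basis. (h \<bullet> i) * ((g x \<bullet> i) * \<phi> x)) = (\<lambda>x. (g x \<bullet> h) * \<phi> x)"
    by (rule ext) (simp add: euclidean_inner[of _ h] sum_distrib_left mult_ac)
  finally show "(LBINT x. u x * ?D x h) = - (LBINT x. (g x \<bullet> h) * \<phi> x)" .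
qed

lemma integrable_unit_interval_indicator: "integrable lborel (indicator {0..1} :: real \<Rightarrow> real)"
  by (simp add: integrable_indicator_iff)

text \<open>The segment runs backwards from \<open>x\<close> because a translation of the weak
  derivative by \<open>s *\<^sub>R h\<close> becomes a translation by \<open>- s *\<^sub>R h\<close>
  of the test function.\<close>

lemma bump_test_FTC_backward:
  assumes \<phi>: "bump_test \<phi>"
  shows "(LBINT s. indicator {0..1} s * frechet_derivative \<phi> (at (x - s *\<^sub>R h)) h) = \<phi> x - \<phi> (x - h)"
proof -
  have "(LBINT s. indicator {0..1} s *\<^sub>R (frechet_derivative \<phi> (at (x - s *\<^sub>R h)) h))
      = - \<phi> (x - 1 *\<^sub>R h) - - \<phi> (x - 0 *\<^sub>R h)"
  proof (rule integral_FTC_atLeastAtMost)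
    fix s :: real
    have "((\<lambda>s. \<phi> (x - s *\<^sub>R h)) has_real_derivative - frechet_derivative \<phi> (at (x - s *\<^sub>R h)) h) (at s)"
      using bump_test_line_derivative[OF \<phi>, of x "- h" s]
        linear_neg[OF has_derivative_linear[OF bump_test_derivative[OF \<phi>]]] by simp
    from DERIV_minus[OF this]
    show "((\<lambda>s. - \<phi> (x - s *\<^sub>R h)) has_vector_derivative frechet_derivative \<phi> (at (x - s *\<^sub>R h)) h)
        (at s within {0..1})"
      using has_field_derivative_at_within by (fastforce simp: has_real_derivative_iff_has_vector_derivative)
  next
    have "bump_algebra (\<lambda>x. frechet_derivative \<phi> (at x) h)"
      using bump_test_frechet[OF \<phi>] by (simp add: bump_test_def)
    then have "continuous_on UNIV (\<lambda>x. frechet_derivative \<phi> (at x) h)" by (rule bump_algebra_continuous)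
    then show "continuous_on {0..1} (\<lambda>s. frechet_derivative \<phi> (at (x - s *\<^sub>R h)) h)"
      by (rule continuous_on_compose2) (auto intro!: continuous_intros)
  qed simp
  then show ?thesis by simp
qed

text \<open>The difference of the two sides is square integrable and orthogonal to every bump: the
  translations are moved to the bump, the weak derivative is applied for each \<open>s\<close>, and
  the fundamental theorem of calculus is used for the bump instead of \<open>u\<close>.\<close>

lemma weak_deriv_line_integral:
  fixes u v :: "'a::euclidean_space \<Rightarrow> real"
  assumes wd: "weak_deriv h u v" and u: "square_integrable lborel u" and v: "square_integrable lborel v"
  shows "AE x in lborel. u (x + h) - u x = (LBINT s. indicator {0..1} s * v (x + s *\<^sub>R h))"
proof -
  let ?I = "indicator {0..1} :: real \<Rightarrow> real"
  let ?V = "\<lambda>x. \<integral>s. ?I s * v (x + s *\<^sub>R h) \<partial>lborel"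
  have [measurable]: "u \<in> borel_measurable borel" "v \<in> borel_measurable borel"
    using square_integrable_measurable[OF u] square_integrable_measurable[OF v] by auto
  have V: "square_integrable lborel ?V"
    by (rule unit_interval_Jensen(1))
      (use integrable_pair_translate[OF integrable_unit_interval_indicator square_integrableD[OF v],
        where a = "\<lambda>s. s *\<^sub>R h"] in simp_all)
  have uh: "square_integrable lborel (\<lambda>x. u (x + h))" by (rule square_integrable_translate[OF u])
  have "AE x in lborel. u (x + h) - u x - ?V x = 0"
  proof (rule AE_zero_if_orthogonal_to_bump_tests)
    show "square_integrable lborel (\<lambda>x. u (x + h) - u x - ?V x)"
      by (intro square_integrable_diff uh u V)
    fix \<phi> :: "'a \<Rightarrow> real" assume \<phi>: "bump_test \<phi>"
    let ?D = "\<lambda>x. frechet_derivative \<phi> (at x) h"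
    have \<phi>2: "square_integrable lborel \<phi>" and D2: "square_integrable lborel ?D"
      using bump_test_square_integrable bump_test_frechet \<phi> by blast+
    have [measurable]: "\<phi> \<in> borel_measurable borel" "?D \<in> borel_measurable borel"
      using bump_test_measurable bump_test_frechet \<phi> by blast+
    have inner: "(LBINT x. v (x + s *\<^sub>R h) * \<phi> x) = - (LBINT x. ?D (x - s *\<^sub>R h) * u x)" for s
    proof -
      let ?\<psi> = "\<lambda>x. \<phi> (x + - (s *\<^sub>R h))"
      have \<psi>: "bump_test ?\<psi>" by (rule bump_test_translate[OF \<phi>])
      have "(?\<psi> has_derivative frechet_derivative \<phi> (at (x + - (s *\<^sub>R h)))) (at x)" for x
      proof -
        have "((\<lambda>x. x + - (s *\<^sub>R h)) has_derivative (\<lambda>y. y)) (at x)"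
          by (auto intro!: derivative_eq_intros)
        from has_derivative_compose[OF this bump_test_derivative[OF \<phi>]] show ?thesis .
      qed
      then have D\<psi>: "frechet_derivative ?\<psi> (at x) = frechet_derivative \<phi> (at (x + - (s *\<^sub>R h)))" for x
        using frechet_derivative_at by metis
      have "(LBINT x. v (x + s *\<^sub>R h) * \<phi> x) = (LBINT x. v x * ?\<psi> x)"
        using lborel_integral_translate[of "\<lambda>x. v x * ?\<psi> x" "s *\<^sub>R h"] by simp
      also have "\<dots> = - (LBINT x. u x * ?D (x + - (s *\<^sub>R h)))"
        using wd \<psi> unfolding weak_deriv_def D\<psi>[symmetric] by simp
      finally show ?thesis by (simp add: mult.commute)
    qed
    have "(LBINT x. ?V x * \<phi> x) = (LBINT x. (LBINT s. ?I s * (v (x + s *\<^sub>R h) * \<phi> x)))"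
      unfolding integral_mult_left_zero[symmetric] by (simp only: mult.assoc)
    also have "\<dots> = (LBINT s. (LBINT x. ?I s * (v (x + s *\<^sub>R h) * \<phi> x)))"
      by (rule lborel_pair.Fubini_integral,
          rule integrable_pair_translate_mult[OF integrable_unit_interval_indicator v \<phi>2]) measurable
    also have "\<dots> = - (LBINT s. (LBINT x. ?I s * (?D (x + - (s *\<^sub>R h)) * u x)))"
      using inner by simp
    also have "(LBINT s. (LBINT x. ?I s * (?D (x + - (s *\<^sub>R h)) * u x)))
        = (LBINT x. (LBINT s. ?I s * (?D (x + - (s *\<^sub>R h)) * u x)))"
      by (rule lborel_pair.Fubini_integral[symmetric],
          rule integrable_pair_translate_mult[OF integrable_unit_interval_indicator D2 u]) measurable
    also have "\<dots> = (LBINT x. (LBINT s. ?I s * ?D (x - s *\<^sub>R h)) * u x)"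
      unfolding integral_mult_left_zero[symmetric] by (simp only: mult.assoc diff_conv_add_uminus)
    also have "\<dots> = (LBINT x. (\<phi> x - \<phi> (x - h)) * u x)"
      unfolding bump_test_FTC_backward[OF \<phi>] ..
    also have "\<dots> = (LBINT x. \<phi> x * u x - \<phi> (x + - h) * u x)"
      by (simp add: left_diff_distrib)
    also have "\<dots> = (LBINT x. \<phi> x * u x) - (LBINT x. \<phi> (x + - h) * u x)"
      by (intro Bochner_Integration.integral_diff integrable_square_integrable_mult
          square_integrable_translate \<phi>2 u)
    also have "(LBINT x. \<phi> (x + - h) * u x) = (LBINT x. \<phi> x * u (x + h))"
      using lborel_integral_translate[of "\<lambda>x. \<phi> (x + - h) * u x" h] by simp
    finally have V\<phi>: "(LBINT x. ?V x * \<phi> x) = (LBINT x. u (x + h) * \<phi> x) - (LBINT x. u x * \<phi> x)"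
      by (simp add: mult.commute)
    have "(LBINT x. (u (x + h) - u x - ?V x) * \<phi> x)
        = (LBINT x. u (x + h) * \<phi> x - u x * \<phi> x - ?V x * \<phi> x)"
      by (simp only: left_diff_distrib)
    also have "\<dots> = (LBINT x. u (x + h) * \<phi> x) - (LBINT x. u x * \<phi> x) - (LBINT x. ?V x * \<phi> x)"
      using integrable_square_integrable_mult[OF uh \<phi>2] integrable_square_integrable_mult[OF u \<phi>2]
        integrable_square_integrable_mult[OF V \<phi>2]
      by (simp only: Bochner_Integration.integral_diff Bochner_Integration.integrable_diff)
    finally show "(LBINT x. (u (x + h) - u x - ?V x) * \<phi> x) = 0" using V\<phi> by simp
  qed
  then show ?thesis by eventually_elim simp
qed

lemma weak_deriv_translate_bound:
  fixes u v :: "'a::euclidean_space \<Rightarrow> real"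
  assumes wd: "weak_deriv h u v" and u: "square_integrable lborel u" and v: "square_integrable lborel v"
  shows "(LBINT x. (u (x + h) - u x)\<^sup>2) \<le> (LBINT x. (v x)\<^sup>2)"
proof -
  let ?I = "indicator {0..1} :: real \<Rightarrow> real"
  have [measurable]: "u \<in> borel_measurable borel" "v \<in> borel_measurable borel"
    using square_integrable_measurable[OF u] square_integrable_measurable[OF v] by auto
  have "(LBINT x. (u (x + h) - u x)\<^sup>2) = (LBINT x. (LBINT s. ?I s * v (x + s *\<^sub>R h))\<^sup>2)"
    by (rule integral_cong_AE) (use weak_deriv_line_integral[OF wd u v] in auto)
  also have "\<dots> \<le> (LBINT s. ?I s * (LBINT x. (v (x + s *\<^sub>R h))\<^sup>2))"
    by (rule unit_interval_Jensen(2))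
      (use integrable_pair_translate[OF integrable_unit_interval_indicator square_integrableD[OF v],
        where a = "\<lambda>s. s *\<^sub>R h"] in simp_all)
  also have "\<dots> = (LBINT x. (v x)\<^sup>2)"
    using lborel_integral_translate[of "\<lambda>x. (v x)\<^sup>2"] by simp
  finally show ?thesis .
qed

text \<open>By the line integral formula the error is the average over \<open>s \<in> {0..1}\<close>
  of \<open>v (x + s *\<^sub>R e n *\<^sub>R h) - v x\<close>, so its mean square is at most the
  average of the translation errors of \<open>v\<close>.\<close>

lemma weak_deriv_difference_quotient_tendsto:
  fixes u v :: "'a::euclidean_space \<Rightarrow> real"
  assumes wd: "weak_deriv h u v" and u: "square_integrable lborel u" and v: "square_integrable lborel v"
    and e: "e \<longlonglongrightarrow> 0" "\<And>n. e n \<noteq> 0"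
  shows "(\<lambda>n. \<integral>x. ((u (x + e n *\<^sub>R h) - u x) / e n - v x)\<^sup>2 \<partial>lborel) \<longlonglongrightarrow> 0"
proof -
  let ?I = "indicator {0..1} :: real \<Rightarrow> real"
  have [measurable]: "u \<in> borel_measurable borel" "v \<in> borel_measurable borel"
    using square_integrable_measurable[OF u] square_integrable_measurable[OF v] by auto
  let ?J = "\<lambda>n s. \<integral>x. (v (x + s *\<^sub>R e n *\<^sub>R h) - v x)\<^sup>2 \<partial>lborel"
  have bound: "(LBINT x. ((u (x + e n *\<^sub>R h) - u x) / e n - v x)\<^sup>2) \<le> (LBINT s. ?I s * ?J n s)" for n
  proof -
    have pair: "integrable (lborel \<Otimes>\<^sub>M lborel) (\<lambda>(s, x). ?I s * (v (x + s *\<^sub>R e n *\<^sub>R h))\<^sup>2)"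
      by (rule integrable_pair_translate[OF integrable_unit_interval_indicator square_integrableD[OF v]])
        measurable
    have ae: "AE x in lborel. (u (x + e n *\<^sub>R h) - u x) / e n - v x
        = (LBINT s. ?I s * (v (x + s *\<^sub>R e n *\<^sub>R h) - v x))"
      using weak_deriv_line_integral[OF weak_deriv_scale[OF wd, of "e n"] u square_integrable_cmult[OF v]]
        lborel_pair.AE_integrable_snd[OF pair]
    proof eventually_elim
      case (elim x)
      \<comment> \<open>Only the square of \<open>v\<close> along the segment is known to be
        integrable; on an interval of finite length \<open>\<bar>a\<bar> \<le> 1 + a\<^sup>2\<close>
        passes to \<open>v\<close> itself, which allows the constant \<open>v x\<close> to be split
        off.\<close>
      have "integrable lborel (\<lambda>s. ?I s + ?I s * (v (x + s *\<^sub>R e n *\<^sub>R h))\<^sup>2)"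
        using elim integrable_unit_interval_indicator by (intro Bochner_Integration.integrable_add) auto
      then have i: "integrable lborel (\<lambda>s. ?I s * v (x + s *\<^sub>R e n *\<^sub>R h))"
      proof (rule integrable_real_bound)
        have "\<bar>a\<bar> \<le> 1 + a\<^sup>2" for a :: real
          using zero_le_power2[of "\<bar>a\<bar> - 1"] by (simp add: power2_diff)
        then show "\<bar>?I s * v (x + s *\<^sub>R e n *\<^sub>R h)\<bar> \<le> ?I s + ?I s * (v (x + s *\<^sub>R e n *\<^sub>R h))\<^sup>2" for s
          by (auto simp: indicator_def)
      qed measurable
      have "(LBINT s. ?I s * (v (x + s *\<^sub>R e n *\<^sub>R h) - v x))
          = (LBINT s. ?I s * v (x + s *\<^sub>R e n *\<^sub>R h) - ?I s * v x)"
        by (simp add: right_diff_distrib)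
      also have "\<dots> = (LBINT s. ?I s * v (x + s *\<^sub>R e n *\<^sub>R h)) - v x"
        using i by (subst Bochner_Integration.integral_diff) (auto intro: integrable_unit_interval_indicator)
      also have "(LBINT s. ?I s * v (x + s *\<^sub>R e n *\<^sub>R h)) = (u (x + e n *\<^sub>R h) - u x) / e n"
        using elim(1) e(2)[of n] by (simp add: mult.left_commute)
      finally show ?case by simp
    qed
    have "(LBINT x. ((u (x + e n *\<^sub>R h) - u x) / e n - v x)\<^sup>2)
        = (LBINT x. (LBINT s. ?I s * (v (x + s *\<^sub>R e n *\<^sub>R h) - v x))\<^sup>2)"
      by (rule integral_cong_AE) (use ae in auto)
    also have "\<dots> \<le> (LBINT s. ?I s * ?J n s)"
    proof (rule unit_interval_Jensen(2))
      have "integrable (lborel \<Otimes>\<^sub>M lborel)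
        (\<lambda>p. 2 * ((\<lambda>(s, x). ?I s * (v (x + s *\<^sub>R e n *\<^sub>R h))\<^sup>2) p + (\<lambda>(s, x). ?I s * (v (x + 0))\<^sup>2) p))"
        by (intro integrable_mult_right Bochner_Integration.integrable_add
            pair integrable_pair_translate[OF integrable_unit_interval_indicator square_integrableD[OF v],
              where a = "\<lambda>s. 0"]) simp_all
      then show "integrable (lborel \<Otimes>\<^sub>M lborel) (\<lambda>(s, x). ?I s * (v (x + s *\<^sub>R e n *\<^sub>R h) - v x)\<^sup>2)"
      proof (rule integrable_real_bound)
        have "(a - b)\<^sup>2 \<le> 2 * (a\<^sup>2 + b\<^sup>2)" for a b :: real
          using zero_le_power2[of "a + b"] by (simp add: power2_eq_square algebra_simps)
        then show "\<bar>(\<lambda>(s, x). ?I s * (v (x + s *\<^sub>R e n *\<^sub>R h) - v x)\<^sup>2) p\<bar>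
          \<le> 2 * ((\<lambda>(s, x). ?I s * (v (x + s *\<^sub>R e n *\<^sub>R h))\<^sup>2) p + (\<lambda>(s, x). ?I s * (v (x + 0))\<^sup>2) p)" for p
          by (cases p) (simp add: indicator_def)
      qed measurable
    qed measurable
    finally show ?thesis .
  qed
  \<comment> \<open>The factor 4 of the dominating function comes from
    \<open>(a - b)\<^sup>2 \<le> 2 * (a\<^sup>2 + b\<^sup>2)\<close> and invariance of the norm
    under translation.\<close>
  have "(\<lambda>n. \<integral>s. ?I s * ?J n s \<partial>lborel) \<longlonglongrightarrow> (LBINT s. ?I s * 0)"
  proof (rule integral_dominated_convergence[where w = "\<lambda>s. ?I s * (4 * (LBINT x. (v x)\<^sup>2))"])
    show "AE s in lborel. (\<lambda>n. ?I s * ?J n s) \<longlonglongrightarrow> ?I s * 0"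
    proof (intro AE_I2 tendsto_mult tendsto_const tendsto_translate_L2 square_integrableD[OF v])
      fix s :: real
      have "(\<lambda>n. s *\<^sub>R e n *\<^sub>R h) \<longlonglongrightarrow> s *\<^sub>R 0 *\<^sub>R h" by (intro tendsto_intros e)
      then show "(\<lambda>n. s *\<^sub>R e n *\<^sub>R h) \<longlonglongrightarrow> 0" by simp
    qed simp
    show "AE s in lborel. norm (?I s * ?J n s) \<le> ?I s * (4 * (LBINT x. (v x)\<^sup>2))" for n
    proof (rule AE_I2)
      fix s :: real
      let ?b = "s *\<^sub>R e n *\<^sub>R h"
      have "?J n s \<le> (LBINT x. 2 * ((v (x + ?b))\<^sup>2 + (v x)\<^sup>2))"
      proof (rule integral_mono)
        show "integrable lborel (\<lambda>x. (v (x + ?b) - v x)\<^sup>2)"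
          by (intro square_integrableD square_integrable_diff square_integrable_translate v)
        show "integrable lborel (\<lambda>x. 2 * ((v (x + ?b))\<^sup>2 + (v x)\<^sup>2))"
          by (intro integrable_mult_right Bochner_Integration.integrable_add square_integrableD
              square_integrable_translate v)
        show "(v (x + ?b) - v x)\<^sup>2 \<le> 2 * ((v (x + ?b))\<^sup>2 + (v x)\<^sup>2)" for x
          using zero_le_power2[of "v (x + ?b) + v x"] by (simp add: power2_eq_square algebra_simps)
      qed
      also have "\<dots> = 2 * ((LBINT x. (v (x + ?b))\<^sup>2) + (LBINT x. (v x)\<^sup>2))"
        using square_integrableD[OF v] square_integrableD[OF square_integrable_translate[OF v]] by simp
      also have "(LBINT x. (v (x + ?b))\<^sup>2) = (LBINT x. (v x)\<^sup>2)"
        by (rule lborel_integral_translate[of "\<lambda>x. (v x)\<^sup>2"]) simp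
      finally have "?J n s \<le> 4 * (LBINT x. (v x)\<^sup>2)" by simp
      moreover have "?J n s \<ge> 0" by simp
      ultimately show "norm (?I s * ?J n s) \<le> ?I s * (4 * (LBINT x. (v x)\<^sup>2))"
        by (simp add: indicator_def)
    qed
    show "integrable lborel (\<lambda>s. ?I s * (4 * (LBINT x. (v x)\<^sup>2)))"
      using integrable_unit_interval_indicator by simp
  qed simp_all
  then have lim: "(\<lambda>n. \<integral>s. ?I s * ?J n s \<partial>lborel) \<longlonglongrightarrow> 0" by simp
  show ?thesis
  proof (rule Lim_null_comparison[OF always_eventually lim], rule allI)
    fix n
    have "0 \<le> (LBINT x. ((u (x + e n *\<^sub>R h) - u x) / e n - v x)\<^sup>2)" by simp
    then show "norm (LBINT x. ((u (x + e n *\<^sub>R h) - u x) / e n - v x)\<^sup>2) \<le> (LBINT s. ?I s * ?J n s)"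
      using bound[of n] unfolding real_norm_def by (subst abs_of_nonneg)
  qed
qed

subsection \<open>A chain rule\<close>

text \<open>The function \<open>\<Phi>\<close> may grow: its quotients are dominated by
  \<open>|A n|\<close> times \<open>M (u (x + e n *\<^sub>R h)) + M (u x)\<close>. Both factors
  converge in mean square, so these dominating functions converge in \<open>L^1\<close>. The bound
  on \<open>\<Phi>'\<close> has the form \<open>M a + M a\<close> because that is the limit of the
  second factor. The instances are \<open>\<Phi> s = s |s|\<close> with \<open>M s = |s|\<close> and
  \<open>\<Phi> s = s^3\<close> with \<open>M s = 3/2 s^2\<close>.\<close>

lemma weak_deriv_chain:
  fixes u v :: "'a::euclidean_space \<Rightarrow> real" and \<Phi> \<Phi>' M :: "real \<Rightarrow> real"
  assumes wd: "weak_deriv h u v" and u: "square_integrable lborel u" and v: "square_integrable lborel v"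
    and \<Phi>: "\<And>s. (\<Phi> has_real_derivative \<Phi>' s) (at s)" and \<Phi>'[measurable]: "\<Phi>' \<in> borel_measurable borel"
    and bound: "\<And>a b. \<bar>\<Phi> a - \<Phi> b\<bar> \<le> \<bar>a - b\<bar> * (M a + M b)" "\<And>a. \<bar>\<Phi>' a\<bar> \<le> M a + M a"
    and Mu: "square_integrable lborel (\<lambda>x. M (u x))"
    and \<Phi>u: "integrable lborel (\<lambda>x. \<Phi> (u x))"
  shows "weak_deriv h (\<lambda>x. \<Phi> (u x)) (\<lambda>x. \<Phi>' (u x) * v x)"
  unfolding weak_deriv_def
proof (intro allI impI)
  fix \<phi> :: "'a \<Rightarrow> real" assume \<phi>: "bump_test \<phi>"
  obtain B where B: "\<And>x. \<bar>\<phi> x\<bar> \<le> B" "B \<ge> 0" using bump_test_bounded[OF \<phi>] by blast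
  define e where "e n = inverse (real (Suc n))" for n
  have e: "e \<longlonglongrightarrow> 0" "\<And>n. e n \<noteq> 0" unfolding e_def using LIMSEQ_inverse_real_of_nat by auto
  have [measurable]: "u \<in> borel_measurable borel" "v \<in> borel_measurable borel" "\<phi> \<in> borel_measurable borel"
    using square_integrable_measurable[OF u] square_integrable_measurable[OF v] bump_test_measurable[OF \<phi>]
    by auto
  have "continuous_on UNIV \<Phi>"
    by (rule continuous_at_imp_continuous_on) (use DERIV_isCont[OF \<Phi>] in auto)
  then have [measurable]: "\<Phi> \<in> borel_measurable borel" by (rule borel_measurable_continuous_onI)
  define A where "A n x = (u (x + e n *\<^sub>R h) - u x) / e n" for n x
  have A: "square_integrable lborel (A n)" for n
    unfolding A_def[abs_def] by (rule square_integrable_difference_quotient[OF u])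
  have Alim: "(\<lambda>n. \<integral>x. (A n x - v x)\<^sup>2 \<partial>lborel) \<longlonglongrightarrow> 0"
    unfolding A_def by (rule weak_deriv_difference_quotient_tendsto[OF wd u v e])
  have Aabs: "(\<lambda>n. \<integral>x. (\<bar>A n x\<bar> - \<bar>v x\<bar>)\<^sup>2 \<partial>lborel) \<longlonglongrightarrow> 0"
  proof (rule Lim_null_comparison[OF always_eventually Alim], rule allI)
    fix n
    have "(LBINT x. (\<bar>A n x\<bar> - \<bar>v x\<bar>)\<^sup>2) \<le> (LBINT x. (A n x - v x)\<^sup>2)"
    proof (rule integral_mono)
      show "integrable lborel (\<lambda>x. (\<bar>A n x\<bar> - \<bar>v x\<bar>)\<^sup>2)"
        by (intro square_integrableD square_integrable_diff square_integrable_abs A v)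
      show "integrable lborel (\<lambda>x. (A n x - v x)\<^sup>2)"
        by (intro square_integrableD square_integrable_diff A v)
      show "(\<bar>A n x\<bar> - \<bar>v x\<bar>)\<^sup>2 \<le> (A n x - v x)\<^sup>2" for x
        using abs_triangle_ineq3[of "A n x" "v x"] by (simp add: abs_le_square_iff)
    qed
    moreover have "0 \<le> (LBINT x. (\<bar>A n x\<bar> - \<bar>v x\<bar>)\<^sup>2)" by simp
    ultimately show "norm (LBINT x. (\<bar>A n x\<bar> - \<bar>v x\<bar>)\<^sup>2) \<le> (LBINT x. (A n x - v x)\<^sup>2)"
      unfolding real_norm_def by (subst abs_of_nonneg)
  qed
  have eh: "(\<lambda>n. e n *\<^sub>R h) \<longlonglongrightarrow> 0" using tendsto_scaleR[OF e(1) tendsto_const[of h]] by simp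
  let ?M = "\<lambda>n x. M (u (x + e n *\<^sub>R h)) + M (u x)"
  have Mn: "square_integrable lborel (?M n)" for n
    by (intro square_integrable_add square_integrable_translate[OF Mu] Mu)
  have M2: "square_integrable lborel (\<lambda>x. M (u x) + M (u x))" by (intro square_integrable_add Mu)
  have Mlim: "(\<lambda>n. \<integral>x. (?M n x - (M (u x) + M (u x)))\<^sup>2 \<partial>lborel) \<longlonglongrightarrow> 0"
    using tendsto_translate_L2[OF _ square_integrableD[OF Mu] eh] square_integrable_measurable[OF Mu] by simp
  define G where "G n x = B * (\<bar>A n x\<bar> * ?M n x)" for n x
  define G' where "G' x = B * (\<bar>v x\<bar> * (M (u x) + M (u x)))" for x
  have M0: "0 \<le> M s + M s" for s using order_trans[OF abs_ge_zero bound(2)] .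
  have *: "(\<lambda>n. \<integral>x. f n x \<partial>lborel) \<longlonglongrightarrow> (LBINT x. \<Phi>' (u x) * v x * \<phi> x)"
    if f_def: "f = (\<lambda>n x. (\<Phi> (u (x + e n *\<^sub>R h)) - \<Phi> (u x)) / e n * \<phi> x)" for f
  proof (rule integral_tendsto_dominated_L1[OF _ _ _ _ _ A v Alim])
    show "f n \<in> borel_measurable lborel" for n unfolding f_def by measurable
    show "(\<lambda>x. \<Phi>' (u x) * v x * \<phi> x) \<in> borel_measurable lborel" by measurable
    show "integrable lborel (G n)" for n
      unfolding G_def by (intro integrable_mult_right integrable_square_integrable_mult square_integrable_abs A Mn)
    show "integrable lborel G'"
      unfolding G'_def by (intro integrable_mult_right integrable_square_integrable_mult square_integrable_abs v M2)
    have "(\<lambda>n. B * (LBINT x. \<bar>\<bar>A n x\<bar> * ?M n x - \<bar>v x\<bar> * (M (u x) + M (u x))\<bar>)) \<longlonglongrightarrow> 0"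
      by (intro tendsto_mult_right_zero tendsto_L1_mult square_integrable_abs A v Aabs Mn M2 Mlim)
    moreover have "\<bar>G n x - G' x\<bar> = B * \<bar>\<bar>A n x\<bar> * ?M n x - \<bar>v x\<bar> * (M (u x) + M (u x))\<bar>" for n x
      unfolding G_def G'_def right_diff_distrib[symmetric] abs_mult using B(2) by simp
    ultimately show "(\<lambda>n. \<integral>x. \<bar>G n x - G' x\<bar> \<partial>lborel) \<longlonglongrightarrow> 0" by simp
    show "\<bar>f n x\<bar> \<le> G n x" for n x
    proof -
      have "\<bar>(\<Phi> (u (x + e n *\<^sub>R h)) - \<Phi> (u x)) / e n\<bar> \<le> \<bar>A n x\<bar> * ?M n x"
        using bound(1)[of "u (x + e n *\<^sub>R h)" "u x"] e(2)[of n]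
        by (simp add: A_def abs_divide divide_right_mono)
      from mult_mono[OF this B(1) order_trans[OF abs_ge_zero this] abs_ge_zero, of x]
      have "\<bar>(\<Phi> (u (x + e n *\<^sub>R h)) - \<Phi> (u x)) / e n\<bar> * \<bar>\<phi> x\<bar> \<le> (\<bar>A n x\<bar> * ?M n x) * B" .
      then show ?thesis by (simp add: f_def G_def abs_mult mult.commute)
    qed
    show "\<bar>\<Phi>' (u x) * v x * \<phi> x\<bar> \<le> G' x" for x
    proof -
      have "\<bar>\<Phi>' (u x)\<bar> * \<bar>v x\<bar> * \<bar>\<phi> x\<bar> \<le> (M (u x) + M (u x)) * \<bar>v x\<bar> * B"
        using bound(2) B M0 by (intro mult_mono) auto
      then show ?thesis by (simp add: G'_def abs_mult mult_ac)
    qed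
    fix r :: "nat \<Rightarrow> nat" and x assume r: "strict_mono r" and lim: "(\<lambda>n. A (r n) x) \<longlonglongrightarrow> v x"
    have er: "(\<lambda>n. e (r n)) \<longlonglongrightarrow> 0" using LIMSEQ_subseq_LIMSEQ[OF e(1) r] by (simp add: o_def)
    have "(\<lambda>n. (\<Phi> (u (x + e (r n) *\<^sub>R h)) - \<Phi> (u x)) / e (r n)) \<longlonglongrightarrow> \<Phi>' (u x) * v x"
      by (rule has_real_derivative_difference_quotient_tendsto[OF \<Phi> er e(2) lim[unfolded A_def]])
    then show "(\<lambda>n. f (r n) x) \<longlonglongrightarrow> \<Phi>' (u x) * v x * \<phi> x"
      unfolding f_def by (intro tendsto_mult tendsto_const)
  qed
  let ?W = "\<lambda>x. \<Phi> (u x)"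
  \<comment> \<open>Discrete integration by parts: a translation moves the increment to
    \<open>\<phi>\<close>, where it becomes a quotient with step \<open>- e n\<close>.\<close>
  have eq: "(LBINT x. (?W (x + e n *\<^sub>R h) - ?W x) / e n * \<phi> x)
      = - (LBINT x. ?W x * ((\<phi> (x + (- e n) *\<^sub>R h) - \<phi> x) / - e n))" for n
  proof -
    have i1: "integrable lborel (\<lambda>x. ?W x * \<phi> x)"
      by (rule integrable_bounded_mult[OF \<Phi>u _ B(1)]) simp
    have i2: "integrable lborel (\<lambda>x. ?W (x + e n *\<^sub>R h) * \<phi> x)"
      by (rule integrable_bounded_mult[OF lborel_integrable_translate[OF \<Phi>u] _ B(1)]) simp
    have i3: "integrable lborel (\<lambda>x. ?W x * \<phi> (x + (- e n) *\<^sub>R h))"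
      by (rule integrable_bounded_mult[OF \<Phi>u _ B(1)]) measurable
    have "(LBINT x. (?W (x + e n *\<^sub>R h) - ?W x) / e n * \<phi> x)
        = (LBINT x. (?W (x + e n *\<^sub>R h) * \<phi> x - ?W x * \<phi> x) / e n)"
      by (simp add: field_simps)
    also have "\<dots> = ((LBINT x. ?W (x + e n *\<^sub>R h) * \<phi> x) - (LBINT x. ?W x * \<phi> x)) / e n"
      using i1 i2 by simp
    also have "(LBINT x. ?W (x + e n *\<^sub>R h) * \<phi> x) = (LBINT x. ?W x * \<phi> (x + (- e n) *\<^sub>R h))"
      using lborel_integral_translate[of "\<lambda>x. ?W x * \<phi> (x + (- e n) *\<^sub>R h)" "e n *\<^sub>R h"] by simp
    also have "((LBINT x. ?W x * \<phi> (x + (- e n) *\<^sub>R h)) - (LBINT x. ?W x * \<phi> x)) / e n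
        = (LBINT x. (?W x * \<phi> (x + (- e n) *\<^sub>R h) - ?W x * \<phi> x) / e n)"
      using i1 i3 by simp
    also have "\<dots> = (LBINT x. - (?W x * ((\<phi> (x + (- e n) *\<^sub>R h) - \<phi> x) / - e n)))"
      by (simp add: right_diff_distrib)
    finally show ?thesis by simp
  qed
  have "(\<lambda>n. - (LBINT x. ?W x * ((\<phi> (x + (- e n) *\<^sub>R h) - \<phi> x) / - e n)))
      \<longlonglongrightarrow> - (LBINT x. ?W x * frechet_derivative \<phi> (at x) h)"
    using tendsto_minus[OF e(1)] e(2)
    by (intro tendsto_minus bump_test_weighted_difference_quotient_tendsto[where e = "\<lambda>n. - e n", OF \<phi> \<Phi>u]) simp_all
  from LIMSEQ_unique[OF this *[OF refl, unfolded eq]]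
  show "(LBINT x. ?W x * frechet_derivative \<phi> (at x) h) = - (LBINT x. \<Phi>' (u x) * v x * \<phi> x)"
    by simp
qed

section \<open>Calculus and inequalities for \<open>s |s|\<close> and \<open>s^3\<close>\<close>

lemma abs_mult_self_has_derivative:
  "((\<lambda>s::real. s * \<bar>s\<bar>) has_real_derivative 2 * \<bar>s\<bar>) (at s)"
proof -
  consider "s > 0" | "s < 0" | "s = 0" by linarith
  then show ?thesis
  proof cases
    case 1
    have "((\<lambda>s. s * s) has_real_derivative 2 * \<bar>s\<bar>) (at s)"
      using 1 by (auto intro!: derivative_eq_intros)
    then show ?thesis
      by (rule has_field_derivative_transform_within_open[of _ _ _ "{0<..}"]) (use 1 in auto)
  next
    case 2
    have "((\<lambda>s. - (s * s)) has_real_derivative 2 * \<bar>s\<bar>) (at s)"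
      using 2 by (auto intro!: derivative_eq_intros)
    then show ?thesis
      by (rule has_field_derivative_transform_within_open[of _ _ _ "{..<0}"]) (use 2 in auto)
  next
    case 3
    have "(\<lambda>h::real. \<bar>h\<bar>) \<midarrow>0\<rightarrow> 0" using tendsto_rabs[OF tendsto_ident_at, of 0] by simp
    then have "(\<lambda>h::real. (h * \<bar>h\<bar>) / h) \<midarrow>0\<rightarrow> 0"
      by (rule Lim_transform_eventually) (auto simp: eventually_at_filter)
    then show ?thesis using 3 by (simp add: DERIV_def)
  qed
qed

lemma abs_mult_self_diff_le:
  fixes a b :: real
  shows "\<bar>a * \<bar>a\<bar> - b * \<bar>b\<bar>\<bar> \<le> \<bar>a - b\<bar> * (\<bar>a\<bar> + \<bar>b\<bar>)"
proof -
  have "a * \<bar>a\<bar> - b * \<bar>b\<bar> = (a - b) * \<bar>a\<bar> + b * (\<bar>a\<bar> - \<bar>b\<bar>)" by (simp add: algebra_simps)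
  also have "\<bar>\<dots>\<bar> \<le> \<bar>a - b\<bar> * \<bar>a\<bar> + \<bar>b\<bar> * \<bar>\<bar>a\<bar> - \<bar>b\<bar>\<bar>"
    using abs_triangle_ineq[of "(a - b) * \<bar>a\<bar>" "b * (\<bar>a\<bar> - \<bar>b\<bar>)"] by (simp add: abs_mult)
  also have "\<bar>b\<bar> * \<bar>\<bar>a\<bar> - \<bar>b\<bar>\<bar> \<le> \<bar>b\<bar> * \<bar>a - b\<bar>"
    by (intro mult_left_mono abs_triangle_ineq3) simp
  finally show ?thesis by (simp add: algebra_simps)
qed

text \<open>The factor \<open>a^2 + a b + b^2\<close> of \<open>a^3 - b^3\<close> is nonnegative and
  at most \<open>3/2 (a^2 + b^2)\<close>, which is the separated form that the chain rule asks
  for.\<close>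

lemma cube_diff_le:
  fixes a b :: real
  shows "\<bar>a ^ 3 - b ^ 3\<bar> \<le> \<bar>a - b\<bar> * (3 / 2 * a\<^sup>2 + 3 / 2 * b\<^sup>2)"
proof -
  have "a ^ 3 - b ^ 3 = (a - b) * (a\<^sup>2 + a * b + b\<^sup>2)" by (simp add: power2_eq_square power3_eq_cube algebra_simps)
  moreover have "0 \<le> a\<^sup>2 + a * b + b\<^sup>2" "a\<^sup>2 + a * b + b\<^sup>2 \<le> 3 / 2 * a\<^sup>2 + 3 / 2 * b\<^sup>2"
    using zero_le_power2[of "a + b"] zero_le_power2[of "a - b"] zero_le_power2[of a] zero_le_power2[of b]
    unfolding power2_sum power2_diff by linarith+
  ultimately show ?thesis by (simp add: abs_mult mult_left_mono)
qed

text \<open>The left side is \<open>(a - b) (a^3 - b^3)\<close>, the product of increments of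
  \<open>u\<close> and \<open>u^3\<close>. For equal signs it is at most
  \<open>(a - b)^2 (a + b)^2\<close>; for opposite signs \<open>|a |a| - b |b||\<close> is
  \<open>a^2 + b^2\<close>, and the factors are estimated by \<open>2 (a^2 + b^2)\<close> and
  \<open>a^2 + b^2\<close>.\<close>

lemma square_diff_mult_le:
  fixes a b :: real
  shows "(a - b)\<^sup>2 * (a\<^sup>2 + a * b + b\<^sup>2) \<le> 2 * (a * \<bar>a\<bar> - b * \<bar>b\<bar>)\<^sup>2"
proof (cases "a * b \<ge> 0")
  case True
  have "(a - b)\<^sup>2 * (a\<^sup>2 + a * b + b\<^sup>2) \<le> (a - b)\<^sup>2 * (a + b)\<^sup>2"
    using True by (intro mult_left_mono) (auto simp: power2_sum)
  also have "\<dots> = (a\<^sup>2 - b\<^sup>2)\<^sup>2" by (simp add: power2_eq_square algebra_simps)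
  also have "\<dots> = (a * \<bar>a\<bar> - b * \<bar>b\<bar>)\<^sup>2"
    using True by (auto simp: zero_le_mult_iff power2_eq_square abs_if algebra_simps)
  finally show ?thesis using zero_le_power2[of "a * \<bar>a\<bar> - b * \<bar>b\<bar>"] by linarith
next
  case False
  have "(a - b)\<^sup>2 * (a\<^sup>2 + a * b + b\<^sup>2) \<le> (2 * (a\<^sup>2 + b\<^sup>2)) * (a\<^sup>2 + b\<^sup>2)"
  proof (intro mult_mono)
    show "(a - b)\<^sup>2 \<le> 2 * (a\<^sup>2 + b\<^sup>2)" using zero_le_power2[of "a + b"] by (simp add: power2_sum power2_diff)
    show "0 \<le> a\<^sup>2 + a * b + b\<^sup>2"
      using zero_le_power2[of "a + b"] zero_le_power2[of a] zero_le_power2[of b] unfolding power2_sum by linarith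
  qed (use False in auto)
  also have "\<dots> = 2 * (a * \<bar>a\<bar> - b * \<bar>b\<bar>)\<^sup>2"
    using False by (auto simp: not_le mult_less_0_iff power2_eq_square abs_if algebra_simps)
  finally show ?thesis .
qed

subsection \<open>Moments of the Laplacian of a bump\<close>

definition bump_laplacian :: "('a::euclidean_space \<Rightarrow> real) \<Rightarrow> 'a \<Rightarrow> real" where
  "bump_laplacian k z = (\<Sum>i\<in>Basis. frechet_derivative (\<lambda>y. frechet_derivative k (at y) i) (at z) i)"

lemma bump_test_zero: "bump_test (\<lambda>_. 0)"
  by (simp add: bump_test_def bump_algebra.const)

lemma bump_test_sum: "finite S \<Longrightarrow> (\<And>i. i \<in> S \<Longrightarrow> bump_test (f i)) \<Longrightarrow> bump_test (\<lambda>x. \<Sum>i\<in>S. f i x)"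
  by (induction S rule: finite_induct) (auto intro: bump_test_add bump_test_zero)

lemma bump_test_laplacian: "bump_test k \<Longrightarrow> bump_test (bump_laplacian k)"
  unfolding bump_laplacian_def[abs_def] by (intro bump_test_sum bump_test_frechet finite_Basis)

lemma frechet_derivative_affine:
  assumes k: "bump_test k"
  shows "frechet_derivative (\<lambda>x. k (c *\<^sub>R x + b)) (at x) h = c * frechet_derivative k (at (c *\<^sub>R x + b)) h"
proof -
  have "((\<lambda>x. c *\<^sub>R x + b) has_derivative (\<lambda>y. c *\<^sub>R y)) (at x)"
    by (auto intro!: derivative_eq_intros)
  from has_derivative_compose[OF this bump_test_derivative[OF k]]
  have "frechet_derivative (\<lambda>x. k (c *\<^sub>R x + b)) (at x)
      = (\<lambda>y. frechet_derivative k (at (c *\<^sub>R x + b)) (c *\<^sub>R y))"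
    by (rule frechet_derivative_at[symmetric])
  then show ?thesis
    using linear_cmul[OF has_derivative_linear[OF bump_test_derivative[OF k]]] by simp
qed

lemma frechet_derivative_cmult_bump_test:
  assumes k: "bump_test k"
  shows "frechet_derivative (\<lambda>x. c * k x) (at x) h = c * frechet_derivative k (at x) h"
  using frechet_derivative_at[OF has_derivative_mult_right[OF bump_test_derivative[OF k], of c x]]
  by (simp add: fun_eq_iff)

lemma bump_laplacian_affine:
  assumes k: "bump_test k" and c: "c \<noteq> 0"
  shows "bump_laplacian (\<lambda>x. k (c *\<^sub>R x + b)) x = c\<^sup>2 * bump_laplacian k (c *\<^sub>R x + b)"
proof -
  have "frechet_derivative (\<lambda>y. frechet_derivative (\<lambda>x. k (c *\<^sub>R x + b)) (at y) i) (at x) i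
      = c\<^sup>2 * frechet_derivative (\<lambda>y. frechet_derivative k (at y) i) (at (c *\<^sub>R x + b)) i" for i
  proof -
    have D: "bump_test (\<lambda>y. frechet_derivative k (at y) i)" by (rule bump_test_frechet[OF k])
    have "frechet_derivative (\<lambda>y. frechet_derivative (\<lambda>x. k (c *\<^sub>R x + b)) (at y) i) (at x) i
        = frechet_derivative (\<lambda>y. c * frechet_derivative k (at (c *\<^sub>R y + b)) i) (at x) i"
      unfolding frechet_derivative_affine[OF k] ..
    also have "\<dots> = c * (c * frechet_derivative (\<lambda>y. frechet_derivative k (at y) i) (at (c *\<^sub>R x + b)) i)"
      by (subst frechet_derivative_cmult_bump_test[OF bump_test_affine[OF D c]])
        (simp only: frechet_derivative_affine[OF D])
    finally show ?thesis by (simp add: power2_eq_square)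
  qed
  then show ?thesis by (simp add: bump_laplacian_def sum_distrib_left)
qed

lemma bump_laplacian_even:
  assumes k: "bump_test k" and even: "\<And>x. k (- x) = k x"
  shows "bump_laplacian k (- x) = bump_laplacian k x"
  using bump_laplacian_affine[OF k, of "-1" 0 x] even by simp

lemma integral_bump_laplacian:
  assumes k: "bump_test k"
  shows "(LBINT z. bump_laplacian k z) = 0"
proof -
  have D: "bump_test (\<lambda>y. frechet_derivative k (at y) i)" for i by (rule bump_test_frechet[OF k])
  have "(LBINT z. bump_laplacian k z)
      = (\<Sum>i\<in>Basis. \<integral>z. frechet_derivative (\<lambda>y. frechet_derivative k (at y) i) (at z) i \<partial>lborel)"
    unfolding bump_laplacian_def
    by (rule Bochner_Integration.integral_sum) (rule bump_test_integrable[OF bump_test_frechet[OF D]])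
  also have "\<dots> = 0" by (simp add: integral_frechet_derivative_bump_test[OF D])
  finally show ?thesis .
qed

text \<open>This makes the final energy isotropic: with \<open>a\<close> the gradient at a point,
  the weighted average over directions \<open>z\<close> of \<open>(a \<bullet> z)^2\<close> is a
  multiple of \<open>(norm a)^2\<close>.\<close>

lemma integral_bump_laplacian_second_moment:
  fixes k :: "'a::euclidean_space \<Rightarrow> real"
  assumes k: "bump_test k"
  shows "(LBINT z. bump_laplacian k z * (a \<bullet> z)\<^sup>2) = 2 * (norm a)\<^sup>2 * (LBINT z. k z)"
proof -
  let ?D = "\<lambda>i y. frechet_derivative k (at y) i"
  let ?DD = "\<lambda>i z. frechet_derivative (?D i) (at z) i"
  have D: "bump_test (?D i)" for i by (rule bump_test_frechet[OF k])
  have ia: "bump_algebra (\<lambda>z. (z \<bullet> a) * (z \<bullet> a))" "bump_algebra (\<lambda>z. z \<bullet> a)"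
    by (intro bump_algebra.intros)+
  have m1: "bump_test (\<lambda>z. (z \<bullet> a) * (z \<bullet> a) * ?DD i z)" for i
    by (rule bump_test_mult[OF ia(1) bump_test_frechet[OF D]])
  have one: "(LBINT z. (z \<bullet> a) * (z \<bullet> a) * ?DD i z) = 2 * (i \<bullet> a)\<^sup>2 * (LBINT z. k z)" for i
  proof -
    \<comment> \<open>Two integrations by parts at once: the derivative of this function is
      \<open>(z \<bullet> a)\<^sup>2 \<partial>\<^sub>i\<partial>\<^sub>i k - 2 (i \<bullet> a)\<^sup>2 k\<close>.\<close>
    let ?f = "\<lambda>z. (z \<bullet> a) * (z \<bullet> a) * ?D i z + (- 2 * (i \<bullet> a)) * (z \<bullet> a) * k z"
    have f: "bump_test ?f"
      by (intro bump_test_add bump_test_mult[OF _ D] bump_test_mult[OF _ k] ia bump_algebra.intros)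
    have "(?f has_derivative (\<lambda>h. (z \<bullet> a) * (z \<bullet> a) * frechet_derivative (?D i) (at z) h
        + ((z \<bullet> a) * (h \<bullet> a) + (h \<bullet> a) * (z \<bullet> a)) * ?D i z
        + ((- 2 * (i \<bullet> a)) * (z \<bullet> a) * frechet_derivative k (at z) h
          + (- 2 * (i \<bullet> a)) * (h \<bullet> a) * k z))) (at z)" for z
      by (intro has_derivative_add has_derivative_mult bump_test_derivative D k
          has_derivative_inner_left has_derivative_ident has_derivative_mult_right)
    then have "frechet_derivative ?f (at z) i = (z \<bullet> a) * (z \<bullet> a) * ?DD i z + (- (2 * (i \<bullet> a)\<^sup>2)) * k z" for z
      by (subst frechet_derivative_at[symmetric]) (auto simp: algebra_simps power2_eq_square)
    then have "0 = (LBINT z. (z \<bullet> a) * (z \<bullet> a) * ?DD i z + (- (2 * (i \<bullet> a)\<^sup>2)) * k z)"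
      using integral_frechet_derivative_bump_test[OF f, of i] by simp
    also have "\<dots> = (LBINT z. (z \<bullet> a) * (z \<bullet> a) * ?DD i z) + (- (2 * (i \<bullet> a)\<^sup>2)) * (LBINT z. k z)"
      by (subst Bochner_Integration.integral_add)
        (auto intro!: integrable_minus bump_test_integrable[OF m1] bump_test_integrable[OF k])
    finally show ?thesis by simp
  qed
  have "(LBINT z. bump_laplacian k z * (a \<bullet> z)\<^sup>2)
      = (LBINT z. (\<Sum>i\<in>Basis. (z \<bullet> a) * (z \<bullet> a) * ?DD i z))"
    unfolding bump_laplacian_def
    by (intro Bochner_Integration.integral_cong refl)
      (simp add: sum_distrib_left inner_commute power2_eq_square mult.commute)
  also have "\<dots> = (\<Sum>i\<in>Basis. 2 * (i \<bullet> a)\<^sup>2 * (LBINT z. k z))"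
    by (subst Bochner_Integration.integral_sum) (auto intro: bump_test_integrable[OF m1] simp: one)
  also have "\<dots> = 2 * (\<Sum>i\<in>Basis. (a \<bullet> i)\<^sup>2) * (LBINT z. k z)"
    by (simp add: sum_distrib_left sum_distrib_right inner_commute)
  also have "(\<Sum>i\<in>Basis. (a \<bullet> i)\<^sup>2) = (norm a)\<^sup>2"
    unfolding power2_norm_eq_inner euclidean_inner[of a a] by (simp add: power2_eq_square)
  finally show ?thesis .
qed

lemma tendsto_L1_square:
  assumes f: "\<And>n. square_integrable M (f n)" "square_integrable M f'"
      "(\<lambda>n. \<integral>x. (f n x - f' x)\<^sup>2 \<partial>M) \<longlonglongrightarrow> 0"
  shows "(\<lambda>n. \<integral>x. \<bar>(f n x)\<^sup>2 - (f' x)\<^sup>2\<bar> \<partial>M) \<longlonglongrightarrow> 0"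
  using tendsto_L1_mult[OF f f] by (simp add: power2_eq_square)

subsection \<open>Products of increments\<close>

text \<open>The polynomial \<open>2/3 s^3 + s\<close> is the primitive of the weight
  \<open>1 + 2 s^2\<close>; its increment is \<open>(a - b) (1 + 2/3 (a^2 + a b + b^2))\<close>. The
  constant \<open>4/3\<close> is \<open>2/3\<close> times the factor 2 of
  \<open>square_diff_mult_le\<close>.\<close>

lemma increment_product_bound:
  fixes a b s t :: real
  assumes "\<bar>s - t\<bar> \<le> \<bar>a - b\<bar>"
  shows "\<bar>((2 / 3 * a ^ 3 + a) - (2 / 3 * b ^ 3 + b)) * (s - t)\<bar>
    \<le> (a - b)\<^sup>2 + 4 / 3 * (a * \<bar>a\<bar> - b * \<bar>b\<bar>)\<^sup>2"
proof -
  have q: "0 \<le> a\<^sup>2 + a * b + b\<^sup>2"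
    using zero_le_power2[of "a + b"] zero_le_power2[of a] zero_le_power2[of b] unfolding power2_sum by linarith
  have "(2 / 3 * a ^ 3 + a) - (2 / 3 * b ^ 3 + b) = (a - b) * (1 + 2 / 3 * (a\<^sup>2 + a * b + b\<^sup>2))"
    by (simp add: power2_eq_square power3_eq_cube field_simps)
  then have "\<bar>((2 / 3 * a ^ 3 + a) - (2 / 3 * b ^ 3 + b)) * (s - t)\<bar>
      = (1 + 2 / 3 * (a\<^sup>2 + a * b + b\<^sup>2)) * (\<bar>a - b\<bar> * \<bar>s - t\<bar>)"
    using q by (simp add: abs_mult mult_ac)
  also have "\<dots> \<le> (1 + 2 / 3 * (a\<^sup>2 + a * b + b\<^sup>2)) * (\<bar>a - b\<bar> * \<bar>a - b\<bar>)"
    using q assms by (intro mult_left_mono) auto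
  also have "\<dots> = (a - b)\<^sup>2 + 2 / 3 * ((a - b)\<^sup>2 * (a\<^sup>2 + a * b + b\<^sup>2))"
    unfolding abs_mult_self_eq power2_eq_square[of "a - b", symmetric]
    by (simp only: distrib_right mult_1_left mult.assoc mult.commute[of "(a - b)\<^sup>2"])
  also have "\<dots> \<le> (a - b)\<^sup>2 + 4 / 3 * (a * \<bar>a\<bar> - b * \<bar>b\<bar>)\<^sup>2"
    using square_diff_mult_le[of a b] by linarith
  finally show ?thesis .
qed

text \<open>The squared quotients of \<open>u\<close> and of \<open>u |u|\<close> converge in
  \<open>L^1\<close> and dominate the integrand. Pointwise convergence is needed along subsequences
  for the quotients \<open>A\<close> of \<open>u\<close> alone, as those of \<open>w\<close> and
  \<open>\<theta>(u)\<close> follow by the chain rule. The second claim is uniform in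
  \<open>n\<close> and quadratic in the derivative along \<open>h\<close>, which later supplies a
  dominating function for the integration over directions.\<close>

lemma increment_product_tendsto:
  fixes u v :: "'a::euclidean_space \<Rightarrow> real" and \<theta> \<theta>' :: "real \<Rightarrow> real"
  assumes wd: "weak_deriv h u v" and u: "square_integrable lborel u" and v: "square_integrable lborel v"
    and uv: "square_integrable lborel (\<lambda>x. 2 * \<bar>u x\<bar> * v x)"
    and u2: "square_integrable lborel (\<lambda>x. u x * \<bar>u x\<bar>)"
    and \<theta>: "\<And>s. (\<theta> has_real_derivative \<theta>' s) (at s)" and [measurable]: "\<theta>' \<in> borel_measurable borel"
    and \<theta>_lip: "\<And>a b. \<bar>\<theta> a - \<theta> b\<bar> \<le> \<bar>a - b\<bar>" "\<And>a. \<bar>\<theta>' a\<bar> \<le> 1"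
    and e: "e \<longlonglongrightarrow> 0" "\<And>n. e n \<noteq> 0"
    and w_def: "w = (\<lambda>x. 2 / 3 * u x ^ 3 + u x)"
  shows "(\<lambda>n. \<integral>y. (w (y + e n *\<^sub>R h) - w y) * (\<theta> (u (y + e n *\<^sub>R h)) - \<theta> (u y)) / (e n)\<^sup>2 \<partial>lborel)
      \<longlonglongrightarrow> (LBINT y. (1 + 2 * (u y)\<^sup>2) * \<theta>' (u y) * (v y)\<^sup>2)" (is ?lim)
    and "\<bar>\<integral>y. (w (y + e n *\<^sub>R h) - w y) * (\<theta> (u (y + e n *\<^sub>R h)) - \<theta> (u y)) / (e n)\<^sup>2 \<partial>lborel\<bar>
      \<le> (LBINT y. (v y)\<^sup>2) + 4 / 3 * (LBINT y. (2 * \<bar>u y\<bar> * v y)\<^sup>2)" (is ?bound)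
proof -
  have [measurable]: "u \<in> borel_measurable borel" "v \<in> borel_measurable borel"
    using square_integrable_measurable[OF u] square_integrable_measurable[OF v] by auto
  have "continuous_on UNIV \<theta>"
    by (rule continuous_at_imp_continuous_on) (use DERIV_isCont[OF \<theta>] in auto)
  then have [measurable]: "\<theta> \<in> borel_measurable borel" by (rule borel_measurable_continuous_onI)
  let ?\<xi> = "\<lambda>x. u x * \<bar>u x\<bar>" and ?\<xi>' = "\<lambda>x. 2 * \<bar>u x\<bar> * v x"
  have ui: "integrable lborel ?\<xi>"
    by (rule integrable_square_integrable_mult[OF u square_integrable_abs[OF u]])
  have wd\<xi>: "weak_deriv h ?\<xi> ?\<xi>'"
    by (rule weak_deriv_chain[OF wd u v abs_mult_self_has_derivative _ abs_mult_self_diff_le _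
          square_integrable_abs[OF u] ui]) simp_all
  define A where "A n x = (u (x + e n *\<^sub>R h) - u x) / e n" for n x
  define X where "X n x = (?\<xi> (x + e n *\<^sub>R h) - ?\<xi> x) / e n" for n x
  have A: "square_integrable lborel (A n)" and X: "square_integrable lborel (X n)" for n
    unfolding A_def[abs_def] X_def[abs_def]
    by (rule square_integrable_difference_quotient[OF u], rule square_integrable_difference_quotient[OF u2])
  have Alim: "(\<lambda>n. \<integral>x. (A n x - v x)\<^sup>2 \<partial>lborel) \<longlonglongrightarrow> 0"
    unfolding A_def by (rule weak_deriv_difference_quotient_tendsto[OF wd u v e])
  have Xlim: "(\<lambda>n. \<integral>x. (X n x - ?\<xi>' x)\<^sup>2 \<partial>lborel) \<longlonglongrightarrow> 0"
    unfolding X_def by (rule weak_deriv_difference_quotient_tendsto[OF wd\<xi> u2 uv e])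
  define f where "f n y = (w (y + e n *\<^sub>R h) - w y) * (\<theta> (u (y + e n *\<^sub>R h)) - \<theta> (u y)) / (e n)\<^sup>2" for n y
  have fm[measurable]: "f n \<in> borel_measurable lborel" for n unfolding f_def w_def by measurable
  have fb: "\<bar>f n x\<bar> \<le> (A n x)\<^sup>2 + 4 / 3 * (X n x)\<^sup>2" for n x
  proof -
    have "\<bar>f n x\<bar> \<le> ((u (x + e n *\<^sub>R h) - u x)\<^sup>2 + 4 / 3 * (?\<xi> (x + e n *\<^sub>R h) - ?\<xi> x)\<^sup>2) / (e n)\<^sup>2"
      unfolding f_def w_def abs_divide abs_power2
      by (intro divide_right_mono increment_product_bound \<theta>_lip) simp
    then show ?thesis by (simp add: A_def X_def power_divide add_divide_distrib)
  qed
  have AX: "integrable lborel (\<lambda>x. (A n x)\<^sup>2 + 4 / 3 * (X n x)\<^sup>2)" for n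
    by (intro Bochner_Integration.integrable_add integrable_mult_right square_integrableD A X)
  \<comment> \<open>The limit of the dominating functions has to dominate the limit integrand: it
    equals \<open>v^2 + 16/3 u^2 v^2\<close>, and only \<open>v^2 + 2 u^2 v^2\<close> is
    required.\<close>
  have f'b: "\<bar>(1 + 2 * (u x)\<^sup>2) * \<theta>' (u x) * (v x)\<^sup>2\<bar> \<le> (v x)\<^sup>2 + 4 / 3 * (?\<xi>' x)\<^sup>2" for x
  proof -
    have "\<bar>(1 + 2 * (u x)\<^sup>2) * \<theta>' (u x) * (v x)\<^sup>2\<bar> = (1 + 2 * (u x)\<^sup>2) * (v x)\<^sup>2 * \<bar>\<theta>' (u x)\<bar>"
      by (simp add: abs_mult)
    also have "\<dots> \<le> (1 + 2 * (u x)\<^sup>2) * (v x)\<^sup>2 * 1"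
      by (intro mult_left_mono \<theta>_lip) simp
    also have "\<dots> \<le> (v x)\<^sup>2 + 4 / 3 * (?\<xi>' x)\<^sup>2"
      by (simp add: power_mult_distrib algebra_simps)
    finally show ?thesis .
  qed
  have "(\<lambda>n. \<integral>x. f n x \<partial>lborel) \<longlonglongrightarrow> (LBINT y. (1 + 2 * (u y)\<^sup>2) * \<theta>' (u y) * (v y)\<^sup>2)"
  proof (rule integral_tendsto_dominated_L1[OF fm _ AX _ _ A v Alim fb f'b])
    show "(\<lambda>x. (1 + 2 * (u x)\<^sup>2) * \<theta>' (u x) * (v x)\<^sup>2) \<in> borel_measurable lborel" by measurable
    show "integrable lborel (\<lambda>x. (v x)\<^sup>2 + 4 / 3 * (?\<xi>' x)\<^sup>2)"
      by (intro Bochner_Integration.integrable_add integrable_mult_right square_integrableD v uv)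
    have lim: "(\<lambda>n. (LBINT x. \<bar>(A n x)\<^sup>2 - (v x)\<^sup>2\<bar>) + 4 / 3 * (LBINT x. \<bar>(X n x)\<^sup>2 - (?\<xi>' x)\<^sup>2\<bar>)) \<longlonglongrightarrow> 0"
      using tendsto_add[OF tendsto_L1_square[OF A v Alim]
          tendsto_mult_right_zero[OF tendsto_L1_square[OF X uv Xlim], of "4 / 3"]] by simp
    show "(\<lambda>n. \<integral>x. \<bar>((A n x)\<^sup>2 + 4 / 3 * (X n x)\<^sup>2) - ((v x)\<^sup>2 + 4 / 3 * (?\<xi>' x)\<^sup>2)\<bar> \<partial>lborel) \<longlonglongrightarrow> 0"
    proof (rule Lim_null_comparison[OF always_eventually lim], rule allI)
      fix n
      have i1: "integrable lborel (\<lambda>x. (A n x)\<^sup>2 - (v x)\<^sup>2)"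
        by (intro Bochner_Integration.integrable_diff square_integrableD A v)
      have i2: "integrable lborel (\<lambda>x. 4 / 3 * ((X n x)\<^sup>2 - (?\<xi>' x)\<^sup>2))"
        by (intro integrable_mult_right Bochner_Integration.integrable_diff square_integrableD X uv)
      have "(LBINT x. \<bar>((A n x)\<^sup>2 + 4 / 3 * (X n x)\<^sup>2) - ((v x)\<^sup>2 + 4 / 3 * (?\<xi>' x)\<^sup>2)\<bar>)
          = (LBINT x. \<bar>((A n x)\<^sup>2 - (v x)\<^sup>2) + 4 / 3 * ((X n x)\<^sup>2 - (?\<xi>' x)\<^sup>2)\<bar>)"
        by (simp add: algebra_simps)
      also have "\<dots> \<le> (LBINT x. \<bar>(A n x)\<^sup>2 - (v x)\<^sup>2\<bar>) + (LBINT x. \<bar>4 / 3 * ((X n x)\<^sup>2 - (?\<xi>' x)\<^sup>2)\<bar>)"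
        by (rule integral_abs_add_le[OF i1 i2])
      also have "(LBINT x. \<bar>4 / 3 * ((X n x)\<^sup>2 - (?\<xi>' x)\<^sup>2)\<bar>) = 4 / 3 * (LBINT x. \<bar>(X n x)\<^sup>2 - (?\<xi>' x)\<^sup>2\<bar>)"
        unfolding abs_mult by simp
      finally show "norm (LBINT x. \<bar>((A n x)\<^sup>2 + 4 / 3 * (X n x)\<^sup>2) - ((v x)\<^sup>2 + 4 / 3 * (?\<xi>' x)\<^sup>2)\<bar>)
          \<le> (LBINT x. \<bar>(A n x)\<^sup>2 - (v x)\<^sup>2\<bar>) + 4 / 3 * (LBINT x. \<bar>(X n x)\<^sup>2 - (?\<xi>' x)\<^sup>2\<bar>)"
        unfolding real_norm_def by (subst abs_of_nonneg) simp_all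
    qed
    fix r :: "nat \<Rightarrow> nat" and x assume r: "strict_mono r" and lim: "(\<lambda>n. A (r n) x) \<longlonglongrightarrow> v x"
    have er: "(\<lambda>n. e (r n)) \<longlonglongrightarrow> 0" using LIMSEQ_subseq_LIMSEQ[OF e(1) r] by (simp add: o_def)
    have d: "((\<lambda>s. 2 / 3 * s ^ 3 + s) has_real_derivative 1 + 2 * (u x)\<^sup>2) (at (u x))"
      by (auto intro!: derivative_eq_intros simp: power2_eq_square)
    have "(\<lambda>n. (w (x + e (r n) *\<^sub>R h) - w x) / e (r n)) \<longlonglongrightarrow> (1 + 2 * (u x)\<^sup>2) * v x"
      unfolding w_def
      by (rule has_real_derivative_difference_quotient_tendsto[OF d er e(2) lim[unfolded A_def]])
    moreover have "(\<lambda>n. (\<theta> (u (x + e (r n) *\<^sub>R h)) - \<theta> (u x)) / e (r n)) \<longlonglongrightarrow> \<theta>' (u x) * v x"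
      by (rule has_real_derivative_difference_quotient_tendsto[OF \<theta> er e(2) lim[unfolded A_def]])
    ultimately have "(\<lambda>n. (w (x + e (r n) *\<^sub>R h) - w x) / e (r n)
        * ((\<theta> (u (x + e (r n) *\<^sub>R h)) - \<theta> (u x)) / e (r n)))
        \<longlonglongrightarrow> (1 + 2 * (u x)\<^sup>2) * v x * (\<theta>' (u x) * v x)"
      by (rule tendsto_mult)
    then show "(\<lambda>n. f (r n) x) \<longlonglongrightarrow> (1 + 2 * (u x)\<^sup>2) * \<theta>' (u x) * (v x)\<^sup>2"
      by (simp add: f_def power2_eq_square mult_ac)
  qed
  then show ?lim unfolding f_def .
  have "\<bar>\<integral>x. f n x \<partial>lborel\<bar> \<le> (LBINT x. \<bar>f n x\<bar>)" by (rule integral_abs_bound)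
  also have "\<dots> \<le> (LBINT x. (A n x)\<^sup>2 + 4 / 3 * (X n x)\<^sup>2)"
    by (intro integral_mono fb AX integrable_abs integrable_real_bound[OF AX fm fb])
  also have "\<dots> = (LBINT x. (A n x)\<^sup>2) + 4 / 3 * (LBINT x. (X n x)\<^sup>2)"
    using square_integrableD[OF A[of n]] square_integrableD[OF X[of n]] by simp
  \<comment> \<open>Along \<open>e n *\<^sub>R h\<close> the weak derivative is
    \<open>e n * v\<close>, so the square of the step cancels in the quotient.\<close>
  also have "(LBINT x. (A n x)\<^sup>2) \<le> (LBINT y. (v y)\<^sup>2)"
    using weak_deriv_translate_bound[OF weak_deriv_scale[OF wd, of "e n"] u square_integrable_cmult[OF v]] e(2)[of n]
    by (simp add: A_def power_divide power_mult_distrib field_simps)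
  also have "(LBINT x. (X n x)\<^sup>2) \<le> (LBINT y. (?\<xi>' y)\<^sup>2)"
    using weak_deriv_translate_bound[OF weak_deriv_scale[OF wd\<xi>, of "e n"] u2 square_integrable_cmult[OF uv]] e(2)[of n]
    by (simp add: X_def power_divide power_mult_distrib[of "e n"] field_simps)
  finally show ?bound unfolding f_def by simp
qed

subsection \<open>The tested equation\<close>

text \<open>Weak differentiation of \<open>u^3\<close>, through the chain rule, and of
  \<open>u\<close> puts both derivatives on the bump. The equation then constrains
  \<open>w = 2/3 u^3 + u\<close> through integrals against Laplacians of bumps, with no gradient of
  \<open>u\<close> on that side.\<close>

lemma weak_divergence_form_laplacian:
  fixes u :: "'a::euclidean_space \<Rightarrow> real" and g :: "'a \<Rightarrow> 'a"
  assumes wg: "weak_grad u g" and u: "square_integrable lborel u"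
    and g: "\<And>i. square_integrable lborel (\<lambda>x. g x \<bullet> i)"
    and u2: "square_integrable lborel (\<lambda>x. (u x)\<^sup>2)" and u3: "integrable lborel (\<lambda>x. u x ^ 3)"
    and \<phi>: "bump_test \<phi>"
  shows "(LBINT x. (2 / 3 * u x ^ 3 + u x) * bump_laplacian \<phi> x)
    = - (LBINT x. (1 + 2 * (u x)\<^sup>2) * (g x \<bullet> cgrad \<phi> x))"
proof -
  let ?D = "\<lambda>i x. frechet_derivative \<phi> (at x) i"
  let ?DD = "\<lambda>i x. frechet_derivative (?D i) (at x) i"
  let ?w = "\<lambda>x. 2 / 3 * u x ^ 3 + u x"
  have D: "bump_test (?D i)" and DD: "bump_test (?DD i)" for i
    by (intro bump_test_frechet \<phi>)+
  have meas[measurable]: "\<psi> \<in> borel_measurable lborel" if "bump_test \<psi>" for \<psi> :: "'a \<Rightarrow> real"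
    using bump_test_measurable[OF that] by simp
  have i1: "integrable lborel (\<lambda>x. u x ^ 3 * \<psi> x)" and i2: "integrable lborel (\<lambda>x. u x * \<psi> x)"
    and i3: "integrable lborel (\<lambda>x. (u x)\<^sup>2 * (g x \<bullet> i) * \<psi> x)"
    and i4: "integrable lborel (\<lambda>x. (g x \<bullet> i) * \<psi> x)" if \<psi>: "bump_test \<psi>" for \<psi> :: "'a \<Rightarrow> real" and i
  proof -
    obtain B where B: "\<And>x. \<bar>\<psi> x\<bar> \<le> B" using bump_test_bounded[OF \<psi>] by blast
    show "integrable lborel (\<lambda>x. u x ^ 3 * \<psi> x)"
      by (rule integrable_bounded_mult[OF u3 meas[OF \<psi>] B])
    show "integrable lborel (\<lambda>x. u x * \<psi> x)"
      by (rule integrable_square_integrable_mult[OF u bump_test_square_integrable[OF \<psi>]])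
    show "integrable lborel (\<lambda>x. (u x)\<^sup>2 * (g x \<bullet> i) * \<psi> x)"
      by (rule integrable_bounded_mult[OF integrable_square_integrable_mult[OF u2 g] meas[OF \<psi>] B])
    show "integrable lborel (\<lambda>x. (g x \<bullet> i) * \<psi> x)"
      by (rule integrable_square_integrable_mult[OF g bump_test_square_integrable[OF \<psi>]])
  qed
  have part: "(LBINT x. ?w x * ?DD i x) = - (LBINT x. (1 + 2 * (u x)\<^sup>2) * (g x \<bullet> i) * ?D i x)" for i
  proof -
    have wd: "weak_deriv i u (\<lambda>x. g x \<bullet> i)" by (rule weak_grad_imp_weak_deriv[OF wg u g])
    have "weak_deriv i (\<lambda>x. u x ^ 3) (\<lambda>x. 3 * (u x)\<^sup>2 * (g x \<bullet> i))"
    proof (rule weak_deriv_chain[OF wd u g, where M = "\<lambda>s. 3 / 2 * s\<^sup>2" and \<Phi> = "\<lambda>s. s ^ 3" and \<Phi>' = "\<lambda>s. 3 * s\<^sup>2"])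
      show "((\<lambda>s::real. s ^ 3) has_real_derivative 3 * s\<^sup>2) (at s)" for s :: real
        by (auto intro!: derivative_eq_intros)
      show "square_integrable lborel (\<lambda>x. 3 / 2 * (u x)\<^sup>2)" by (rule square_integrable_cmult[OF u2])
    qed (use cube_diff_le u3 in simp_all)
    then have a: "(LBINT x. u x ^ 3 * ?DD i x) = - (LBINT x. 3 * (u x)\<^sup>2 * (g x \<bullet> i) * ?D i x)"
      using D unfolding weak_deriv_def by blast
    have b: "(LBINT x. u x * ?DD i x) = - (LBINT x. (g x \<bullet> i) * ?D i x)"
      using wd D unfolding weak_deriv_def by blast
    have "(LBINT x. ?w x * ?DD i x) = (LBINT x. 2 / 3 * (u x ^ 3 * ?DD i x) + u x * ?DD i x)"
      by (simp only: distrib_right mult.assoc)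
    also have "\<dots> = 2 / 3 * (LBINT x. u x ^ 3 * ?DD i x) + (LBINT x. u x * ?DD i x)"
      using i1[OF DD] i2[OF DD] by simp
    also have "(LBINT x. u x ^ 3 * ?DD i x) = - (3 * (LBINT x. (u x)\<^sup>2 * (g x \<bullet> i) * ?D i x))"
      unfolding a by (simp add: mult.assoc)
    also have "2 / 3 * - (3 * (LBINT x. (u x)\<^sup>2 * (g x \<bullet> i) * ?D i x)) + (LBINT x. u x * ?DD i x)
        = - (2 * (LBINT x. (u x)\<^sup>2 * (g x \<bullet> i) * ?D i x) + (LBINT x. (g x \<bullet> i) * ?D i x))"
      unfolding b by simp
    also have "2 * (LBINT x. (u x)\<^sup>2 * (g x \<bullet> i) * ?D i x) + (LBINT x. (g x \<bullet> i) * ?D i x)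
        = (LBINT x. 2 * ((u x)\<^sup>2 * (g x \<bullet> i) * ?D i x) + (g x \<bullet> i) * ?D i x)"
      using i3[OF D] i4[OF D] by simp
    also have "\<dots> = (LBINT x. (1 + 2 * (u x)\<^sup>2) * (g x \<bullet> i) * ?D i x)"
      by (simp add: algebra_simps)
    finally show ?thesis .
  qed
  have i5: "integrable lborel (\<lambda>x. ?w x * ?DD i x)" for i
  proof -
    have "integrable lborel (\<lambda>x. 2 / 3 * (u x ^ 3 * ?DD i x) + u x * ?DD i x)"
      using i1[OF DD] i2[OF DD] by simp
    then show ?thesis by (simp only: distrib_right mult.assoc)
  qed
  have i6: "integrable lborel (\<lambda>x. (1 + 2 * (u x)\<^sup>2) * (g x \<bullet> i) * ?D i x)" for i
  proof -
    have "integrable lborel (\<lambda>x. 2 * ((u x)\<^sup>2 * (g x \<bullet> i) * ?D i x) + (g x \<bullet> i) * ?D i x)"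
      using i3[OF D] i4[OF D] by simp
    then show ?thesis by (simp add: algebra_simps)
  qed
  have "(LBINT x. ?w x * bump_laplacian \<phi> x) = (LBINT x. (\<Sum>i\<in>Basis. ?w x * ?DD i x))"
    unfolding bump_laplacian_def sum_distrib_left ..
  also have "\<dots> = (\<Sum>i\<in>Basis. - (LBINT x. (1 + 2 * (u x)\<^sup>2) * (g x \<bullet> i) * ?D i x))"
    unfolding part[symmetric] by (rule Bochner_Integration.integral_sum) (rule i5)
  also have "\<dots> = - (LBINT x. (\<Sum>i\<in>Basis. (1 + 2 * (u x)\<^sup>2) * (g x \<bullet> i) * ?D i x))"
    using i6 by (simp add: Bochner_Integration.integral_sum sum_negf)
  also have "(\<lambda>x. \<Sum>i\<in>Basis. (1 + 2 * (u x)\<^sup>2) * (g x \<bullet> i) * ?D i x)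
      = (\<lambda>x. (1 + 2 * (u x)\<^sup>2) * (g x \<bullet> cgrad \<phi> x))"
    by (simp add: cgrad_def inner_sum_right sum_distrib_left mult_ac)
  finally show ?thesis .
qed

text \<open>With \<open>P h\<close> the pairing of \<open>w (y + h)\<close> and \<open>t y\<close>,
  the product of increments integrates to \<open>2 * P 0 - P h - P (- h)\<close>. The mean zero of
  \<open>L\<close> removes \<open>P 0\<close>, and its evenness identifies the other two
  contributions.\<close>

lemma integral_increment_product:
  fixes w t L :: "'a::euclidean_space \<Rightarrow> real"
  assumes f: "integrable lborel f" and g: "square_integrable lborel g"
    and t: "square_integrable lborel t" and C: "\<And>x. \<bar>t x\<bar> \<le> C"
    and L: "integrable lborel L" "\<And>z. L (- z) = L z" "(LBINT z. L z) = 0"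
    and w_def: "w = (\<lambda>x. f x + g x)"
  shows "(LBINT z. L z * (LBINT y. (w (y + e *\<^sub>R z) - w y) * (t (y + e *\<^sub>R z) - t y)))
    = - 2 * (LBINT z. L z * (LBINT y. w (y + e *\<^sub>R z) * t y))"
proof -
  have [measurable]: "f \<in> borel_measurable borel" "g \<in> borel_measurable borel" "t \<in> borel_measurable borel"
    "L \<in> borel_measurable borel"
    using f L(1) square_integrable_measurable[OF g] square_integrable_measurable[OF t] by auto
  have wm[measurable]: "w \<in> borel_measurable borel" unfolding w_def by measurable
  have int: "integrable lborel (\<lambda>y. w (y + a) * t (y + b))" for a b
  proof -
    have "integrable lborel (\<lambda>y. f (y + a) * t (y + b))"
      by (rule integrable_bounded_mult[OF lborel_integrable_translate[OF f] _ C]) measurable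
    moreover have "integrable lborel (\<lambda>y. g (y + a) * t (y + b))"
      by (intro integrable_square_integrable_mult square_integrable_translate g t)
    ultimately show ?thesis unfolding w_def distrib_right by (rule Bochner_Integration.integrable_add)
  qed
  define P where "P h = (LBINT y. w (y + h) * t y)" for h
  have inner: "(LBINT y. (w (y + h) - w y) * (t (y + h) - t y)) = 2 * P 0 - (P h + P (- h))" for h
  proof -
    have "(LBINT y. (w (y + h) - w y) * (t (y + h) - t y))
        = (LBINT y. w (y + h) * t (y + h) + w (y + 0) * t (y + 0) - (w (y + h) * t (y + 0) + w (y + 0) * t (y + h)))"
      by (simp add: algebra_simps)
    also have "\<dots> = (LBINT y. w (y + h) * t (y + h)) + (LBINT y. w (y + 0) * t (y + 0))
        - ((LBINT y. w (y + h) * t (y + 0)) + (LBINT y. w (y + 0) * t (y + h)))"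
      by (simp only: Bochner_Integration.integral_add Bochner_Integration.integral_diff
          Bochner_Integration.integrable_add int)
    also have "(LBINT y. w (y + h) * t (y + h)) = P 0"
      using lborel_integral_translate[of "\<lambda>y. w y * t y" h] by (simp add: P_def)
    also have "(LBINT y. w (y + 0) * t (y + h)) = P (- h)"
      using lborel_integral_translate[of "\<lambda>y. w (y + - h) * t y" h] by (simp add: P_def)
    finally show ?thesis by (simp add: P_def)
  qed
  define B where "B = C * (LBINT y. \<bar>f y\<bar>) + sqrt (LBINT y. (g y)\<^sup>2) * sqrt (LBINT y. (t y)\<^sup>2)"
  have PB: "\<bar>P h\<bar> \<le> B" for h
    unfolding P_def B_def w_def by (rule translate_pairing_tendsto(2)[OF f g t C tendsto_const])
  have Pm[measurable]: "P \<in> borel_measurable borel"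
    unfolding P_def[abs_def] by measurable
  have LP: "integrable lborel (\<lambda>z. L z * P (c *\<^sub>R z))" for c
    by (rule integrable_bounded_mult[OF L(1) _ PB]) measurable
  have "(LBINT z. L z * (LBINT y. (w (y + e *\<^sub>R z) - w y) * (t (y + e *\<^sub>R z) - t y)))
      = (LBINT z. 2 * P 0 * L z - (L z * P (e *\<^sub>R z) + L z * P ((- e) *\<^sub>R z)))"
    unfolding inner by (simp add: algebra_simps)
  also have "\<dots> = 2 * P 0 * (LBINT z. L z)
      - ((LBINT z. L z * P (e *\<^sub>R z)) + (LBINT z. L z * P ((- e) *\<^sub>R z)))"
    using LP[of e] LP[of "- e"] L(1)
    by (simp only: Bochner_Integration.integral_add Bochner_Integration.integral_diff
        Bochner_Integration.integrable_add integrable_mult_right integral_mult_right_zero)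
  also have "(LBINT z. L z * P ((- e) *\<^sub>R z)) = (LBINT z. L z * P (e *\<^sub>R z))"
    using lborel_integral_reflect[of "\<lambda>z. L z * P (e *\<^sub>R z)"] by (simp add: L(2))
  finally show ?thesis by (simp add: L(3) P_def)
qed

text \<open>The bound \<open>C\<close> makes \<open>\<theta>(u)\<close> an admissible factor for the
  integrable \<open>F\<^sub>1\<close>; the Lipschitz condition with \<open>\<theta> 0 = 0\<close>
  makes it square integrable, as needed for \<open>F\<^sub>2\<close>. The Lipschitz constant 1 also
  lets increments of \<open>\<theta>(u)\<close> be replaced by those of \<open>u\<close> in the
  estimates.\<close>

lemma quasilinear_energy_identity:
  fixes u F\<^sub>1 F\<^sub>2 :: "'a::euclidean_space \<Rightarrow> real" and g :: "'a \<Rightarrow> 'a" and \<theta> \<theta>' :: "real \<Rightarrow> real"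
  assumes wg: "weak_grad u g" and u: "square_integrable lborel u"
    and gm[measurable]: "g \<in> borel_measurable borel"
    and g2: "integrable lborel (\<lambda>x. (norm (g x))\<^sup>2)"
    and ug2: "integrable lborel (\<lambda>x. (u x)\<^sup>2 * (norm (g x))\<^sup>2)"
    and u2: "square_integrable lborel (\<lambda>x. (u x)\<^sup>2)" and u3: "integrable lborel (\<lambda>x. u x ^ 3)"
    and F\<^sub>1: "integrable lborel F\<^sub>1" and F\<^sub>2: "square_integrable lborel F\<^sub>2"
    and eq: "\<And>\<phi>. bump_test \<phi> \<Longrightarrow> (LBINT x. (1 + 2 * (u x)\<^sup>2) * (g x \<bullet> cgrad \<phi> x))
      = (LBINT x. (F\<^sub>1 x + F\<^sub>2 x) * \<phi> x)"
    and \<theta>: "\<And>s. (\<theta> has_real_derivative \<theta>' s) (at s)" and \<theta>'[measurable]: "\<theta>' \<in> borel_measurable borel"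
    and \<theta>_lip: "\<And>a b. \<bar>\<theta> a - \<theta> b\<bar> \<le> \<bar>a - b\<bar>" "\<And>a. \<bar>\<theta>' a\<bar> \<le> 1" "\<theta> 0 = 0"
    and \<theta>C: "\<And>a. \<bar>\<theta> a\<bar> \<le> C"
  shows "(LBINT x. (1 + 2 * (u x)\<^sup>2) * \<theta>' (u x) * (norm (g x))\<^sup>2) = (LBINT x. (F\<^sub>1 x + F\<^sub>2 x) * \<theta> (u x))"
proof -
  have [measurable]: "u \<in> borel_measurable borel" using square_integrable_measurable[OF u] by simp
  have "continuous_on UNIV \<theta>"
    by (rule continuous_at_imp_continuous_on) (use DERIV_isCont[OF \<theta>] in auto)
  then have [measurable]: "\<theta> \<in> borel_measurable borel" by (rule borel_measurable_continuous_onI)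
  have nug: "square_integrable lborel (\<lambda>x. u x * norm (g x))"
    using ug2 by (simp add: square_integrable_def power_mult_distrib)
  have g: "square_integrable lborel (\<lambda>x. g x \<bullet> z)" for z
    by (rule square_integrable_inner[OF _ g2]) simp
  have ug: "square_integrable lborel (\<lambda>x. 2 * \<bar>u x\<bar> * (g x \<bullet> z))" for z
  proof (rule square_integrable_bound[OF nug, of _ "2 * norm z"])
    show "\<bar>2 * \<bar>u x\<bar> * (g x \<bullet> z)\<bar> \<le> 2 * norm z * \<bar>u x * norm (g x)\<bar>" for x
      using mult_left_mono[OF Cauchy_Schwarz_ineq2[of "g x" z], of "2 * \<bar>u x\<bar>"] by (simp add: abs_mult mult_ac)
  qed measurable
  have uu: "square_integrable lborel (\<lambda>x. u x * \<bar>u x\<bar>)"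
    by (rule square_integrable_bound[OF u2, of _ 1]) (auto simp: power2_eq_square abs_mult)
  define t where "t x = \<theta> (u x)" for x
  have [measurable]: "t \<in> borel_measurable borel" unfolding t_def by measurable
  have t: "square_integrable lborel t"
    by (rule square_integrable_bound[OF u, of _ 1]) (use \<theta>_lip(1)[of _ 0] \<theta>_lip(3) in \<open>auto simp: t_def\<close>)
  have tC: "\<bar>t x\<bar> \<le> C" for x by (simp add: t_def \<theta>C)
  obtain k :: "'a \<Rightarrow> real" where k: "bump_test k" "\<And>x. k (- x) = k x" "(LBINT x. k x) > 0"
    using exists_even_bump_test by blast
  let ?L = "bump_laplacian k"
  have L: "bump_test ?L" by (rule bump_test_laplacian[OF k(1)])
  have [measurable]: "k \<in> borel_measurable borel" "?L \<in> borel_measurable borel"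
    using bump_test_measurable k(1) L by auto
  note ki = bump_test_integrable[OF k(1)] and Li = bump_test_integrable[OF L]
  define w where "w = (\<lambda>x. 2 / 3 * u x ^ 3 + u x)"
  have [measurable]: "w \<in> borel_measurable borel" unfolding w_def by measurable
  have w1: "integrable lborel (\<lambda>x. 2 / 3 * u x ^ 3)" using u3 by simp
  have [measurable]: "F\<^sub>1 \<in> borel_measurable borel" "F\<^sub>2 \<in> borel_measurable borel"
    using F\<^sub>1 square_integrable_measurable[OF F\<^sub>2] by auto
  define e where "e n = inverse (real (Suc n))" for n
  have e: "e \<longlonglongrightarrow> 0" "\<And>n. e n \<noteq> 0" "\<And>n. e n > 0" unfolding e_def using LIMSEQ_inverse_real_of_nat by auto
  define I where "I n z = (LBINT y. (w (y + e n *\<^sub>R z) - w y) * (\<theta> (u (y + e n *\<^sub>R z)) - \<theta> (u y)) / (e n)\<^sup>2)" for n z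
  define J where "J z = (LBINT y. (1 + 2 * (u y)\<^sup>2) * \<theta>' (u y) * (g y \<bullet> z)\<^sup>2)" for z
  define Q where "Q n = (LBINT z. k z * (LBINT y. (F\<^sub>1 (y + e n *\<^sub>R z) + F\<^sub>2 (y + e n *\<^sub>R z)) * t y))" for n
  \<comment> \<open>Here \<open>r\<close> is the scale \<open>e n\<close> and \<open>m\<close> the
    Jacobian \<open>e n ^ DIM('a)\<close>; the factor \<open>(1 / r)\<^sup>2\<close> comes from the
    two derivatives of the rescaled bump.\<close>
  have cancel: "X = - r\<^sup>2 * Y" if "(1 / r)\<^sup>2 * (m * X) = - (m * Y)" "r > 0" "m > 0" for X Y r m :: real
  proof -
    have "m * X = r\<^sup>2 * ((1 / r)\<^sup>2 * (m * X))" using that(2) by (simp add: power2_eq_square)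
    then have "m * X = m * (- r\<^sup>2 * Y)" unfolding that(1) by simp
    then show ?thesis using that(3) unfolding mult_cancel_left by simp
  qed
  \<comment> \<open>The factor \<open>- 2\<close> of \<open>integral_increment_product\<close> meets
    the factor \<open>- (e n)\<^sup>2\<close> of \<open>per_y\<close>, and the division by
    \<open>(e n)\<^sup>2\<close> in \<open>I\<close> leaves \<open>2\<close>.\<close>
  have IQ: "(LBINT z. ?L z * I n z) = 2 * Q n" for n
  proof -
    have per_y: "(LBINT z. w (y + e n *\<^sub>R z) * ?L z)
        = - (e n)\<^sup>2 * (LBINT z. (F\<^sub>1 (y + e n *\<^sub>R z) + F\<^sub>2 (y + e n *\<^sub>R z)) * k z)" for y
    proof -
      let ?a = "\<lambda>x. (1 / e n) *\<^sub>R x + (- (1 / e n)) *\<^sub>R y"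
      let ?\<phi> = "\<lambda>x. k (?a x)"
      have \<phi>: "bump_test ?\<phi>" using e(2)[of n] by (intro bump_test_affine k) simp
      have "(LBINT x. w x * bump_laplacian ?\<phi> x) = - (LBINT x. (F\<^sub>1 x + F\<^sub>2 x) * ?\<phi> x)"
        using weak_divergence_form_laplacian[OF wg u g u2 u3 \<phi>] eq[OF \<phi>] by (simp add: w_def)
      moreover have "bump_laplacian ?\<phi> x = (1 / e n)\<^sup>2 * ?L (?a x)" for x
        using e(2)[of n] by (intro bump_laplacian_affine k) simp
      ultimately have "(1 / e n)\<^sup>2 * (LBINT x. w x * ?L (?a x)) = - (LBINT x. (F\<^sub>1 x + F\<^sub>2 x) * ?\<phi> x)"
        by (simp only: mult.left_commute[of "w _"] integral_mult_right_zero)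
      moreover have "(LBINT x. w x * ?L (?a x)) = e n ^ DIM('a) * (LBINT z. w (y + e n *\<^sub>R z) * ?L z)"
        by (rule integral_rescaled_kernel) (use e(3) in auto)
      moreover have "(LBINT x. (F\<^sub>1 x + F\<^sub>2 x) * ?\<phi> x)
          = e n ^ DIM('a) * (LBINT z. (F\<^sub>1 (y + e n *\<^sub>R z) + F\<^sub>2 (y + e n *\<^sub>R z)) * k z)"
        by (rule integral_rescaled_kernel) (use e(3) in auto)
      ultimately have "(1 / e n)\<^sup>2 * (e n ^ DIM('a) * (LBINT z. w (y + e n *\<^sub>R z) * ?L z))
          = - (e n ^ DIM('a) * (LBINT z. (F\<^sub>1 (y + e n *\<^sub>R z) + F\<^sub>2 (y + e n *\<^sub>R z)) * k z))"
        by (simp only:)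
      then show ?thesis by (rule cancel[OF _ e(3)]) (use e(3) in simp)
    qed
    have I_eq: "I n z = (1 / (e n)\<^sup>2) * (LBINT y. (w (y + e n *\<^sub>R z) - w y) * (t (y + e n *\<^sub>R z) - t y))" for z
      by (simp add: I_def t_def)
    have "(LBINT z. ?L z * I n z)
        = (1 / (e n)\<^sup>2) * (LBINT z. ?L z * (LBINT y. (w (y + e n *\<^sub>R z) - w y) * (t (y + e n *\<^sub>R z) - t y)))"
      unfolding I_eq by (simp add: mult.left_commute)
    also have "\<dots> = (1 / (e n)\<^sup>2) * (- 2 * (LBINT z. ?L z * (LBINT y. w (y + e n *\<^sub>R z) * t y)))"
      by (subst integral_increment_product[OF w1 u t tC Li bump_laplacian_even[OF k(1,2)]
            integral_bump_laplacian[OF k(1)] w_def]) (rule refl)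
    also have "(LBINT z. ?L z * (LBINT y. w (y + e n *\<^sub>R z) * t y))
        = (LBINT y. (LBINT z. w (y + e n *\<^sub>R z) * ?L z) * t y)"
      unfolding w_def by (rule mollified_pairing_swap[OF Li w1 u t tC, symmetric])
    also have "\<dots> = - (e n)\<^sup>2 * (LBINT y. (LBINT z. (F\<^sub>1 (y + e n *\<^sub>R z) + F\<^sub>2 (y + e n *\<^sub>R z)) * k z) * t y)"
      unfolding per_y by (simp add: mult.assoc)
    also have "(LBINT y. (LBINT z. (F\<^sub>1 (y + e n *\<^sub>R z) + F\<^sub>2 (y + e n *\<^sub>R z)) * k z) * t y) = Q n"
      unfolding Q_def by (rule mollified_pairing_swap[OF ki F\<^sub>1 F\<^sub>2 t tC])
    finally show ?thesis using e(2)[of n] by simp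
  qed
  have "Q \<longlonglongrightarrow> (LBINT z. k z) * (LBINT y. (F\<^sub>1 y + F\<^sub>2 y) * t y)"
    unfolding Q_def by (rule mollified_pairing_tendsto[OF ki F\<^sub>1 F\<^sub>2 t tC e(1)])
  then have lim1: "(\<lambda>n. \<integral>z. ?L z * I n z \<partial>lborel)
      \<longlonglongrightarrow> 2 * ((LBINT z. k z) * (LBINT y. (F\<^sub>1 y + F\<^sub>2 y) * t y))"
    unfolding IQ by (rule tendsto_mult_left)
  \<comment> \<open>\<open>\<bar>I n z\<bar>\<close> is at most \<open>(z \<bullet> z) * S\<close>
    for all \<open>n\<close>; here \<open>16 / 3\<close> is \<open>4 / 3\<close> times the 4 from
    squaring \<open>2 * \<bar>u\<bar>\<close>. The quadratic growth in \<open>z\<close> is harmless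
    because \<open>?L\<close> vanishes outside a ball.\<close>
  define S where "S = (LBINT x. (norm (g x))\<^sup>2) + 16 / 3 * (LBINT x. (u x)\<^sup>2 * (norm (g x))\<^sup>2)"
  have zLi: "integrable lborel (\<lambda>z. (z \<bullet> z) * ?L z)"
    by (rule bump_test_integrable[OF bump_test_mult[OF bump_algebra.square L]])
  have lim2: "(\<lambda>n. \<integral>z. ?L z * I n z \<partial>lborel) \<longlonglongrightarrow> (LBINT z. ?L z * J z)"
  proof (rule integral_dominated_convergence[where w = "\<lambda>z. \<bar>(z \<bullet> z) * ?L z\<bar> * S"])
    show "integrable lborel (\<lambda>z. \<bar>(z \<bullet> z) * ?L z\<bar> * S)" using zLi by simp
    show "(\<lambda>z. ?L z * J z) \<in> borel_measurable lborel" unfolding J_def by measurable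
    show "(\<lambda>z. ?L z * I n z) \<in> borel_measurable lborel" for n unfolding I_def by measurable
    note prod = increment_product_tendsto[OF weak_grad_imp_weak_deriv[OF wg u g] u g ug uu \<theta> \<theta>' \<theta>_lip(1,2) e(1,2) w_def]
    show "AE z in lborel. (\<lambda>n. ?L z * I n z) \<longlonglongrightarrow> ?L z * J z"
      unfolding I_def J_def by (intro AE_I2 tendsto_mult tendsto_const prod(1))
    show "AE z in lborel. norm (?L z * I n z) \<le> \<bar>(z \<bullet> z) * ?L z\<bar> * S" for n
    proof (rule AE_I2)
      fix z :: 'a
      have CS: "(g x \<bullet> z)\<^sup>2 \<le> (z \<bullet> z) * (norm (g x))\<^sup>2" for x
        using Cauchy_Schwarz_ineq[of "g x" z] by (simp add: power2_norm_eq_inner mult.commute)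
      have "\<bar>I n z\<bar> \<le> (LBINT y. (g y \<bullet> z)\<^sup>2) + 4 / 3 * (LBINT y. (2 * \<bar>u y\<bar> * (g y \<bullet> z))\<^sup>2)"
        unfolding I_def by (rule prod(2))
      also have "(LBINT y. (g y \<bullet> z)\<^sup>2) \<le> (LBINT y. (z \<bullet> z) * (norm (g y))\<^sup>2)"
        by (intro integral_mono square_integrableD g integrable_mult_right g2 CS)
      also have "(LBINT y. (2 * \<bar>u y\<bar> * (g y \<bullet> z))\<^sup>2) \<le> (LBINT y. 4 * (z \<bullet> z) * ((u y)\<^sup>2 * (norm (g y))\<^sup>2))"
      proof (intro integral_mono square_integrableD ug integrable_mult_right ug2)
        show "(2 * \<bar>u y\<bar> * (g y \<bullet> z))\<^sup>2 \<le> 4 * (z \<bullet> z) * ((u y)\<^sup>2 * (norm (g y))\<^sup>2)" for y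
          using mult_left_mono[OF CS[of y], of "4 * (u y)\<^sup>2"] by (simp add: power_mult_distrib mult_ac)
      qed
      finally have "\<bar>I n z\<bar> \<le> (z \<bullet> z) * S" by (simp add: S_def algebra_simps)
      from mult_left_mono[OF this, of "\<bar>?L z\<bar>"]
      show "norm (?L z * I n z) \<le> \<bar>(z \<bullet> z) * ?L z\<bar> * S" by (simp add: abs_mult mult_ac)
    qed
  qed
  define \<kappa> where "\<kappa> = (LBINT z. k z)"
  let ?H = "\<lambda>y. (1 + 2 * (u y)\<^sup>2) * \<theta>' (u y)"
  have "(LBINT z. ?L z * J z) = (LBINT z. (LBINT y. ?L z * (?H y * (g y \<bullet> z)\<^sup>2)))"
    by (simp add: J_def)
  also have "\<dots> = (LBINT y. (LBINT z. ?L z * (?H y * (g y \<bullet> z)\<^sup>2)))"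
  proof (rule lborel_pair.Fubini_integral[symmetric])
    have e2: "integrable lborel (\<lambda>x. (1 + 2 * (u x)\<^sup>2) * (norm (g x))\<^sup>2)"
    proof -
      have "integrable lborel (\<lambda>x. (norm (g x))\<^sup>2 + 2 * ((u x)\<^sup>2 * (norm (g x))\<^sup>2))" using g2 ug2 by simp
      then show ?thesis by (simp add: algebra_simps)
    qed
    have "integrable (lborel \<Otimes>\<^sub>M lborel)
        (\<lambda>(z::'a, y::'a). \<bar>(z \<bullet> z) * ?L z\<bar> * ((1 + 2 * (u (y + 0))\<^sup>2) * (norm (g (y + 0)))\<^sup>2))"
      by (rule integrable_pair_translate[OF integrable_abs[OF zLi] e2]) simp
    then show "integrable (lborel \<Otimes>\<^sub>M lborel) (\<lambda>(z, y). ?L z * (?H y * (g y \<bullet> z)\<^sup>2))"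
    proof (rule integrable_real_bound)
      have "\<bar>?L z * (?H y * (g y \<bullet> z)\<^sup>2)\<bar> \<le> \<bar>(z \<bullet> z) * ?L z\<bar> * ((1 + 2 * (u y)\<^sup>2) * (norm (g y))\<^sup>2)" for z y
      proof -
        have "(g y \<bullet> z)\<^sup>2 \<le> (z \<bullet> z) * (norm (g y))\<^sup>2"
          using Cauchy_Schwarz_ineq[of "g y" z] by (simp add: power2_norm_eq_inner mult.commute)
        then have "\<bar>\<theta>' (u y)\<bar> * (g y \<bullet> z)\<^sup>2 \<le> 1 * ((z \<bullet> z) * (norm (g y))\<^sup>2)"
          by (intro mult_mono \<theta>_lip(2)) simp_all
        from mult_left_mono[OF this, of "\<bar>?L z\<bar> * (1 + 2 * (u y)\<^sup>2)"] show ?thesis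
          by (simp add: abs_mult mult_ac)
      qed
      then show "\<bar>(\<lambda>(z, y). ?L z * (?H y * (g y \<bullet> z)\<^sup>2)) p\<bar>
        \<le> (\<lambda>(z, y). \<bar>(z \<bullet> z) * ?L z\<bar> * ((1 + 2 * (u (y + 0))\<^sup>2) * (norm (g (y + 0)))\<^sup>2)) p" for p
        by (cases p) simp
    qed measurable
  qed
  \<comment> \<open>The second moment of the Laplacian contributes a factor 2, which cancels against
    the 2 in \<open>IQ\<close>.\<close>
  also have "\<dots> = (LBINT y. ?H y * (2 * (norm (g y))\<^sup>2 * (LBINT z. k z)))"
    unfolding mult.left_commute[of "?L _"] integral_mult_right_zero
      integral_bump_laplacian_second_moment[OF k(1)] ..
  also have "\<dots> = 2 * ((LBINT z. k z) * (LBINT y. ?H y * (norm (g y))\<^sup>2))"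
    unfolding \<kappa>_def[symmetric] integral_mult_right_zero[symmetric] by (simp only: mult_ac)
  finally have "2 * ((LBINT z. k z) * (LBINT y. ?H y * (norm (g y))\<^sup>2))
      = 2 * ((LBINT z. k z) * (LBINT y. (F\<^sub>1 y + F\<^sub>2 y) * t y))"
    using LIMSEQ_unique[OF lim2 lim1] by (simp only:)
  then show ?thesis using k(3) by (simp add: t_def)
qed

subsection \<open>Nonexistence\<close>

lemma powr_interpolation_le:
  fixes x :: real
  assumes "0 \<le> x" "a \<le> r" "r \<le> b"
  shows "x powr r \<le> x powr a + x powr b"
proof (cases "x \<le> 1")
  case True
  then have "x powr r \<le> x powr a" using assms by (intro powr_mono') auto
  then show ?thesis using powr_ge_zero[of x b] by linarith
next
  case False
  then have "x powr r \<le> x powr b" using assms by (intro powr_mono) auto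
  then show ?thesis using powr_ge_zero[of x a] by linarith
qed

lemma abs_powr_mult_self:
  fixes s :: real
  shows "\<bar>\<bar>s\<bar> powr (r - 2) * s\<bar> = \<bar>s\<bar> powr (r - 1)"
    and "\<bar>s\<bar> powr (r - 2) * s * s = \<bar>s\<bar> powr r"
proof -
  have "\<bar>s\<bar> powr (r - 2) * \<bar>s\<bar> = \<bar>s\<bar> powr (r - 1)" if "s \<noteq> 0"
    using that powr_add[of "\<bar>s\<bar>" "r - 2" 1] by simp
  then show "\<bar>\<bar>s\<bar> powr (r - 2) * s\<bar> = \<bar>s\<bar> powr (r - 1)" by (cases "s = 0") (auto simp: abs_mult)
  have "\<bar>s\<bar> powr (r - 2) * (s * s) = \<bar>s\<bar> powr r" if "s \<noteq> 0"
  proof -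
    have "\<bar>s\<bar> powr (r - 2) * \<bar>s\<bar> powr 2 = \<bar>s\<bar> powr r"
      using powr_add[of "\<bar>s\<bar>" "r - 2" 2] by simp
    then show ?thesis using that by (simp add: powr_numeral power2_eq_square)
  qed
  then show "\<bar>s\<bar> powr (r - 2) * s * s = \<bar>s\<bar> powr r" by (cases "s = 0") (auto simp: mult.assoc)
qed

text \<open>The limit \<open>n \<longrightarrow> \<infinity>\<close> of the previous identity for \<open>\<theta> s = n sin (s / n)\<close>.\<close>

lemma quasilinear_tested_with_solution:
  fixes u :: "'a::euclidean_space \<Rightarrow> real" and g :: "'a \<Rightarrow> 'a" and q p \<tau> lam :: real
  assumes X: "Xt_with_grad u g" and up: "integrable lborel (\<lambda>x. \<bar>u x\<bar> powr p)"
    and p: "4 \<le> p" and q: "2 < q" "q < p"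
    and weq: "\<And>\<phi>. test_fun \<phi> \<Longrightarrow>
     (LBINT x. g x \<bullet> cgrad \<phi> x)
     + 2 * (LBINT x. (u x)\<^sup>2 * (g x \<bullet> cgrad \<phi> x) + u x * (norm (g x))\<^sup>2 * \<phi> x)
     + lam * (LBINT x. u x * \<phi> x)
     = \<tau> * (LBINT x. \<bar>u x\<bar> powr (q - 2) * u x * \<phi> x)
       + (LBINT x. \<bar>u x\<bar> powr (p - 2) * u x * \<phi> x)"
  shows "(LBINT x. (norm (g x))\<^sup>2) + 4 * (LBINT x. (u x)\<^sup>2 * (norm (g x))\<^sup>2)
      + lam * (LBINT x. (u x)\<^sup>2)
    = \<tau> * (LBINT x. \<bar>u x\<bar> powr q) + (LBINT x. \<bar>u x\<bar> powr p)"
proof -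
  have um[measurable]: "u \<in> borel_measurable borel" and gm[measurable]: "g \<in> borel_measurable borel"
    and uL2: "integrable lborel (\<lambda>x. (u x)\<^sup>2)" and g2: "integrable lborel (\<lambda>x. (norm (g x))\<^sup>2)"
    and ug2: "integrable lborel (\<lambda>x. (u x)\<^sup>2 * (norm (g x))\<^sup>2)" and wg: "weak_grad u g"
    using X by (auto simp: Xt_with_grad_def H1_with_grad_def)
  have u: "square_integrable lborel u" using uL2 by (simp add: square_integrable_def)
  have ur: "integrable lborel (\<lambda>x. \<bar>u x\<bar> powr r)" if "2 \<le> r" "r \<le> p" for r
  proof (rule integrable_real_bound[OF Bochner_Integration.integrable_add[OF uL2 up]])
    show "\<bar>\<bar>u x\<bar> powr r\<bar> \<le> (u x)\<^sup>2 + \<bar>u x\<bar> powr p" for x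
      using powr_interpolation_le[of "\<bar>u x\<bar>" 2 r p] that by (cases "u x = 0") (auto simp: powr_numeral)
  qed measurable
  \<comment> \<open>Fourth powers of \<open>u\<close> lie between the exponents 2 and
    \<open>p\<close> because \<open>4 \<le> p\<close>. This is what the chain rule for the cube
    requires.\<close>
  have u2: "square_integrable lborel (\<lambda>x. (u x)\<^sup>2)"
    unfolding square_integrable_def
  proof
    have "((s::real)\<^sup>2)\<^sup>2 = \<bar>s\<bar> powr 4" for s
      by (cases "s = 0") (auto simp: powr_numeral)
    then show "integrable lborel (\<lambda>x. ((u x)\<^sup>2)\<^sup>2)" using ur[of 4] p by simp
  qed measurable
  have u3: "integrable lborel (\<lambda>x. u x ^ 3)"
  proof (rule integrable_real_bound[OF ur[of 3]])
    show "\<bar>u x ^ 3\<bar> \<le> \<bar>u x\<bar> powr 3" for x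
      by (cases "u x = 0") (auto simp: powr_numeral power_abs)
  qed (use p in auto)
  have ng: "square_integrable lborel (\<lambda>x. norm (g x))" using g2 by (simp add: square_integrable_def)
  have nug: "square_integrable lborel (\<lambda>x. u x * norm (g x))"
    using ug2 by (simp add: square_integrable_def power_mult_distrib)
  have ugg: "integrable lborel (\<lambda>x. u x * (norm (g x))\<^sup>2)"
    using integrable_square_integrable_mult[OF nug ng] by (simp add: power2_eq_square mult.assoc)
  have gi: "square_integrable lborel (\<lambda>x. g x \<bullet> z)" for z
    by (rule square_integrable_inner[OF _ g2]) simp
  define Z where "Z s = \<tau> * (\<bar>s\<bar> powr (q - 2) * s) + \<bar>s\<bar> powr (p - 2) * s - lam * s" for s :: real
  have [measurable]: "Z \<in> borel_measurable borel" unfolding Z_def by measurable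
  \<comment> \<open>The sum of the absolute coefficients of \<open>Z\<close>: each of the three
    powers in \<open>Z\<close> is at most \<open>|s|\<close> for \<open>|s| \<le> 1\<close> and at
    most \<open>|s|^p\<close> for \<open>|s| > 1\<close>.\<close>
  define C where "C = \<bar>\<tau>\<bar> + 1 + \<bar>lam\<bar>"
  have Zb: "\<bar>Z s\<bar> \<le> \<bar>\<tau>\<bar> * \<bar>s\<bar> powr (q - 1) + \<bar>s\<bar> powr (p - 1) + \<bar>lam\<bar> * \<bar>s\<bar>" for s
  proof -
    have "\<bar>Z s\<bar> \<le> \<bar>\<tau> * (\<bar>s\<bar> powr (q - 2) * s)\<bar> + \<bar>\<bar>s\<bar> powr (p - 2) * s\<bar> + \<bar>lam * s\<bar>"
      unfolding Z_def by linarith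
    then show ?thesis
      unfolding abs_powr_mult_self(1) abs_mult[of \<tau>] abs_mult[of lam] .
  qed
  have Z_small: "\<bar>Z s\<bar> \<le> C * \<bar>s\<bar>" if "\<bar>s\<bar> \<le> 1" for s
  proof -
    have le: "\<bar>s\<bar> powr (r - 1) \<le> \<bar>s\<bar>" if "2 \<le> r" for r
      using powr_mono'[of 1 "r - 1" "\<bar>s\<bar>"] that \<open>\<bar>s\<bar> \<le> 1\<close> by (cases "s = 0") auto
    have "\<bar>\<tau>\<bar> * \<bar>s\<bar> powr (q - 1) \<le> \<bar>\<tau>\<bar> * \<bar>s\<bar>" using le[of q] q by (intro mult_left_mono) auto
    moreover have "\<bar>s\<bar> powr (p - 1) \<le> \<bar>s\<bar>" using le[of p] p by simp
    ultimately show ?thesis using Zb[of s] unfolding C_def distrib_right mult_1_left by linarith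
  qed
  have Z_large: "\<bar>Z s\<bar> \<le> C * \<bar>s\<bar> powr p" if "1 < \<bar>s\<bar>" for s
  proof -
    have "\<bar>\<tau>\<bar> * \<bar>s\<bar> powr (q - 1) \<le> \<bar>\<tau>\<bar> * \<bar>s\<bar> powr p"
      using that q by (intro mult_left_mono powr_mono) auto
    moreover have "\<bar>s\<bar> powr (p - 1) \<le> \<bar>s\<bar> powr p" using that by (intro powr_mono) auto
    moreover have "\<bar>lam\<bar> * \<bar>s\<bar> \<le> \<bar>lam\<bar> * \<bar>s\<bar> powr p"
      using that p powr_mono[of 1 p "\<bar>s\<bar>"] by (intro mult_left_mono) auto
    ultimately show ?thesis using Zb[of s] unfolding C_def distrib_right mult_1_left by linarith
  qed
  \<comment> \<open>Splitting at \<open>|u| = 1\<close>: where \<open>|u|\<close> is small,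
    \<open>Z (u x)\<close> is bounded by \<open>C |u|\<close> and goes to the square integrable
    part; where it is large, it is bounded by \<open>C |u|^p\<close> and goes to the integrable
    part. The gradient term is the product of the square integrable functions \<open>u |g|\<close>
    and \<open>|g|\<close>.\<close>
  define F\<^sub>1 where "F\<^sub>1 x = - 2 * (u x * (norm (g x))\<^sup>2) + (if \<bar>u x\<bar> \<le> 1 then 0 else Z (u x))" for x
  define F\<^sub>2 where "F\<^sub>2 x = (if \<bar>u x\<bar> \<le> 1 then Z (u x) else 0)" for x
  have F_sum: "F\<^sub>1 x + F\<^sub>2 x = - 2 * (u x * (norm (g x))\<^sup>2) + Z (u x)" for x
    by (simp add: F\<^sub>1_def F\<^sub>2_def)
  have C0: "C \<ge> 0" by (simp add: C_def)
  have F\<^sub>1: "integrable lborel F\<^sub>1"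
    unfolding F\<^sub>1_def[abs_def]
  proof (intro Bochner_Integration.integrable_add integrable_mult_right ugg)
    show "integrable lborel (\<lambda>x. if \<bar>u x\<bar> \<le> 1 then 0 else Z (u x))"
      by (rule integrable_real_bound[OF integrable_mult_right[OF up, of C]])
        (use Z_large C0 in \<open>auto simp: not_le\<close>)
  qed
  have F\<^sub>2: "square_integrable lborel F\<^sub>2"
    by (rule square_integrable_bound[OF u, of _ C]) (use Z_small C0 in \<open>auto simp: F\<^sub>2_def[abs_def]\<close>)
  have eq: "(LBINT x. (1 + 2 * (u x)\<^sup>2) * (g x \<bullet> cgrad \<phi> x)) = (LBINT x. (F\<^sub>1 x + F\<^sub>2 x) * \<phi> x)"
    if \<phi>: "bump_test \<phi>" for \<phi>
  proof -
    obtain B where B: "\<And>x. \<bar>\<phi> x\<bar> \<le> B" using bump_test_bounded[OF \<phi>] by blast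
    have [measurable]: "\<phi> \<in> borel_measurable borel" by (rule bump_test_measurable[OF \<phi>])
    let ?D = "\<lambda>i x. frechet_derivative \<phi> (at x) i"
    have D: "bump_test (?D i)" for i by (rule bump_test_frechet[OF \<phi>])
    have gc: "g x \<bullet> cgrad \<phi> x = (\<Sum>i\<in>Basis. (g x \<bullet> i) * ?D i x)" for x
      by (simp add: cgrad_def inner_sum_right mult.commute)
    have i1: "integrable lborel (\<lambda>x. g x \<bullet> cgrad \<phi> x)"
      unfolding gc by (intro Bochner_Integration.integrable_sum integrable_square_integrable_mult gi
          bump_test_square_integrable D)
    have i2: "integrable lborel (\<lambda>x. (u x)\<^sup>2 * (g x \<bullet> cgrad \<phi> x))"
    proof -
      have "integrable lborel (\<lambda>x. (u x)\<^sup>2 * (g x \<bullet> i) * ?D i x)" for i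
      proof -
        obtain B' where "\<And>x. \<bar>?D i x\<bar> \<le> B'" using bump_test_bounded[OF D] by blast
        then show ?thesis
          using bump_test_measurable[OF D]
          by (intro integrable_bounded_mult[OF integrable_square_integrable_mult[OF u2 gi]]) auto
      qed
      then show ?thesis unfolding gc sum_distrib_left by (simp add: mult.assoc)
    qed
    have i3: "integrable lborel (\<lambda>x. u x * (norm (g x))\<^sup>2 * \<phi> x)"
      by (rule integrable_bounded_mult[OF ugg _ B]) simp
    have i4: "integrable lborel (\<lambda>x. u x * \<phi> x)"
      by (rule integrable_square_integrable_mult[OF u bump_test_square_integrable[OF \<phi>]])
    have i5: "integrable lborel (\<lambda>x. \<bar>u x\<bar> powr (r - 2) * u x * \<phi> x)" if r: "2 \<le> r" "r \<le> p" for r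
    proof (rule integrable_real_bound)
      show "integrable lborel (\<lambda>x. \<bar>u x * \<phi> x\<bar> + \<bar>\<bar>u x\<bar> powr p * \<phi> x\<bar>)"
        using i4 integrable_bounded_mult[OF up _ B] by simp
      show "\<bar>\<bar>u x\<bar> powr (r - 2) * u x * \<phi> x\<bar> \<le> \<bar>u x * \<phi> x\<bar> + \<bar>\<bar>u x\<bar> powr p * \<phi> x\<bar>" for x
      proof -
        have "\<bar>\<bar>u x\<bar> powr (r - 2) * u x\<bar> \<le> \<bar>u x\<bar> + \<bar>u x\<bar> powr p"
          using powr_interpolation_le[of "\<bar>u x\<bar>" 1 "r - 1" p] r unfolding abs_powr_mult_self(1)
          by (cases "u x = 0") auto
        from mult_right_mono[OF this, of "\<bar>\<phi> x\<bar>"] show ?thesis by (simp add: abs_mult distrib_right)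
      qed
    qed measurable
    let ?q = "\<lambda>x. \<bar>u x\<bar> powr (q - 2) * u x * \<phi> x" and ?p = "\<lambda>x. \<bar>u x\<bar> powr (p - 2) * u x * \<phi> x"
    have iq: "integrable lborel ?q" and ip: "integrable lborel ?p" using i5 q p by auto
    have "(LBINT x. (F\<^sub>1 x + F\<^sub>2 x) * \<phi> x)
        = (LBINT x. \<tau> * ?q x + ?p x - lam * (u x * \<phi> x) - 2 * (u x * (norm (g x))\<^sup>2 * \<phi> x))"
      unfolding F_sum Z_def by (simp add: algebra_simps)
    also have "\<dots> = \<tau> * (LBINT x. ?q x) + (LBINT x. ?p x) - lam * (LBINT x. u x * \<phi> x)
        - 2 * (LBINT x. u x * (norm (g x))\<^sup>2 * \<phi> x)"
      using iq ip i3 i4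
      by (simp only: Bochner_Integration.integral_add Bochner_Integration.integral_diff integral_mult_right_zero
          Bochner_Integration.integrable_add Bochner_Integration.integrable_diff integrable_mult_right)
    finally have rhs: "(LBINT x. (F\<^sub>1 x + F\<^sub>2 x) * \<phi> x) = \<dots>" .
    have "(LBINT x. (1 + 2 * (u x)\<^sup>2) * (g x \<bullet> cgrad \<phi> x))
        = (LBINT x. g x \<bullet> cgrad \<phi> x + 2 * ((u x)\<^sup>2 * (g x \<bullet> cgrad \<phi> x)))"
      by (simp add: algebra_simps)
    also have "\<dots> = (LBINT x. g x \<bullet> cgrad \<phi> x) + 2 * (LBINT x. (u x)\<^sup>2 * (g x \<bullet> cgrad \<phi> x))"
      using i1 i2 by simp
    finally show ?thesis
      using weq[OF bump_test_test_fun[OF \<phi>]] Bochner_Integration.integral_add[OF i2 i3] unfolding rhs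
      by (simp only: distrib_left)
  qed
  \<comment> \<open>Unlike truncation at height \<open>n\<close>, this is differentiable everywhere.
    It is bounded, has derivative \<open>cos (s / Suc n)\<close> tending to 1, and satisfies
    \<open>|\<theta> n s| \<le> |s|\<close>, so both sides of the identity have dominated
    limits.\<close>
  define \<theta> where "\<theta> n s = real (Suc n) * sin (s / real (Suc n))" for n s
  have \<theta>_lip: "\<bar>\<theta> n a - \<theta> n b\<bar> \<le> \<bar>a - b\<bar>" for n a b
  proof -
    have "\<bar>sin x - sin y\<bar> \<le> \<bar>x - y\<bar>" for x y :: real
      using field_differentiable_bound[OF convex_UNIV, of sin cos 1 x y] DERIV_sin by simp
    from mult_left_mono[OF this[of "a / real (Suc n)" "b / real (Suc n)"], of "real (Suc n)"]
    have "\<bar>real (Suc n) * (sin (a / real (Suc n)) - sin (b / real (Suc n)))\<bar>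
        \<le> \<bar>real (Suc n) * (a / real (Suc n) - b / real (Suc n))\<bar>"
      unfolding abs_mult by simp
    then show ?thesis by (simp add: \<theta>_def right_diff_distrib)
  qed
  have \<theta>_le: "\<bar>\<theta> n a\<bar> \<le> \<bar>a\<bar>" for n a using \<theta>_lip[of n a 0] by (simp add: \<theta>_def)
  have identity: "(LBINT x. (1 + 2 * (u x)\<^sup>2) * cos (u x / real (Suc n)) * (norm (g x))\<^sup>2)
      = (LBINT x. (F\<^sub>1 x + F\<^sub>2 x) * \<theta> n (u x))" for n
  proof (rule quasilinear_energy_identity[OF wg u gm g2 ug2 u2 u3 F\<^sub>1 F\<^sub>2 eq, where C = "real (Suc n)"])
    show "(\<theta> n has_real_derivative cos (s / real (Suc n))) (at s)" for s
      unfolding \<theta>_def[abs_def] by (auto intro!: derivative_eq_intros)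
    show "\<bar>\<theta> n a\<bar> \<le> real (Suc n)" for a
      using mult_left_mono[OF abs_sin_le_one, of "real (Suc n)" "a / real (Suc n)"]
      unfolding \<theta>_def abs_mult by simp
  qed (auto simp: \<theta>_lip, simp add: \<theta>_def)
  have inv: "(\<lambda>n. s / real (Suc n)) \<longlonglongrightarrow> 0" for s :: real
    using tendsto_mult_right_zero[OF LIMSEQ_inverse_real_of_nat, of s] by (simp add: divide_inverse)
  have lim1: "(\<lambda>n. \<integral>x. (1 + 2 * (u x)\<^sup>2) * cos (u x / real (Suc n)) * (norm (g x))\<^sup>2 \<partial>lborel)
      \<longlonglongrightarrow> (LBINT x. (norm (g x))\<^sup>2 + 2 * ((u x)\<^sup>2 * (norm (g x))\<^sup>2))"
  proof (rule integral_dominated_convergence[where w = "\<lambda>x. (norm (g x))\<^sup>2 + 2 * ((u x)\<^sup>2 * (norm (g x))\<^sup>2)"])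
    show "AE x in lborel. (\<lambda>n. (1 + 2 * (u x)\<^sup>2) * cos (u x / real (Suc n)) * (norm (g x))\<^sup>2)
        \<longlonglongrightarrow> (norm (g x))\<^sup>2 + 2 * ((u x)\<^sup>2 * (norm (g x))\<^sup>2)"
    proof (rule AE_I2)
      fix x
      have "(\<lambda>n. (1 + 2 * (u x)\<^sup>2) * cos (u x / real (Suc n)) * (norm (g x))\<^sup>2)
          \<longlonglongrightarrow> (1 + 2 * (u x)\<^sup>2) * cos 0 * (norm (g x))\<^sup>2"
        by (intro tendsto_intros inv)
      then show "(\<lambda>n. (1 + 2 * (u x)\<^sup>2) * cos (u x / real (Suc n)) * (norm (g x))\<^sup>2)
        \<longlonglongrightarrow> (norm (g x))\<^sup>2 + 2 * ((u x)\<^sup>2 * (norm (g x))\<^sup>2)"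
        by (simp only: cos_zero mult_1_right distrib_right mult_1_left mult.assoc)
    qed
    show "AE x in lborel. norm ((1 + 2 * (u x)\<^sup>2) * cos (u x / real (Suc n)) * (norm (g x))\<^sup>2)
        \<le> (norm (g x))\<^sup>2 + 2 * ((u x)\<^sup>2 * (norm (g x))\<^sup>2)" for n
    proof (rule AE_I2)
      fix x
      have "norm ((1 + 2 * (u x)\<^sup>2) * cos (u x / real (Suc n)) * (norm (g x))\<^sup>2)
          = (1 + 2 * (u x)\<^sup>2) * (norm (g x))\<^sup>2 * \<bar>cos (u x / real (Suc n))\<bar>"
        by (simp add: abs_mult)
      also have "\<dots> \<le> (1 + 2 * (u x)\<^sup>2) * (norm (g x))\<^sup>2 * 1"
        by (intro mult_left_mono abs_cos_le_one) simp
      finally show "norm ((1 + 2 * (u x)\<^sup>2) * cos (u x / real (Suc n)) * (norm (g x))\<^sup>2)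
        \<le> (norm (g x))\<^sup>2 + 2 * ((u x)\<^sup>2 * (norm (g x))\<^sup>2)"
        by (simp only: mult_1_right distrib_right mult_1_left mult.assoc)
    qed
  qed (use g2 ug2 in simp_all)
  \<comment> \<open>The limit \<open>(F\<^sub>1 + F\<^sub>2) u\<close>; it is integrable although
    the factors are not treated separately. Its term \<open>- 2 u^2 |g|^2\<close> joins
    \<open>2 u^2 |g|^2\<close> from the left side to give the coefficient 4 of the claim.\<close>
  define R where "R x = \<tau> * \<bar>u x\<bar> powr q + \<bar>u x\<bar> powr p - lam * (u x)\<^sup>2 - 2 * ((u x)\<^sup>2 * (norm (g x))\<^sup>2)" for x
  have FR: "(F\<^sub>1 x + F\<^sub>2 x) * u x = R x" for x
  proof -
    have "(F\<^sub>1 x + F\<^sub>2 x) * u x = \<tau> * (\<bar>u x\<bar> powr (q - 2) * u x * u x) + \<bar>u x\<bar> powr (p - 2) * u x * u x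
        - lam * (u x * u x) - 2 * (u x * u x * (norm (g x))\<^sup>2)"
      unfolding F_sum Z_def by (simp add: algebra_simps)
    then show ?thesis unfolding abs_powr_mult_self(2) R_def power2_eq_square[of "u x"] .
  qed
  have uq: "integrable lborel (\<lambda>x. \<bar>u x\<bar> powr q)" using ur q by simp
  have Ri: "integrable lborel R"
    unfolding R_def[abs_def]
    by (intro Bochner_Integration.integrable_diff Bochner_Integration.integrable_add integrable_mult_right
        uq up uL2 ug2)
  have lim2: "(\<lambda>n. \<integral>x. (F\<^sub>1 x + F\<^sub>2 x) * \<theta> n (u x) \<partial>lborel) \<longlonglongrightarrow> (LBINT x. R x)"
  proof (rule integral_dominated_convergence[OF _ _ integrable_abs[OF Ri]])
    have [measurable]: "F\<^sub>1 \<in> borel_measurable borel" "F\<^sub>2 \<in> borel_measurable borel"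
      using F\<^sub>1 square_integrable_measurable[OF F\<^sub>2] by auto
    show "(\<lambda>x. (F\<^sub>1 x + F\<^sub>2 x) * \<theta> n (u x)) \<in> borel_measurable lborel" for n
      unfolding \<theta>_def by measurable
    show "R \<in> borel_measurable lborel" using Ri by simp
    show "AE x in lborel. (\<lambda>n. (F\<^sub>1 x + F\<^sub>2 x) * \<theta> n (u x)) \<longlonglongrightarrow> R x"
      unfolding FR[symmetric]
    proof (intro AE_I2 tendsto_mult tendsto_const)
      fix x
      have "(\<lambda>n. (sin (u x / real (Suc n)) - sin 0) / (1 / real (Suc n))) \<longlonglongrightarrow> cos 0 * u x"
        by (rule has_real_derivative_difference_quotient_tendsto[OF DERIV_sin])
          (use inv[of 1] in simp_all)
      then show "(\<lambda>n. \<theta> n (u x)) \<longlonglongrightarrow> u x" by (simp add: \<theta>_def mult.commute)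
    qed
    show "AE x in lborel. norm ((F\<^sub>1 x + F\<^sub>2 x) * \<theta> n (u x)) \<le> \<bar>R x\<bar>" for n
      unfolding FR[symmetric] real_norm_def abs_mult by (intro AE_I2 mult_left_mono \<theta>_le) simp
  qed
  have "(LBINT x. (norm (g x))\<^sup>2 + 2 * ((u x)\<^sup>2 * (norm (g x))\<^sup>2)) = (LBINT x. R x)"
    by (rule LIMSEQ_unique[OF lim1[unfolded identity] lim2])
  moreover have "(LBINT x. (norm (g x))\<^sup>2 + 2 * ((u x)\<^sup>2 * (norm (g x))\<^sup>2))
      = (LBINT x. (norm (g x))\<^sup>2) + 2 * (LBINT x. (u x)\<^sup>2 * (norm (g x))\<^sup>2)"
    using g2 ug2 by simp
  moreover have "(LBINT x. R x) = \<tau> * (LBINT x. \<bar>u x\<bar> powr q) + (LBINT x. \<bar>u x\<bar> powr p)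
      - lam * (LBINT x. (u x)\<^sup>2) - 2 * (LBINT x. (u x)\<^sup>2 * (norm (g x))\<^sup>2)"
    unfolding R_def using uq up uL2 ug2
    by (simp only: Bochner_Integration.integral_add Bochner_Integration.integral_diff integral_mult_right_zero
        Bochner_Integration.integrable_add Bochner_Integration.integrable_diff integrable_mult_right)
  ultimately show ?thesis by linarith
qed

section \<open>Comparison of the tested equation with the Pohozaev identity\<close>

theorem theorem1p6:
  fixes u :: "'a::euclidean_space \<Rightarrow> real" and q \<tau> c lam :: real
  assumes "DIM('a) \<ge> 3"
    and "2 < q" and "q < 2 * crit_exp TYPE('a)"
    and "\<tau> \<le> 0" and "c > 0"
    and "lam > 0"
  shows "\<not> solution_pair \<tau> q c u lam"
proof
  assume "solution_pair \<tau> q c u lam"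
  then obtain g where X: "Xt_with_grad u g" and c: "(LBINT x. (u x)\<^sup>2) = c"
    and weq: "weak_eq \<tau> q u g lam" and poh: "pohozaev \<tau> q u g lam"
    by (auto simp: solution_pair_def)
  define N where "N = real DIM('a)"
  define p where "p = 2 * crit_exp TYPE('a)"
  define P where "P = (LBINT x. (norm (g x))\<^sup>2)"
  define Q where "Q = (LBINT x. (u x)\<^sup>2 * (norm (g x))\<^sup>2)"
  define B where "B = (LBINT x. \<bar>u x\<bar> powr q)"
  define D where "D = (LBINT x. \<bar>u x\<bar> powr p)"
  have N: "N \<ge> 3" using assms(1) by (simp add: N_def)
  have p_eq: "p = 4 * N / (N - 2)" by (simp add: p_def crit_exp_def N_def)
  have p4: "p \<ge> 4" unfolding p_eq using N by (simp add: field_simps)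
  have Np: "N / p = (N - 2) / 4" unfolding p_eq using N by (simp add: field_simps)
  \<comment> \<open>Subcriticality \<open>q < p\<close> fixes the sign of the coefficient that will
    stand in front of \<open>\<tau> * B\<close>.\<close>
  have Nq: "N / q > (N - 2) / 4"
    unfolding Np[symmetric] using assms(2,3) N by (intro divide_strict_left_mono) (auto simp: p_def)
  \<comment> \<open>The bound on \<open>B\<close> also covers a power that is not integrable, where
    \<open>B\<close> has the default value 0; this matters when \<open>\<bar>u\<bar> powr p\<close>
    is not integrable.\<close>
  have PQ: "P \<ge> 0" "Q \<ge> 0" "B \<ge> 0" by (simp_all add: P_def Q_def B_def)
  have g2: "integrable lborel (\<lambda>x. (norm (g x))\<^sup>2)"
    and ug2: "integrable lborel (\<lambda>x. (u x)\<^sup>2 * (norm (g x))\<^sup>2)"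
    using X by (auto simp: Xt_with_grad_def H1_with_grad_def)
  have "(LBINT x. (1 + 2 * (u x)\<^sup>2) * (norm (g x))\<^sup>2)
      = (LBINT x. (norm (g x))\<^sup>2 + 2 * ((u x)\<^sup>2 * (norm (g x))\<^sup>2))"
    by (simp only: distrib_right mult_1_left mult.assoc)
  also have "\<dots> = P + 2 * Q" using g2 ug2 by (simp add: P_def Q_def)
  finally have poh': "(N - 2) / 2 * (P + 2 * Q) + N * lam / 2 * c = N * \<tau> / q * B + N / p * D"
    using poh c by (simp add: pohozaev_def N_def p_def B_def D_def)
  have \<tau>B: "\<tau> * B \<le> 0" using assms(4) PQ(3) by (rule mult_nonpos_nonneg)
  have lc: "lam * c > 0" using assms(5,6) by simp
  show False
  proof (cases "integrable lborel (\<lambda>x. \<bar>u x\<bar> powr p)")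
    case False
    then have "D = 0" by (simp add: D_def not_integrable_integral_eq)
    moreover have "(N - 2) / 2 * (P + 2 * Q) \<ge> 0" using N PQ by simp
    moreover have "N * lam / 2 * c > 0" using N assms(5,6) by simp
    moreover have "N * \<tau> / q * B \<le> 0"
      using mult_nonneg_nonpos[OF _ \<tau>B, of "N / q"] N assms(2) by simp
    ultimately show False using poh' by simp
  next
    case True
    have "P + 4 * Q + lam * c = \<tau> * B + D"
      unfolding P_def Q_def B_def D_def c[symmetric]
      using weq assms(3)
      by (intro quasilinear_tested_with_solution[OF X True p4 assms(2)]) (auto simp: weak_eq_def p_def)
    then have D: "D = P + 4 * Q + lam * c - \<tau> * B" by linarith
    \<comment> \<open>Because \<open>N / p = (N - 2) / 4\<close>, eliminating \<open>D\<close>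
      cancels the terms in \<open>Q\<close>: both identities contribute \<open>(N - 2) * Q\<close>.
      The coefficient of \<open>P\<close> is halved from \<open>(N - 2) / 2\<close>, and that of
      \<open>lam * c\<close> equals \<open>(N + 2) / 4\<close>.\<close>
    have "(N - 2) / 4 * P + (N / 2 - (N - 2) / 4) * (lam * c) = (N / q - (N - 2) / 4) * (\<tau> * B)"
      using poh' unfolding Np D by (simp add: algebra_simps add_divide_distrib diff_divide_distrib)
    moreover have "(N - 2) / 4 * P \<ge> 0" using N PQ by simp
    moreover have "(N / 2 - (N - 2) / 4) * (lam * c) > 0" using N lc by simp
    moreover have "(N / q - (N - 2) / 4) * (\<tau> * B) \<le> 0" using Nq by (intro mult_nonneg_nonpos[OF _ \<tau>B]) simp
    ultimately show False by linarith
  qed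
qed

end
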